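(* Assume that $g\in C^1(\mathbb R)$, $g(0)=0$; that there exists $\lambda\ge 0$ such that $g'(r)\ge-\lambda$ for all $r\in\mathbb R$; and that $\liminf_{|r|\to\infty}\big(g(r)r+(\lambda_1-\kappa)r^2\big)>0$ for some $\kappa>0$. Set $\beta(r):=g(r)+\lambda r$ and let $\widehat\beta$ be a primitive of $\beta$. Let $u_0\in\mathcal X_{\sigma0}$ with $\widehat\beta(u_0)\in L^1(\Omega)$, and let $(u,w)$ be the unique weak solution of the fractional Cahn-Hilliard system on $(0,\infty)$ with initial datum $u_0$. Then, for any $t_0>0$, $$u_t\in L^2(t_0,\infty;\mathcal X_{\sigma0})\cap L^\infty(t_0,\infty;\mathcal X_{s0}'),\qquad w\in L^\infty(t_0,\infty;\mathcal X_{s0}).$$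
   Context: $\Omega\subset\mathbb R^N$ is a bounded domain with smooth boundary and $s,\sigma\in(0,1)$. Functions in $L^p(\Omega)$ are identified with their extensions by zero to $\mathbb R^N$. For $a\in(0,1)$, $C_a>0$ denotes the normalization constant (depending only on $N$ and $a$) in the singular-integral definition $(-\Delta)^a u(x)=C_a\,\mathrm{p.v.}\int_{\mathbb R^N}\frac{u(x)-u(y)}{|x-y|^{N+2a}}dy$, and $$\mathcal X_{a0}:=\{v\in H^a(\mathbb R^N): v=0\text{ a.e. in }\mathbb R^N\setminus\Omega\},\qquad \|v\|_{\mathcal X_{a0}}^2:=\frac{C_a}{2}\iint_{\mathbb R^{2N}}\frac{|v(x)-v(y)|^2}{|x-y|^{N+2a}}\,dx\,dy,$$ a Hilbert space with dual $\mathcal X_{a0}'$; $\mathcal X_{a0}\hookrightarrow L^2(\Omega)\simeq L^2(\Omega)'\hookrightarrow\mathcal X_{a0}'$. The operator $\mathfrak A_a:\mathcal X_{a0}\to\mathcal X_{a0}'$ is defined by $$\langle\mathfrak A_a u,v\rangle_{\mathcal X_{a0}}=\frac{C_a}{2}\iint_{\mathbb R^{2N}}\frac{(u(x)-u(y))(v(x)-v(y))}{|x-y|^{N+2a}}\,dx\,dy .$$ $\lambda_1=\inf_{v\in\mathcal X_{\sigma0}\setminus\{0\}}\|v\|_{\mathcal X_{\sigma0}}^2/\|v\|_{L^2(\Omega)}^2>0$ is the first eigenvalue of the fractional Dirichlet Laplacian of order $\sigma$. The fractional Cahn-Hilliard system is $u_t+(-\Delta)^s w=0$, $w=(-\Delta)^\sigma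 u+g(u)$ in $\Omega\times(0,\infty)$, $u|_{t=0}=u_0$ in $\Omega$, $u=w=0$ in $\mathbb R^N\setminus\Omega$. Weak solution: for $0\le S<T\le\infty$, $(u,w)$ is a weak solution on $(S,T)$ if $u\in C_w([S,T);\mathcal X_{\sigma0})$ (weakly continuous), $u_t\in L^2(S,T;\mathcal X_{s0}')$, $w\in L^2(S,T;\mathcal X_{s0})$, $g(u)\in L^2_{\rm loc}(S,T;L^2(\Omega))$, and for a.e. $t\in(S,T)$: $u_t(t)+\mathfrak A_s w(t)=0$ in $\mathcal X_{s0}'$ and $w(t)=\mathfrak A_\sigma u(t)+g(u(t))$ in $\mathcal X_{\sigma0}'$; if $S=0$, having initial datum $u_0$ means $u(0)=u_0$. Here $L^p_{\rm loc}(S,T;X)$ means $L^p(S,T;X)$ if $T<\infty$ and $L^p_{\rm loc}([S,\infty);X)$ if $T=\infty$. Under the hypotheses of the claim, a weak solution on $(0,\infty)$ exists and is unique. *)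

theory Defs
  imports "HOL-Analysis.Analysis"
begin

section \<open>Smooth functions and smooth bounded domains\<close>

text \<open>Intended for open \<open>U\<close>.\<close>

primrec Ck_on :: "nat \<Rightarrow> ('a::euclidean_space \<Rightarrow> real) \<Rightarrow> 'a set \<Rightarrow> bool" where
  "Ck_on 0 f U \<longleftrightarrow> continuous_on U f"
| "Ck_on (Suc k) f U \<longleftrightarrow>
     (\<forall>x\<in>U. f differentiable (at x)) \<and>
     (\<forall>i\<in>Basis. Ck_on k (\<lambda>x. frechet_derivative f (at x) i) U)"

definition smooth_on :: "('a::euclidean_space \<Rightarrow> real) \<Rightarrow> 'a set \<Rightarrow> bool" where
  "smooth_on f U \<longleftrightarrow> (\<forall>k. Ck_on k f U)"

text \<open>Smoothness of the boundary is expressed by local defining functions \<open>\<phi>\<close> with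
  non-vanishing differential. Then automatically \<open>frontier \<Omega> \<inter> U = {x \<in> U. \<phi> x = 0}\<close>, and
  \<open>\<Omega>\<close> lies locally on one side of its boundary.\<close>

definition smooth_bounded_domain :: "'a::euclidean_space set \<Rightarrow> bool" where
  "smooth_bounded_domain \<Omega> \<longleftrightarrow>
     open \<Omega> \<and> connected \<Omega> \<and> \<Omega> \<noteq> {} \<and> bounded \<Omega> \<and>
     (\<forall>p\<in>frontier \<Omega>. \<exists>U \<phi>. open U \<and> p \<in> U \<and> smooth_on \<phi> U \<and>
        (\<forall>x\<in>U. \<exists>v. frechet_derivative \<phi> (at x) v \<noteq> 0) \<and>
        \<Omega> \<inter> U = {x \<in> U. \<phi> x < 0})"

section \<open>Fractional Sobolev spaces\<close>

text \<open>Elements of function spaces are represented by functions on the whole space; functions that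
  agree almost everywhere represent the same element. All norms below are therefore seminorms on
  representatives.\<close>

definition L2_space :: "'a::euclidean_space set \<Rightarrow> ('a \<Rightarrow> real) set" where
  "L2_space \<Omega> = {v \<in> borel_measurable lebesgue.
     integrable lebesgue (\<lambda>x. (v x)\<^sup>2) \<and> (AE x in lebesgue. x \<notin> \<Omega> \<longrightarrow> v x = 0)}"

definition L2_pairing :: "'a::euclidean_space set \<Rightarrow> ('a \<Rightarrow> real) \<Rightarrow> ('a \<Rightarrow> real) \<Rightarrow> real" where
  "L2_pairing \<Omega> u v = (LINT x:\<Omega>|lebesgue. u x * v x)"

definition L2_norm :: "'a::euclidean_space set \<Rightarrow> ('a \<Rightarrow> real) \<Rightarrow> real" where
  "L2_norm \<Omega> v = sqrt (LINT x:\<Omega>|lebesgue. (v x)\<^sup>2)"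

text \<open>The normalization constant of the singular-integral fractional Laplacian of order \<open>2 a\<close> in
  dimension \<open>N\<close>, i.e. the reciprocal of the integral of
  \<open>(1 - cos (\<zeta> \<bullet> e)) / norm \<zeta> powr (N + 2 a)\<close> for any unit vector \<open>e\<close> (so that the symbol of the
  operator is \<open>norm \<xi> powr (2 a)\<close>).\<close>

definition frac_const :: "nat \<Rightarrow> real \<Rightarrow> real" where
  "frac_const N a =
     4 powr a * a * Gamma (real N / 2 + a) / (pi powr (real N / 2) * Gamma (1 - a))"

definition frac_sobolev :: "real \<Rightarrow> ('a::euclidean_space \<Rightarrow> real) set" where
  "frac_sobolev a = {v \<in> borel_measurable lebesgue.
     integrable lebesgue (\<lambda>x. (v x)\<^sup>2) \<and>
     integrable lebesgue
       (\<lambda>(x::'a, y::'a). (v x - v y)\<^sup>2 / norm (x - y) powr (real DIM('a) + 2 * a))}"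

definition X_space :: "'a::euclidean_space set \<Rightarrow> real \<Rightarrow> ('a \<Rightarrow> real) set" where
  "X_space \<Omega> a = {v \<in> frac_sobolev a. AE x in lebesgue. x \<notin> \<Omega> \<longrightarrow> v x = 0}"

text \<open>\<open>frac_op a u\<close> is the operator applied to \<open>u\<close>, a functional of the second argument.\<close>

definition frac_op :: "real \<Rightarrow> ('a::euclidean_space \<Rightarrow> real) \<Rightarrow> ('a \<Rightarrow> real) \<Rightarrow> real" where
  "frac_op a u v = frac_const DIM('a) a / 2 *
     (LINT (x::'a, y::'a)|lebesgue.
        (u x - u y) * (v x - v y) / norm (x - y) powr (real DIM('a) + 2 * a))"

definition X_norm :: "real \<Rightarrow> ('a::euclidean_space \<Rightarrow> real) \<Rightarrow> real" where
  "X_norm a v = sqrt (frac_op a v v)"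

definition first_eigenvalue :: "'a::euclidean_space set \<Rightarrow> real \<Rightarrow> real" where
  "first_eigenvalue \<Omega> a =
     (INF v\<in>{v \<in> X_space \<Omega> a. \<not> (AE x in lebesgue. v x = 0)}.
        (X_norm a v)\<^sup>2 / (L2_norm \<Omega> v)\<^sup>2)"

section \<open>Dual spaces\<close>

text \<open>A functional is given on representatives and is arbitrary outside \<open>X\<close>; boundedness makes it
  invariant under change of representative.\<close>

definition dual_space :: "('b \<Rightarrow> real) set \<Rightarrow> (('b \<Rightarrow> real) \<Rightarrow> real) \<Rightarrow> (('b \<Rightarrow> real) \<Rightarrow> real) set" where
  "dual_space X nrm = {l.
     (\<forall>u\<in>X. \<forall>v\<in>X. l (\<lambda>x. u x + v x) = l u + l v) \<and>
     (\<forall>c. \<forall>v\<in>X. l (\<lambda>x. c * v x) = c * l v) \<and>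
     (\<exists>C. \<forall>v\<in>X. \<bar>l v\<bar> \<le> C * nrm v)}"

definition dual_norm :: "('b \<Rightarrow> real) set \<Rightarrow> (('b \<Rightarrow> real) \<Rightarrow> real) \<Rightarrow> (('b \<Rightarrow> real) \<Rightarrow> real) \<Rightarrow> real" where
  "dual_norm X nrm l = (SUP v\<in>{v \<in> X. nrm v \<le> 1}. \<bar>l v\<bar>)"

abbreviation X_dual :: "'a::euclidean_space set \<Rightarrow> real \<Rightarrow> (('a \<Rightarrow> real) \<Rightarrow> real) set" where
  "X_dual \<Omega> a \<equiv> dual_space (X_space \<Omega> a) (X_norm a)"

abbreviation X_dual_norm :: "'a::euclidean_space set \<Rightarrow> real \<Rightarrow> (('a \<Rightarrow> real) \<Rightarrow> real) \<Rightarrow> real" where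
  "X_dual_norm \<Omega> a \<equiv> dual_norm (X_space \<Omega> a) (X_norm a)"

section \<open>Bochner spaces\<close>

text \<open>Below, \<open>X\<close> is a space of real functions (possibly functionals) with seminorm \<open>nrm\<close>, and \<open>I\<close> is
  a Lebesgue measurable set of times.\<close>

definition strongly_measurable_on ::
  "real set \<Rightarrow> ('b \<Rightarrow> real) set \<Rightarrow> (('b \<Rightarrow> real) \<Rightarrow> real) \<Rightarrow> (real \<Rightarrow> 'b \<Rightarrow> real) \<Rightarrow> bool" where
  "strongly_measurable_on I X nrm f \<longleftrightarrow>
     (\<exists>q :: nat \<Rightarrow> real \<Rightarrow> 'b \<Rightarrow> real.
        (\<forall>n. finite (q n ` I) \<and> q n ` I \<subseteq> X \<and> (\<forall>y. {t \<in> I. q n t = y} \<in> sets lebesgue)) \<and>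
        (AE t in lebesgue. t \<in> I \<longrightarrow>
           f t \<in> X \<and> (\<lambda>n. nrm (\<lambda>x. f t x - q n t x)) \<longlonglongrightarrow> 0))"

definition bochner_Lp ::
  "nat \<Rightarrow> real set \<Rightarrow> ('b \<Rightarrow> real) set \<Rightarrow> (('b \<Rightarrow> real) \<Rightarrow> real) \<Rightarrow> (real \<Rightarrow> 'b \<Rightarrow> real) set" where
  "bochner_Lp p I X nrm = {f. strongly_measurable_on I X nrm f \<and>
     set_integrable lebesgue I (\<lambda>t. nrm (f t) ^ p)}"

definition bochner_Linfty ::
  "real set \<Rightarrow> ('b \<Rightarrow> real) set \<Rightarrow> (('b \<Rightarrow> real) \<Rightarrow> real) \<Rightarrow> (real \<Rightarrow> 'b \<Rightarrow> real) set" where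
  "bochner_Linfty I X nrm = {f. strongly_measurable_on I X nrm f \<and>
     (\<exists>C. AE t in lebesgue. t \<in> I \<longrightarrow> nrm (f t) \<le> C)}"

definition time_interval :: "real \<Rightarrow> ereal \<Rightarrow> real set" where
  "time_interval S T = {t. S < t \<and> ereal t < T}"

definition bochner_Lp_loc ::
  "nat \<Rightarrow> real \<Rightarrow> ereal \<Rightarrow> ('b \<Rightarrow> real) set \<Rightarrow> (('b \<Rightarrow> real) \<Rightarrow> real) \<Rightarrow> (real \<Rightarrow> 'b \<Rightarrow> real) set" where
  "bochner_Lp_loc p S T X nrm =
     (if T = \<infinity> then {f. \<forall>T'>S. f \<in> bochner_Lp p (time_interval S (ereal T')) X nrm}
      else bochner_Lp p (time_interval S T) X nrm)"

definition weakly_continuous ::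
  "real \<Rightarrow> ereal \<Rightarrow> ('b \<Rightarrow> real) set \<Rightarrow> (('b \<Rightarrow> real) \<Rightarrow> real) \<Rightarrow> (real \<Rightarrow> 'b \<Rightarrow> real) \<Rightarrow> bool" where
  "weakly_continuous S T X nrm u \<longleftrightarrow>
     (\<forall>t. S \<le> t \<and> ereal t < T \<longrightarrow> u t \<in> X) \<and>
     (\<forall>l\<in>dual_space X nrm. continuous_on {t. S \<le> t \<and> ereal t < T} (\<lambda>t. l (u t)))"

section \<open>Weak solutions\<close>

definition test_function :: "real set \<Rightarrow> (real \<Rightarrow> real) \<Rightarrow> bool" where
  "test_function I \<phi> \<longleftrightarrow> smooth_on \<phi> UNIV \<and> (\<exists>K. compact K \<and> K \<subseteq> I \<and> (\<forall>t. t \<notin> K \<longrightarrow> \<phi> t = 0))"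

text \<open>\<open>u'\<close> is the distributional derivative of \<open>u\<close> on \<open>I\<close>, where \<open>u t\<close> is regarded as the functional
  \<open>L2_pairing \<Omega> (u t)\<close> in the dual of \<open>X_space \<Omega> a\<close>. The identity of dual-valued integrals is written
  out by evaluating both sides at an arbitrary \<open>v\<close>.\<close>

definition has_weak_time_derivative ::
  "'a::euclidean_space set \<Rightarrow> real \<Rightarrow> real set \<Rightarrow>
     (real \<Rightarrow> 'a \<Rightarrow> real) \<Rightarrow> (real \<Rightarrow> ('a \<Rightarrow> real) \<Rightarrow> real) \<Rightarrow> bool" where
  "has_weak_time_derivative \<Omega> a I u u' \<longleftrightarrow>
     (\<forall>K. compact K \<and> K \<subseteq> I \<longrightarrow>
        (\<lambda>t. L2_pairing \<Omega> (u t)) \<in> bochner_Lp 1 K (X_dual \<Omega> a) (X_dual_norm \<Omega> a) \<and>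
        u' \<in> bochner_Lp 1 K (X_dual \<Omega> a) (X_dual_norm \<Omega> a)) \<and>
     (\<forall>\<phi>. test_function I \<phi> \<longrightarrow> (\<forall>v\<in>X_space \<Omega> a.
        (LINT t:I|lebesgue. deriv \<phi> t * L2_pairing \<Omega> (u t) v) =
        - (LINT t:I|lebesgue. \<phi> t * u' t v)))"

definition weak_solution ::
  "'a::euclidean_space set \<Rightarrow> real \<Rightarrow> real \<Rightarrow> (real \<Rightarrow> real) \<Rightarrow> real \<Rightarrow> ereal \<Rightarrow>
     (real \<Rightarrow> 'a \<Rightarrow> real) \<Rightarrow> (real \<Rightarrow> 'a \<Rightarrow> real) \<Rightarrow> bool" where
  "weak_solution \<Omega> s \<sigma> g S T u w \<longleftrightarrow>
     weakly_continuous S T (X_space \<Omega> \<sigma>) (X_norm \<sigma>) u \<and>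
     w \<in> bochner_Lp 2 (time_interval S T) (X_space \<Omega> s) (X_norm s) \<and>
     (\<lambda>t x. g (u t x)) \<in> bochner_Lp_loc 2 S T (L2_space \<Omega>) (L2_norm \<Omega>) \<and>
     (\<exists>u'. has_weak_time_derivative \<Omega> s (time_interval S T) u u' \<and>
        u' \<in> bochner_Lp 2 (time_interval S T) (X_dual \<Omega> s) (X_dual_norm \<Omega> s) \<and>
        (AE t in lebesgue. t \<in> time_interval S T \<longrightarrow>
           (\<forall>v\<in>X_space \<Omega> s. u' t v + frac_op s (w t) v = 0) \<and>
           (\<forall>v\<in>X_space \<Omega> \<sigma>. L2_pairing \<Omega> (w t) v =
              frac_op \<sigma> (u t) v + L2_pairing \<Omega> (\<lambda>x. g (u t x)) v)))"

text \<open>A dual-valued function belongs to \<open>L\<^sup>p(I; X)\<close> when, almost everywhere, it is the image under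
  the embedding through \<open>L\<^sup>2\<close> of an \<open>X\<close>-valued function in that space.\<close>

definition dual_valued_in_Lp_X ::
  "nat \<Rightarrow> real set \<Rightarrow> 'a::euclidean_space set \<Rightarrow> real \<Rightarrow> real \<Rightarrow>
     (real \<Rightarrow> ('a \<Rightarrow> real) \<Rightarrow> real) \<Rightarrow> bool" where
  "dual_valued_in_Lp_X p I \<Omega> s \<sigma> f \<longleftrightarrow>
     (\<exists>z \<in> bochner_Lp p I (X_space \<Omega> \<sigma>) (X_norm \<sigma>).
        AE t in lebesgue. t \<in> I \<longrightarrow> (\<forall>v\<in>X_space \<Omega> s. f t v = L2_pairing \<Omega> (z t) v))"

end

theory Submission
  imports Defs
begin

text \<open>Formally, differentiating the system in time and testing with \<open>u\<^sub>t\<close> gives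
  \<open>1/2 d/dt \<parallel>u\<^sub>t\<parallel>\<^sup>2 + \<parallel>u\<^sub>t\<parallel>\<^sup>2 \<le> lam \<parallel>u\<^sub>t\<parallel>\<^sup>2\<close>, where the norms are those of the dual of
  \<open>X_space \<Omega> s\<close>, of \<open>X_space \<Omega> \<sigma>\<close> and of \<open>L\<^sup>2\<close>. By an inequality of Ehrling type the right-hand side
  is absorbed up to a multiple of the squared dual norm of \<open>u\<^sub>t\<close>, which equals \<open>\<parallel>w\<parallel>\<^sup>2\<close> and is therefore
  integrable on \<open>(0, \<infinity>)\<close>; averaging the resulting inequality over initial times in \<open>(0, t\<^sub>0)\<close>
  bounds \<open>u\<^sub>t\<close> after time \<open>t\<^sub>0\<close>. Rigorously this is done for the difference quotients
  \<open>(u (t + h) - u t) / h\<close>, with bounds uniform in \<open>h\<close>. At almost every time a sequence of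
  them is bounded in \<open>X_space \<Omega> \<sigma>\<close> and Cauchy in the dual norm, hence, again by Ehrling, Cauchy in
  \<open>L\<^sup>2\<close>, and its limit represents \<open>u\<^sub>t\<close>.\<close>


section \<open>Semi-inner product spaces of functions\<close>

text \<open>The equations hold only after testing: the first against
  \<open>X_space \<Omega> s\<close>, the second against \<open>X_space \<Omega> \<sigma>\<close>,
  while u_t lies a priori only in the dual of the former. Testing the second equation with u_t is
  therefore not allowed, but testing it with a time increment of u is, since both end values lie in
  \<open>X_space \<Omega> \<sigma>\<close>; likewise the increment of w is admissible in the first
  equation. The two identities meet in the L^2 pairing of the increments, so no relation between s
  and \<sigma> enters. The nonlinearity is used only through (g x - g y) (x - y) \<ge> - lam (x -
  y)^2, so no time derivative of g(u) appears. Elements are representatives carrying only seminorms,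
  so vector-valued statements are reduced to scalar ones by coordinates in a countable orthonormal
  system, built from the values of approximating simple functions (for w) or from the values at
  rational times (for u). Parseval then gives measurability, dual norms of increments and their
  derivative in time. The limit of the quotients at t is reached along a sequence depending on t, so
  its measurability in t has to be secured separately.\<close>

locale semi_inner_space =
  fixes X :: "('b \<Rightarrow> real) set" and B :: "('b \<Rightarrow> real) \<Rightarrow> ('b \<Rightarrow> real) \<Rightarrow> real"
  assumes zero_mem: "(\<lambda>x. 0) \<in> X"
    and add_mem: "u \<in> X \<Longrightarrow> v \<in> X \<Longrightarrow> (\<lambda>x. u x + v x) \<in> X"
    and scale_mem: "v \<in> X \<Longrightarrow> (\<lambda>x. c * v x) \<in> X"
    and B_add_left: "u \<in> X \<Longrightarrow> v \<in> X \<Longrightarrow> w \<in> X \<Longrightarrow> B (\<lambda>x. u x + v x) w = B u w + B v w"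
    and B_scale_left: "u \<in> X \<Longrightarrow> w \<in> X \<Longrightarrow> B (\<lambda>x. c * u x) w = c * B u w"
    and B_sym: "u \<in> X \<Longrightarrow> v \<in> X \<Longrightarrow> B u v = B v u"
    and B_nonneg: "u \<in> X \<Longrightarrow> 0 \<le> B u u"
begin

definition nrm :: "('b \<Rightarrow> real) \<Rightarrow> real" where "nrm v = sqrt (B v v)"

lemma diff_mem: "u \<in> X \<Longrightarrow> v \<in> X \<Longrightarrow> (\<lambda>x. u x - v x) \<in> X"
  using add_mem[of u "\<lambda>x. (-1) * v x"] scale_mem[of v "-1"] by simp

lemma B_add_right: "u \<in> X \<Longrightarrow> v \<in> X \<Longrightarrow> w \<in> X \<Longrightarrow> B w (\<lambda>x. u x + v x) = B w u + B w v"
  using B_add_left[of u v w] B_sym add_mem by metis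

lemma B_scale_right: "u \<in> X \<Longrightarrow> w \<in> X \<Longrightarrow> B w (\<lambda>x. c * u x) = c * B w u"
  using B_scale_left[of u w c] B_sym scale_mem by metis

lemma B_diff_left: "u \<in> X \<Longrightarrow> v \<in> X \<Longrightarrow> w \<in> X \<Longrightarrow> B (\<lambda>x. u x - v x) w = B u w - B v w"
  using B_add_left[of u "\<lambda>x. (-1) * v x" w] scale_mem[of v "-1"] B_scale_left[of v w "-1"] by simp

lemma B_diff_right: "u \<in> X \<Longrightarrow> v \<in> X \<Longrightarrow> w \<in> X \<Longrightarrow> B w (\<lambda>x. u x - v x) = B w u - B w v"
  using B_diff_left[of u v w] B_sym diff_mem by metis

lemma B_zero_left: "w \<in> X \<Longrightarrow> B (\<lambda>x. 0) w = 0"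
  using B_scale_left[of "\<lambda>x. 0" w 0] zero_mem by simp

lemma B_zero_right: "w \<in> X \<Longrightarrow> B w (\<lambda>x. 0) = 0"
  using B_zero_left[of w] B_sym zero_mem by metis

lemma nrm_nonneg: "u \<in> X \<Longrightarrow> 0 \<le> nrm u"
  by (simp add: nrm_def B_nonneg)

lemma nrm_sq: "u \<in> X \<Longrightarrow> (nrm u)\<^sup>2 = B u u"
  by (simp add: nrm_def B_nonneg)

lemma cauchy_schwarz: 
  assumes "u \<in> X" "v \<in> X" shows "\<bar>B u v\<bar> \<le> nrm u * nrm v"
proof -
  have q: "0 \<le> B u u - 2 * c * B u v + c\<^sup>2 * B v v" for c
  proof -
    have "0 \<le> B (\<lambda>x. u x - c * v x) (\<lambda>x. u x - c * v x)"
      using assms by (intro B_nonneg diff_mem scale_mem)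
    also have "\<dots> = B u u - 2 * c * B u v + c\<^sup>2 * B v v"
      using assms B_sym[of v u]
      by (simp add: B_diff_left B_diff_right B_scale_left B_scale_right scale_mem diff_mem 
          power2_eq_square algebra_simps)
    finally show ?thesis .
  qed
  have "(B u v)\<^sup>2 \<le> B u u * B v v"
  proof (cases "B v v = 0")
    case True
    have "B u v = 0"
    proof (rule ccontr)
      assume n: "B u v \<noteq> 0"
      \<comment> \<open>With \<open>B v v = 0\<close> the quadratic in \<open>q\<close> is affine in
        c with slope \<open>- 2 * B u v\<close>; this choice of c drives it below zero.\<close>
      have "B u u - 2 * ((B u u + 1) / B u v) * B u v < 0"
        using n B_nonneg[OF assms(1)] by simp
      with q[of "(B u u + 1) / B u v"] True show False by simp
    qed
    then show ?thesis using B_nonneg assms by simp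
  next
    case False
    then have p: "B v v > 0" using B_nonneg[OF assms(2)] by simp
    have "0 \<le> B u u - (B u v)\<^sup>2 / B v v"
      using q[of "B u v / B v v"] p by (simp add: power2_eq_square field_simps)
    then show ?thesis using p by (simp add: field_simps)
  qed
  then have "\<bar>B u v\<bar> \<le> sqrt (B u u * B v v)"
    by (metis real_sqrt_abs real_sqrt_le_iff)
  then show ?thesis by (simp add: nrm_def real_sqrt_mult)
qed

lemma B_add_self:
  assumes "u \<in> X" "v \<in> X"
  shows "B (\<lambda>x. u x + v x) (\<lambda>x. u x + v x) = B u u + 2 * B u v + B v v"
  using assms B_sym[of v u] by (simp add: B_add_left B_add_right add_mem)

lemma B_diff_self:
  assumes "u \<in> X" "v \<in> X"
  shows "B (\<lambda>x. u x - v x) (\<lambda>x. u x - v x) = B u u - 2 * B u v + B v v"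
  using assms B_sym[of v u] by (simp add: B_diff_left B_diff_right diff_mem)

lemma nrm_triangle:
  assumes "u \<in> X" "v \<in> X" shows "nrm (\<lambda>x. u x + v x) \<le> nrm u + nrm v"
proof (rule power2_le_imp_le)
  show "(nrm (\<lambda>x. u x + v x))\<^sup>2 \<le> (nrm u + nrm v)\<^sup>2"
    using cauchy_schwarz[OF assms] nrm_sq[OF assms(1)] nrm_sq[OF assms(2)]
    by (simp add: nrm_sq add_mem assms B_add_self power2_sum)
qed (use assms nrm_nonneg in auto)

lemma nrm_scale: "u \<in> X \<Longrightarrow> nrm (\<lambda>x. c * u x) = \<bar>c\<bar> * nrm u"
  unfolding nrm_def
  by (simp add: B_scale_left B_scale_right scale_mem real_sqrt_mult flip: mult.assoc)

lemma nrm_minus_commute: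
  assumes "u \<in> X" "v \<in> X" shows "nrm (\<lambda>x. u x - v x) = nrm (\<lambda>x. v x - u x)"
  using nrm_scale[OF diff_mem[OF assms], of "-1"] by simp

lemma nrm_diff_triangle:
  assumes "u \<in> X" "v \<in> X" "w \<in> X"
  shows "nrm (\<lambda>x. u x - w x) \<le> nrm (\<lambda>x. u x - v x) + nrm (\<lambda>x. v x - w x)"
  using nrm_triangle[OF diff_mem[OF assms(1,2)] diff_mem[OF assms(2,3)]] by simp

lemma sum_mem: "(\<And>k. k \<in> K \<Longrightarrow> e k \<in> X) \<Longrightarrow> (\<lambda>x. \<Sum>k\<in>K. c k * e k x) \<in> X"
  by (induction K rule: infinite_finite_induct) (auto simp: zero_mem add_mem scale_mem)

lemma functional_sum:
  assumes l: "l \<in> dual_space X N" and e: "\<And>k. k \<in> K \<Longrightarrow> e k \<in> X"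
  shows "l (\<lambda>x. \<Sum>k\<in>K. c k * e k x) = (\<Sum>k\<in>K. c k * l (e k))"
proof -
  have a: "l (\<lambda>x. u x + v x) = l u + l v" if "u \<in> X" "v \<in> X" for u v
    using l that by (auto simp: dual_space_def)
  have s: "l (\<lambda>x. c * v x) = c * l v" if "v \<in> X" for c v
    using l that by (auto simp: dual_space_def)
  have z: "l (\<lambda>x. 0) = 0" using s[of "\<lambda>x. 0" 0] zero_mem by simp
  show ?thesis
    using e
  proof (induction K rule: infinite_finite_induct)
    case (insert k K)
    then show ?case
      using a[of "\<lambda>x. c k * e k x" "\<lambda>x. \<Sum>k\<in>K. c k * e k x"] 
      by (simp add: s scale_mem sum_mem)
  qed (simp_all add: z)
qed

lemma functional_diff:
  assumes l: "l \<in> dual_space X N" and "u \<in> X" "v \<in> X"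
  shows "l (\<lambda>x. u x - v x) = l u - l v"
proof -
  have "l (\<lambda>x. u x + (-1) * v x) = l u + l (\<lambda>x. (-1) * v x)"
  proof -
    have "\<forall>a\<in>X. \<forall>b\<in>X. l (\<lambda>x. a x + b x) = l a + l b"
      using l by (simp add: dual_space_def)
    from bspec[OF bspec[OF this assms(2)] scale_mem[OF assms(3), of "-1"]] show ?thesis by simp
  qed
  moreover have "l (\<lambda>x. (-1) * v x) = (-1) * l v"
    using l assms unfolding dual_space_def by blast
  ultimately show ?thesis by simp
qed

lemma B_in_dual:
  assumes "v \<in> X" shows "(\<lambda>u. B u v) \<in> dual_space X nrm"
  unfolding dual_space_def
  using assms cauchy_schwarz[OF _ assms]
  by (auto simp: B_add_left B_scale_left intro!: exI[of _ "nrm v"] simp: mult.commute)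

lemma B_sum_left:
  assumes "\<And>k. k \<in> K \<Longrightarrow> e k \<in> X" "v \<in> X"
  shows "B (\<lambda>x. \<Sum>k\<in>K. c k * e k x) v = (\<Sum>k\<in>K. c k * B (e k) v)"
  using functional_sum[OF B_in_dual[OF assms(2)], of K e c] assms(1) by simp

subsection \<open>Orthonormal systems\<close>

text \<open>Members of norm zero are allowed, so that Gram-Schmidt need not skip indices.\<close>

definition orthosys :: "(nat \<Rightarrow> 'b \<Rightarrow> real) \<Rightarrow> bool" where
  "orthosys e \<longleftrightarrow> (\<forall>k. e k \<in> X) \<and> (\<forall>i j. i \<noteq> j \<longrightarrow> B (e i) (e j) = 0) \<and>
     (\<forall>k. B (e k) (e k) = 0 \<or> B (e k) (e k) = 1)"

definition proj :: "(nat \<Rightarrow> 'b \<Rightarrow> real) \<Rightarrow> nat \<Rightarrow> ('b \<Rightarrow> real) \<Rightarrow> 'b \<Rightarrow> real" where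
  "proj e n v = (\<lambda>x. \<Sum>k<n. B v (e k) * e k x)"

text \<open>Parseval's identity expresses that \<open>v\<close> lies in the closed span of \<open>e\<close>.\<close>

definition spanned :: "(nat \<Rightarrow> 'b \<Rightarrow> real) \<Rightarrow> ('b \<Rightarrow> real) \<Rightarrow> bool" where
  "spanned e v \<longleftrightarrow> v \<in> X \<and> (\<lambda>k. (B v (e k))\<^sup>2) sums B v v"

lemma orthosys_mem: "orthosys e \<Longrightarrow> e k \<in> X"
  by (simp add: orthosys_def)

lemma proj_mem: "orthosys e \<Longrightarrow> proj e n v \<in> X"
  unfolding proj_def by (intro sum_mem) (simp add: orthosys_def)

text \<open>A member of norm zero is orthogonal to everything by Cauchy-Schwarz, so the factor
  \<open>B (e k) (e k)\<close>, which is 0 or 1, can always be dropped. This makes degenerate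
  members harmless in the projection formulas.\<close>

lemma B_orthosys_self:
  assumes "orthosys e" "v \<in> X" shows "B v (e k) * B (e k) (e k) = B v (e k)"
proof (cases "B (e k) (e k) = 0")
  case True
  then have "nrm (e k) = 0" by (simp add: nrm_def)
  then show ?thesis using cauchy_schwarz[of v "e k"] assms by (simp add: orthosys_mem)
next
  case False
  then show ?thesis using assms(1) by (auto simp: orthosys_def)
qed

lemma B_combination:
  assumes "orthosys e"
  shows "B (\<lambda>x. \<Sum>k<n. c k * e k x) (e j) = (if j < n then c j * B (e j) (e j) else 0)"
proof -
  have "B (\<lambda>x. \<Sum>k<n. c k * e k x) (e j) = (\<Sum>k<n. c k * B (e k) (e j))"
    using assms by (intro B_sum_left) (auto simp: orthosys_mem)
  also have "\<dots> = (\<Sum>k<n. if k = j then c j * B (e j) (e j) else 0)"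
    using assms by (intro sum.cong) (auto simp: orthosys_def)
  finally show ?thesis by (simp add: sum.delta)
qed

text \<open>Only an inequality, because members of norm zero contribute to the right-hand side but
  not to the left.\<close>

lemma B_combination_self_le:
  assumes "orthosys e"
  shows "B (\<lambda>x. \<Sum>k<n. c k * e k x) (\<lambda>x. \<Sum>k<n. c k * e k x) \<le> (\<Sum>k<n. (c k)\<^sup>2)"
proof -
  let ?s = "\<lambda>x. \<Sum>k<n. c k * e k x"
  have m: "?s \<in> X" using assms by (intro sum_mem) (simp add: orthosys_mem)
  have "B ?s ?s = (\<Sum>k<n. c k * B (e k) ?s)"
    using assms m by (intro B_sum_left) (auto simp: orthosys_mem)
  also have "\<dots> = (\<Sum>k<n. c k * B ?s (e k))"
    using assms m B_sym by (intro sum.cong) (auto simp: orthosys_mem)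
  also have "\<dots> = (\<Sum>k<n. (c k)\<^sup>2 * B (e k) (e k))"
    using assms by (intro sum.cong) (auto simp: B_combination power2_eq_square)
  also have "\<dots> \<le> (\<Sum>k<n. (c k)\<^sup>2)"
  proof (rule sum_mono)
    show "(c i)\<^sup>2 * B (e i) (e i) \<le> (c i)\<^sup>2" for i
      using assms unfolding orthosys_def by (cases "B (e i) (e i) = 0") auto
  qed
  finally show ?thesis .
qed

lemma B_proj_left:
  assumes "orthosys e" "v \<in> X" "w \<in> X"
  shows "B (proj e n v) w = (\<Sum>k<n. B v (e k) * B w (e k))"
  unfolding proj_def using assms B_sym
  by (subst B_sum_left) (auto simp: orthosys_mem intro!: sum.cong)

lemma B_proj_self:
  assumes "orthosys e" "v \<in> X"
  shows "B (proj e n v) (proj e n v) = (\<Sum>k<n. (B v (e k))\<^sup>2)"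
proof -
  have "B (proj e n v) (e k) = B v (e k)" if "k < n" for k
    using B_combination[OF assms(1), of "\<lambda>k. B v (e k)" n k] B_orthosys_self[OF assms, of k] that
    by (simp add: proj_def)
  then show ?thesis
    using assms by (subst B_proj_left) (auto simp: proj_mem power2_eq_square)
qed

lemma proj_residual:
  assumes "orthosys e" "v \<in> X"
  shows "B (\<lambda>x. v x - proj e n v x) (\<lambda>x. v x - proj e n v x) = B v v - (\<Sum>k<n. (B v (e k))\<^sup>2)"
proof -
  have "B v (proj e n v) = (\<Sum>k<n. (B v (e k))\<^sup>2)"
    using assms B_sym[of v "proj e n v"] 
    by (simp add: proj_mem B_proj_left power2_eq_square)
  then show ?thesis
    using assms by (simp add: B_diff_self proj_mem B_proj_self)
qed

lemma bessel:
  assumes "orthosys e" "v \<in> X"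
  shows "(\<Sum>k<n. (B v (e k))\<^sup>2) \<le> B v v"
  using proj_residual[OF assms, of n] B_nonneg[OF diff_mem[OF assms(2) proj_mem[OF assms(1)]], of n v] 
  by simp

lemma bessel_summable:
  assumes "orthosys e" "v \<in> X"
  shows "summable (\<lambda>k. (B v (e k))\<^sup>2)"
  by (rule bounded_imp_summable[where B = "B v v"])
     (use bessel[OF assms, of "Suc _"] in \<open>auto simp: lessThan_Suc_atMost\<close>)

text \<open>The Parseval defect after n terms is the squared distance from v to its n-th projection
  (\<open>proj_residual\<close>), so Parseval's identity and convergence of the projections are the
  same statement.\<close>

lemma spanned_iff_residual:
  assumes "orthosys e" "v \<in> X"
  shows "spanned e v \<longleftrightarrow> (\<lambda>n. nrm (\<lambda>x. v x - proj e n v x)) \<longlonglongrightarrow> 0"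
proof -
  have "spanned e v \<longleftrightarrow> (\<lambda>n. B v v - (\<Sum>k<n. (B v (e k))\<^sup>2)) \<longlonglongrightarrow> 0"
    using assms(2) LIM_zero_iff[of "\<lambda>n. \<Sum>k<n. (B v (e k))\<^sup>2" "B v v" sequentially]
      tendsto_minus_cancel_left[of "\<lambda>n. (\<Sum>k<n. (B v (e k))\<^sup>2) - B v v" 0 sequentially] 
    by (simp add: spanned_def sums_def)
  also have "\<dots> \<longleftrightarrow> (\<lambda>n. (nrm (\<lambda>x. v x - proj e n v x))\<^sup>2) \<longlonglongrightarrow> 0"
    using assms by (simp add: nrm_sq diff_mem proj_mem proj_residual)
  also have "\<dots> \<longleftrightarrow> (\<lambda>n. nrm (\<lambda>x. v x - proj e n v x)) \<longlonglongrightarrow> 0"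
  proof
    assume "(\<lambda>n. (nrm (\<lambda>x. v x - proj e n v x))\<^sup>2) \<longlonglongrightarrow> 0"
    from tendsto_real_sqrt[OF this] show "(\<lambda>n. nrm (\<lambda>x. v x - proj e n v x)) \<longlonglongrightarrow> 0"
      using assms by (simp add: nrm_nonneg diff_mem proj_mem)
  next
    assume "(\<lambda>n. nrm (\<lambda>x. v x - proj e n v x)) \<longlonglongrightarrow> 0"
    from tendsto_power[OF this, of 2] show "(\<lambda>n. (nrm (\<lambda>x. v x - proj e n v x))\<^sup>2) \<longlonglongrightarrow> 0"
      by simp
  qed
  finally show ?thesis .
qed

text \<open>Boundedness lets l pass to the limit along the projections of v. Consequently a bounded
  functional that vanishes on every \<open>e k\<close> vanishes on all spanned elements.\<close>

lemma spanned_functional_sums: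
  assumes e: "orthosys e" and v: "spanned e v" and l: "l \<in> dual_space X nrm"
  shows "(\<lambda>k. B v (e k) * l (e k)) sums l v"
proof -
  have vX: "v \<in> X" using v by (simp add: spanned_def)
  obtain C where C: "\<bar>l w\<bar> \<le> C * nrm w" if "w \<in> X" for w
    using l unfolding dual_space_def by blast
  have "(\<lambda>n. nrm (\<lambda>x. v x - proj e n v x)) \<longlonglongrightarrow> 0"
    using spanned_iff_residual[OF e vX] v by simp
  then have "(\<lambda>n. C * nrm (\<lambda>x. v x - proj e n v x)) \<longlonglongrightarrow> 0"
    using tendsto_mult_right_zero by blast
  then have "(\<lambda>n. l (\<lambda>x. v x - proj e n v x)) \<longlonglongrightarrow> 0"
    by (rule Lim_null_comparison[rotated]) (use C vX e in \<open>auto simp: diff_mem proj_mem\<close>)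
  then have "(\<lambda>n. l v - l (proj e n v)) \<longlonglongrightarrow> 0"
    using functional_diff[OF l vX proj_mem[OF e]] by simp
  then have "(\<lambda>n. l (proj e n v)) \<longlonglongrightarrow> l v"
    using tendsto_diff[of "\<lambda>_. l v" "l v" sequentially "\<lambda>n. l v - l (proj e n v)" 0] by simp
  then show ?thesis
    unfolding sums_def using functional_sum[OF l, of "{..<_}" e "\<lambda>k. B v (e k)"] e
    by (simp add: proj_def orthosys_mem)
qed

lemma spanned_parseval:
  assumes "orthosys e" "spanned e u" "v \<in> X"
  shows "(\<lambda>k. B u (e k) * B v (e k)) sums B u v"
  using spanned_functional_sums[OF assms(1,2) B_in_dual[OF assms(3)]] B_sym[OF orthosys_mem[OF assms(1)] assms(3)]
  by simp

lemma spanned_combination: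
  assumes e: "orthosys e"
  shows "spanned e (\<lambda>x. \<Sum>k<n. c k * e k x)"
proof -
  let ?s = "\<lambda>x. \<Sum>k<n. c k * e k x"
  have m: "?s \<in> X" using e by (intro sum_mem) (simp add: orthosys_mem)
  have "B ?s ?s = (\<Sum>k<n. c k * B (e k) ?s)"
    using e m by (intro B_sum_left) (auto simp: orthosys_mem)
  also have "\<dots> = (\<Sum>k<n. c k * B ?s (e k))"
    using e m B_sym by (intro sum.cong) (auto simp: orthosys_mem)
  also have "\<dots> = (\<Sum>k<n. (B ?s (e k))\<^sup>2)"
  proof (rule sum.cong)
    fix k assume "k \<in> {..<n}"
    then have k: "B ?s (e k) = c k * B (e k) (e k)" using B_combination[OF e, of c n k] by simp
    show "c k * B ?s (e k) = (B ?s (e k))\<^sup>2"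
      unfolding k using e unfolding orthosys_def 
      by (cases "B (e k) (e k) = 0") (auto simp: power2_eq_square)
  qed simp
  finally have "B ?s ?s = (\<Sum>k<n. (B ?s (e k))\<^sup>2)" .
  moreover have "(\<lambda>k. (B ?s (e k))\<^sup>2) sums (\<Sum>k<n. (B ?s (e k))\<^sup>2)"
    by (rule sums_finite) (auto simp: B_combination[OF e])
  ultimately show ?thesis using m by (simp add: spanned_def)
qed

lemma spanned_diff:
  assumes e: "orthosys e" and u: "spanned e u" and v: "spanned e v"
  shows "spanned e (\<lambda>x. u x - v x)"
proof -
  have m: "u \<in> X" "v \<in> X" using u v by (auto simp: spanned_def)
  have "(\<lambda>k. (B u (e k))\<^sup>2 - 2 * (B u (e k) * B v (e k)) + (B v (e k))\<^sup>2) sums 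
        (B u u - 2 * B u v + B v v)"
    using u v spanned_parseval[OF e u m(2)]
    by (intro sums_add sums_diff sums_mult) (auto simp: spanned_def)
  then show ?thesis
    using m e unfolding spanned_def
    by (simp add: diff_mem B_diff_self B_diff_left orthosys_mem power2_diff algebra_simps)
qed

lemma spanned_scale:
  assumes e: "orthosys e" and v: "spanned e v"
  shows "spanned e (\<lambda>x. c * v x)"
proof -
  have m: "v \<in> X" using v by (auto simp: spanned_def)
  have "(\<lambda>k. c\<^sup>2 * (B v (e k))\<^sup>2) sums (c\<^sup>2 * B v v)"
    using v by (intro sums_mult) (auto simp: spanned_def)
  then show ?thesis
    using m e unfolding spanned_def
    by (simp add: scale_mem B_scale_left B_scale_right orthosys_mem power_mult_distrib) 
       (simp add: power2_eq_square mult.assoc)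
qed

text \<open>The converse of the uniqueness principle contained in
  \<open>spanned_functional_sums\<close>. As X need not be complete, the projections of v need not
  converge in X, so the component of v orthogonal to the system may not exist as an element. The
  pairing with it, \<open>m\<close>, still exists as a bounded functional: it is the pointwise limit
  of pairings with the finite residuals, whose norms are at most \<open>nrm v\<close>. It kills
  every \<open>e j\<close>, hence \<open>m v = 0\<close>, which is Parseval's identity.\<close>

lemma spanned_if_annihilated:
  assumes e: "orthosys e" and v: "v \<in> X"
    and l: "\<And>l. l \<in> dual_space X nrm \<Longrightarrow> (\<And>k. l (e k) = 0) \<Longrightarrow> l v = 0"
  shows "spanned e v"
proof -
  note eX = orthosys_mem[OF e]
  have sm: "summable (\<lambda>k. B v (e k) * B w (e k))" if w: "w \<in> X" for w
  proof (rule summable_comparison_test)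
    show "summable (\<lambda>k. (B v (e k))\<^sup>2 + (B w (e k))\<^sup>2)"
      using bessel_summable[OF e] v w by (intro summable_add)
    have "\<bar>a * b\<bar> \<le> a\<^sup>2 + b\<^sup>2" for a b :: real
    proof -
      have "0 \<le> (\<bar>a\<bar> - \<bar>b\<bar>)\<^sup>2" by simp
      then have "2 * (\<bar>a\<bar> * \<bar>b\<bar>) \<le> a\<^sup>2 + b\<^sup>2" by (simp add: power2_diff)
      then show ?thesis by (simp add: abs_mult) (smt (verit) mult_nonneg_nonneg)
    qed
    then show "\<exists>N. \<forall>n\<ge>N. norm (B v (e n) * B w (e n)) \<le> (B v (e n))\<^sup>2 + (B w (e n))\<^sup>2"
      by auto
  qed
  define m where "m = (\<lambda>w. B v w - (\<Sum>k. B v (e k) * B w (e k)))"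
  have "m \<in> dual_space X nrm"
    unfolding dual_space_def
  proof (intro CollectI conjI ballI allI exI[of _ "nrm v"])
    fix a b assume "a \<in> X" "b \<in> X"
    then show "m (\<lambda>x. a x + b x) = m a + m b"
      using v eX sm
      by (simp add: m_def B_add_right B_add_left distrib_left suminf_add[symmetric])
  next
    fix c b assume "b \<in> X"
    then show "m (\<lambda>x. c * b x) = c * m b"
      using v eX sm suminf_mult[OF sm, of b c]
      by (simp add: m_def B_scale_right B_scale_left right_diff_distrib ac_simps)
  next
    fix w assume w: "w \<in> X"
    have "(\<lambda>n. B (\<lambda>x. v x - proj e n v x) w) \<longlonglongrightarrow> m w"
    proof -
      have "(\<lambda>n. B v w - (\<Sum>k<n. B v (e k) * B w (e k))) \<longlonglongrightarrow> m w"
        unfolding m_def using summable_LIMSEQ[OF sm[OF w]] by (intro tendsto_intros)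
      then show ?thesis using v w e by (simp add: B_diff_left proj_mem B_proj_left)
    qed
    moreover have "\<bar>B (\<lambda>x. v x - proj e n v x) w\<bar> \<le> nrm v * nrm w" for n
    proof -
      have "nrm (\<lambda>x. v x - proj e n v x) \<le> nrm v"
        unfolding nrm_def using proj_residual[OF e v, of n]
        by (simp add: sum_nonneg)
      moreover have "(\<lambda>x. v x - proj e n v x) \<in> X" by (rule diff_mem[OF v proj_mem[OF e]])
      ultimately show ?thesis
        using cauchy_schwarz[OF _ w] mult_right_mono[OF _ nrm_nonneg[OF w]] order_trans by blast
    qed
    ultimately show "\<bar>m w\<bar> \<le> nrm v * nrm w"
      using tendsto_rabs LIMSEQ_le_const2 by blast
  qed
  moreover have "m (e j) = 0" for j
  proof -
    have "(\<lambda>k. B v (e k) * B (e j) (e k)) = (\<lambda>k. if k = j then B v (e j) * B (e j) (e j) else 0)"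
      using e by (auto simp: orthosys_def)
    then have "(\<Sum>k. B v (e k) * B (e j) (e k)) = B v (e j) * B (e j) (e j)"
      using sums_single[of j "\<lambda>_. B v (e j) * B (e j) (e j)"] by (simp add: sums_iff)
    then show ?thesis by (simp add: m_def B_orthosys_self[OF e v])
  qed
  ultimately have "m v = 0" using l by blast
  then have "(\<Sum>k. (B v (e k))\<^sup>2) = B v v" by (simp add: m_def power2_eq_square)
  then show ?thesis using bessel_summable[OF e v] v by (simp add: spanned_def sums_iff)
qed

text \<open>A bounded functional that kills the system kills the approximants \<open>y\<close> and
  therefore, by continuity, v; the annihilator criterion then spares any estimate of Parseval
  sums.\<close>

lemma spanned_closed:
  assumes e: "orthosys e" and v: "v \<in> X"
    and d: "\<And>\<epsilon>. \<epsilon> > 0 \<Longrightarrow> \<exists>y. spanned e y \<and> nrm (\<lambda>x. v x - y x) < \<epsilon>"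
  shows "spanned e v"
proof (rule spanned_if_annihilated[OF e v])
  fix l assume l: "l \<in> dual_space X nrm" and z: "\<And>k. l (e k) = 0"
  obtain C where C: "\<bar>l w\<bar> \<le> C * nrm w" if "w \<in> X" for w
    using l unfolding dual_space_def by blast
  show "l v = 0"
  proof (rule ccontr)
    assume "l v \<noteq> 0"
    then have "\<bar>l v\<bar> / (\<bar>C\<bar> + 1) > 0" by simp
    from d[OF this] obtain y where y: "spanned e y" "nrm (\<lambda>x. v x - y x) < \<bar>l v\<bar> / (\<bar>C\<bar> + 1)"
      by blast
    have yX: "y \<in> X" using y by (simp add: spanned_def)
    have "l y = 0" using spanned_functional_sums[OF e y(1) l] z by (simp add: sums_iff)
    then have "\<bar>l v\<bar> = \<bar>l (\<lambda>x. v x - y x)\<bar>" using functional_diff[OF l v yX] by simp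
    also have "\<dots> \<le> \<bar>C\<bar> * nrm (\<lambda>x. v x - y x)"
      using C[OF diff_mem[OF v yX]] mult_right_mono[OF abs_ge_self nrm_nonneg[OF diff_mem[OF v yX]]]
      by (rule order_trans)
    also have "\<dots> \<le> (\<bar>C\<bar> + 1) * nrm (\<lambda>x. v x - y x)"
      using nrm_nonneg[OF diff_mem[OF v yX]] by (intro mult_right_mono) auto
    also have "\<dots> < \<bar>l v\<bar>" using y(2) by (simp add: field_simps)
    finally show False by simp
  qed
qed

text \<open>Convergence is assumed only against elements of X, which need not exhaust the dual, so
  the annihilator criterion does not apply directly. Instead the residual \<open>y n\<close> of z
  serves as test element: \<open>B (v j) (y n)\<close> is the tail of a Parseval series and, by
  Cauchy-Schwarz, at most C times the square root of the tail of the series of z, uniformly in j.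
  Letting j grow bounds the squared norm of \<open>y n\<close> by a quantity that vanishes with
  n.\<close>

lemma spanned_weak_limit:
  fixes v :: "nat \<Rightarrow> 'b \<Rightarrow> real"
  assumes e: "orthosys e" and z: "z \<in> X" and v: "\<And>j. spanned e (v j)"
    and bd: "\<And>j. nrm (v j) \<le> C"
    and lim: "\<And>y. y \<in> X \<Longrightarrow> (\<lambda>j. B (v j) y) \<longlonglongrightarrow> B z y"
  shows "spanned e z"
proof -
  note eX = orthosys_mem[OF e]
  have vX: "v j \<in> X" for j using v by (simp add: spanned_def)
  have C0: "C \<ge> 0" using bd[of 0] nrm_nonneg[OF vX[of 0]] by linarith
  define y where "y = (\<lambda>n x. z x - proj e n z x)"
  have yX: "y n \<in> X" for n unfolding y_def using z e by (intro diff_mem proj_mem)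
  let ?r = "\<lambda>k. (B z (e k))\<^sup>2"
  have sm: "summable ?r" by (rule bessel_summable[OF e z])
  \<comment> \<open>The residual is orthogonal to the projection.\<close>
  have 1: "B z (y n) = B (y n) (y n)" for n
  proof -
    have p: "proj e n z \<in> X" by (rule proj_mem[OF e])
    show ?thesis
      using proj_residual[OF e z, of n] B_diff_right[OF z p z]
        B_proj_left[OF e z z, of n] B_sym[OF z p]
      by (simp add: y_def power2_eq_square)
  qed
  have 2: "\<bar>B (v j) (y n)\<bar> \<le> C * sqrt (suminf ?r - (\<Sum>k<n. ?r k))" for j n
  proof -
    have s: "(\<lambda>k. B (v j) (e k) * B z (e k)) sums B (v j) z"
      by (rule spanned_parseval[OF e v z])
    have B: "B (v j) (y n) = B (v j) z - (\<Sum>k<n. B (v j) (e k) * B z (e k))"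
    proof -
      have p: "proj e n z \<in> X" by (rule proj_mem[OF e])
      show ?thesis
        using B_diff_right[OF z p vX[of j]] B_proj_left[OF e z vX[of j], of n] B_sym[OF vX[of j] p]
        by (simp add: y_def mult.commute)
    qed
    have "(\<lambda>m. \<Sum>k<m. B (v j) (e (k+n)) * B z (e (k+n))) \<longlonglongrightarrow> B (v j) (y n)"
      using sums_split_initial_segment[OF s, of n] unfolding B sums_def by simp
    moreover have "\<bar>\<Sum>k<m. B (v j) (e (k+n)) * B z (e (k+n))\<bar> \<le> C * sqrt (suminf ?r - (\<Sum>k<n. ?r k))" for m
    proof -
      have "\<bar>\<Sum>k<m. B (v j) (e (k+n)) * B z (e (k+n))\<bar> 
          \<le> L2_set (\<lambda>k. B (v j) (e (k+n))) {..<m} * L2_set (\<lambda>k. B z (e (k+n))) {..<m}"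
        by (rule order_trans[OF sum_abs]) (use L2_set_mult_ineq in \<open>auto simp: abs_mult\<close>)
      also have "\<dots> \<le> C * sqrt (suminf ?r - (\<Sum>k<n. ?r k))"
      proof (intro mult_mono)
        have "(\<Sum>k<m. (B (v j) (e (k+n)))\<^sup>2) = (\<Sum>k\<in>{n..<m+n}. (B (v j) (e k))\<^sup>2)"
          by (rule sum.reindex_bij_witness[of _ "\<lambda>k. k - n" "\<lambda>k. k + n"]) auto
        also have "\<dots> \<le> (\<Sum>k<m+n. (B (v j) (e k))\<^sup>2)"
          by (intro sum_mono2) auto
        also have "\<dots> \<le> B (v j) (v j)" by (rule bessel[OF e vX])
        finally show "L2_set (\<lambda>k. B (v j) (e (k+n))) {..<m} \<le> C"
          using bd[of j] by (auto simp: L2_set_def nrm_def intro: order_trans[OF real_sqrt_le_mono])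
        have "(\<Sum>k<m. (B z (e (k+n)))\<^sup>2) \<le> (\<Sum>k. ?r (k + n))"
          using summable_ignore_initial_segment[OF sm, of n] by (intro sum_le_suminf) auto
        also have "\<dots> = suminf ?r - (\<Sum>k<n. ?r k)"
          by (rule suminf_minus_initial_segment[OF sm])
        finally show "L2_set (\<lambda>k. B z (e (k+n))) {..<m} \<le> sqrt (suminf ?r - (\<Sum>k<n. ?r k))"
          by (auto simp: L2_set_def)
      qed (use C0 in \<open>auto simp: L2_set_nonneg\<close>)
      finally show ?thesis .
    qed
    ultimately show ?thesis using tendsto_rabs LIMSEQ_le_const2 by blast
  qed
  have 3: "B (y n) (y n) \<le> C * sqrt (suminf ?r - (\<Sum>k<n. ?r k))" for n
  proof -
    have "B z (y n) \<le> C * sqrt (suminf ?r - (\<Sum>k<n. ?r k))"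
      using LIMSEQ_le_const2[OF lim[OF yX[of n]]] 2[of _ n] abs_le_D1 by blast
    then show ?thesis by (simp add: 1)
  qed
  have "(\<lambda>n. C * sqrt (suminf ?r - (\<Sum>k<n. ?r k))) \<longlonglongrightarrow> C * sqrt (suminf ?r - suminf ?r)"
    by (intro tendsto_intros summable_LIMSEQ sm)
  then have "(\<lambda>n. B (y n) (y n)) \<longlonglongrightarrow> 0"
    by (intro tendsto_sandwich[of "\<lambda>_. 0" "\<lambda>n. B (y n) (y n)" sequentially]) (use 3 B_nonneg[OF yX] in auto)
  from tendsto_real_sqrt[OF this] show ?thesis
    unfolding spanned_iff_residual[OF e z] by (simp add: nrm_def y_def)
qed

text \<open>Each stage is a whole sequence, because \<open>proj\<close> expects one; stage
  \<open>Suc n\<close> changes index n only, so the entries \<open>gs d (Suc k) k\<close> form the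
  final system. When the residual has norm zero, \<open>inverse 0 = 0\<close> puts the zero function
  at its index.\<close>

primrec gs :: "(nat \<Rightarrow> 'b \<Rightarrow> real) \<Rightarrow> nat \<Rightarrow> nat \<Rightarrow> 'b \<Rightarrow> real" where
  "gs d 0 = (\<lambda>_ _. 0)"
| "gs d (Suc n) = (gs d n)(n := (\<lambda>x. inverse (nrm (\<lambda>x. d n x - proj (gs d n) n (d n) x)) * 
      (d n x - proj (gs d n) n (d n) x)))"

lemma gs_stable: "k < n \<Longrightarrow> gs d n k = gs d (Suc k) k"
proof (induction n)
  case (Suc n)
  show ?case
  proof (cases "k = n")
    case False
    then have "gs d (Suc n) k = gs d n k" by simp
    then show ?thesis using Suc False by simp
  qed simp
qed simp

lemma gram_schmidt:
  assumes d: "\<And>n::nat. d n \<in> X"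
  obtains e where "orthosys e" "\<And>n. spanned e (d n)"
proof -
  define e where "e = (\<lambda>k. gs d (Suc k) k)"
  define r where "r = (\<lambda>n x. d n x - proj e n (d n) x)"
  have ge: "gs d n k = e k" if "k < n" for n k
    unfolding e_def using that by (rule gs_stable)
  have pr: "proj (gs d n) n v = proj e n v" for n v
    unfolding proj_def by (intro ext sum.cong) (auto simp: ge)
  have er: "e n = (\<lambda>x. inverse (nrm (r n)) * r n x)" for n
  proof -
    have "gs d (Suc n) n = (\<lambda>x. inverse (nrm (r n)) * r n x)"
      by (simp add: r_def pr)
    then show ?thesis by (simp add: e_def del: gs.simps)
  qed
  have ortho_n: "(\<forall>k<n. e k \<in> X) \<and> (\<forall>i<n. \<forall>j<n. i \<noteq> j \<longrightarrow> B (e i) (e j) = 0) \<and>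
     (\<forall>k<n. B (e k) (e k) = 0 \<or> B (e k) (e k) = 1)" for n
  proof (induction n)
    case (Suc n)
    \<comment> \<open>Padding with zeros turns the part built so far into an
      \<open>orthosys\<close>, so the projection lemmas apply inside the induction.\<close>
    define e' where "e' = (\<lambda>k. if k < n then e k else (\<lambda>x. 0))"
    have o: "orthosys e'"
      unfolding orthosys_def e'_def using Suc
      by (auto simp: zero_mem B_zero_left B_zero_right)
    have p: "proj e n v = proj e' n v" for v
      unfolding proj_def e'_def by (intro ext sum.cong) auto
    have rX: "r n \<in> X" unfolding r_def p using d o by (intro diff_mem proj_mem)
    have eX: "e n \<in> X" unfolding er using rX by (rule scale_mem)
    have orth: "B (r n) (e k) = 0" if "k < n" for k
    proof -
      have "B (proj e' n (d n)) (e' k) = B (d n) (e' k)"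
        using B_combination[OF o, of "\<lambda>k. B (d n) (e' k)" n k] that B_orthosys_self[OF o d, of n k]
        by (simp add: proj_def)
      then have "B (r n) (e' k) = 0"
        unfolding r_def p using d o by (simp add: B_diff_left proj_mem orthosys_mem)
      then show ?thesis using that by (simp add: e'_def)
    qed
    have orth': "B (e n) (e k) = 0" "B (e k) (e n) = 0" if "k < n" for k
    proof -
      have "e k \<in> X" using Suc that by blast
      then show "B (e n) (e k) = 0" unfolding er[of n] using orth[OF that] rX by (simp add: B_scale_left)
      then show "B (e k) (e n) = 0" using B_sym[OF eX \<open>e k \<in> X\<close>] by simp
    qed
    have "B (e n) (e n) = 0 \<or> B (e n) (e n) = 1"
    proof -
      have "B (e n) (e n) = inverse (nrm (r n)) * inverse (nrm (r n)) * (nrm (r n))\<^sup>2"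
        unfolding er[of n] using rX by (simp add: B_scale_left B_scale_right scale_mem nrm_sq)
      then show ?thesis by (cases "nrm (r n) = 0") (simp_all add: power2_eq_square field_simps)
    qed
    then show ?case using Suc eX orth' by (auto simp: less_Suc_eq)
  qed simp
  have o: "orthosys e"
    unfolding orthosys_def
  proof (intro conjI allI impI)
    show "e k \<in> X" for k using ortho_n[of "Suc k"] by blast
    show "B (e i) (e j) = 0" if "i \<noteq> j" for i j
      using conjunct1[OF conjunct2[OF ortho_n[of "Suc (max i j)"]]] that
      by (simp add: less_Suc_eq_le)
    show "B (e k) (e k) = 0 \<or> B (e k) (e k) = 1" for k using ortho_n[of "Suc k"] by blast
  qed
  \<comment> \<open>When \<open>nrm (r n) = 0\<close> the function \<open>r n\<close> itself need
    not vanish, so \<open>d n\<close> is not literally a combination of the system; it differs from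
    one by an element of norm zero.\<close>
  have "spanned e (d n)" for n
  proof (rule spanned_closed[OF o d])
    fix \<epsilon> :: real assume \<epsilon>: "\<epsilon> > 0"
    have rX: "r n \<in> X" unfolding r_def using d o by (intro diff_mem proj_mem)
    have "spanned e (\<lambda>x. \<Sum>k<Suc n. (if k < n then B (d n) (e k) else nrm (r n)) * e k x)" (is "spanned e ?y")
      by (rule spanned_combination[OF o])
    moreover have "nrm (\<lambda>x. d n x - ?y x) = 0"
    proof -
      have y: "(\<lambda>x. d n x - ?y x) = (\<lambda>x. r n x - nrm (r n) * e n x)"
        by (simp add: r_def proj_def fun_eq_iff)
      show ?thesis
      proof (cases "nrm (r n) = 0")
        case True
        then show ?thesis unfolding y by simp
      next
        case False
        then have "(\<lambda>x. r n x - nrm (r n) * e n x) = (\<lambda>x. 0)" unfolding er[of n]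
            by (simp flip: mult.assoc)
        then show ?thesis unfolding y by (simp add: nrm_def B_zero_left zero_mem)
      qed
    qed
    ultimately show "\<exists>y. spanned e y \<and> nrm (\<lambda>x. d n x - y x) < \<epsilon>" using \<epsilon> by auto
  qed
  with o show ?thesis using that by blast
qed


text \<open>Bochner measurability of f is reduced to scalar measurability of its coordinates; this
  covers even an f picked pointwise by a choice operator. The approximation \<open>q n\<close> keeps
  n coordinates, each rounded down to a multiple of 1/2^n, or replaced by 0 when it exceeds n in
  modulus, and therefore takes finitely many values.\<close>

lemma strongly_measurable_if_coefficients:
  assumes e: "orthosys e" and I: "I \<in> sets lebesgue"
    and c: "\<And>k. c k \<in> borel_measurable lebesgue"
    and f: "AE t in lebesgue. t \<in> I \<longrightarrow> spanned e (f t) \<and> (\<forall>k. B (f t) (e k) = c k t)"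
  shows "strongly_measurable_on I X nrm f"
proof -
  define r where "r = (\<lambda>(n::nat) (x::real). if \<bar>x\<bar> \<le> n then of_int \<lfloor>2^n * x\<rfloor> / 2^n else (0::real))"
  define R where "R = (\<lambda>n::nat. insert 0 ((\<lambda>j::int. of_int j / 2^n :: real) ` {\<lfloor>2^n * - real n\<rfloor>..\<lfloor>2^n * real n\<rfloor>}))"
  have finR: "finite (R n)" for n by (simp add: R_def)
  have rR: "r n x \<in> R n" for n x
  proof (cases "\<bar>x\<bar> \<le> n")
    case True
    then have "2^n * - real n \<le> 2^n * x" "2^n * x \<le> 2^n * real n" 
      using mult_left_mono[of "- real n" x "2^n"] by auto
    then have "\<lfloor>2^n * x\<rfloor> \<in> {\<lfloor>2^n * - real n\<rfloor>..\<lfloor>2^n * real n\<rfloor>}" by (simp add: floor_mono del: mult_minus_right)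
    then show ?thesis using True unfolding r_def R_def by auto
  qed (simp add: r_def R_def)
  have r_meas: "(\<lambda>t. r n (c k t)) \<in> borel_measurable lebesgue" for n k
    unfolding r_def using c[of k] by measurable
  have r_err: "(r n x - x)\<^sup>2 \<le> (1/2^n)\<^sup>2" if "\<bar>x\<bar> \<le> n" for n x
  proof (rule power2_le_iff_abs_le[THEN iffD2])
    have "r n x - x = (of_int \<lfloor>2^n * x\<rfloor> - 2^n * x) / 2^n"
      using that by (simp add: r_def diff_divide_distrib)
    moreover have "\<bar>of_int \<lfloor>2^n * x\<rfloor> - 2^n * x\<bar> \<le> 1" by linarith
    ultimately show "\<bar>r n x - x\<bar> \<le> 1/2^n" by (simp add: abs_divide divide_right_mono)
  qed simp
  define q where "q = (\<lambda>n t x. \<Sum>k<n. r n (c k t) * e k x)"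
  define comb where "comb = (\<lambda>n (a::nat \<Rightarrow> real) x. \<Sum>k<n. a k * e k x)"
  have qc: "q n t = comb n (restrict (\<lambda>k. r n (c k t)) {..<n})" for n t
    by (simp add: q_def comb_def fun_eq_iff)
  have rP: "restrict (\<lambda>k. r n (c k t)) {..<n} \<in> PiE {..<n} (\<lambda>_. R n)" for n t
    by (simp add: PiE_iff rR)
  have qI: "q n ` I \<subseteq> comb n ` (PiE {..<n} (\<lambda>_. R n))" for n
    unfolding qc by (intro image_subsetI imageI rP)
  show ?thesis
    unfolding strongly_measurable_on_def
  proof (intro exI[of _ q] conjI allI)
    fix n
    show "finite (q n ` I)"
      by (rule finite_subset[OF qI]) (auto intro!: finite_PiE finR)
    show "q n ` I \<subseteq> X"
      unfolding q_def by (intro image_subsetI sum_mem orthosys_mem[OF e])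
    fix y
    have "{t \<in> I. q n t = y} = (\<Union>a\<in>{a\<in>PiE {..<n} (\<lambda>_. R n). comb n a = y}. {t\<in>I. \<forall>k\<in>{..<n}. r n (c k t) = a k})"
      (is "?L = ?R")
    proof
      show "?L \<subseteq> ?R"
      proof
        fix t assume t: "t \<in> ?L"
        let ?a = "restrict (\<lambda>k. r n (c k t)) {..<n}"
        have "?a \<in> {a\<in>PiE {..<n} (\<lambda>_. R n). comb n a = y}"
          using rP t by (auto simp: qc)
        then show "t \<in> ?R" by (rule UN_I[where a = ?a]) (use t in simp)
      qed
      show "?R \<subseteq> ?L" by (auto simp: q_def comb_def)
    qed
    moreover have "?R \<in> sets lebesgue"
    proof (rule sets.finite_UN)
      show "finite {a\<in>PiE {..<n} (\<lambda>_. R n). comb n a = y}"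
        by (rule finite_subset[of _ "PiE {..<n} (\<lambda>_. R n)"]) (auto intro!: finite_PiE finR)
      fix a
      have "{t\<in>space lebesgue. \<forall>k\<in>{..<n}. r n (c k t) = a k} \<in> sets lebesgue"
        using r_meas by measurable
      then have "I \<inter> {t. \<forall>k\<in>{..<n}. r n (c k t) = a k} \<in> sets lebesgue"
        using I by (intro sets.Int) auto
      moreover have "I \<inter> {t. \<forall>k\<in>{..<n}. r n (c k t) = a k} = {t\<in>I. \<forall>k\<in>{..<n}. r n (c k t) = a k}"
        by auto
      ultimately show "{t\<in>I. \<forall>k\<in>{..<n}. r n (c k t) = a k} \<in> sets lebesgue" by simp
    qed
    ultimately show "?L \<in> sets lebesgue" by simp
  next
    show "AE t in lebesgue. t \<in> I \<longrightarrow> f t \<in> X \<and> (\<lambda>n. nrm (\<lambda>x. f t x - q n t x)) \<longlonglongrightarrow> 0"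
      using f
    proof eventually_elim
      case (elim t)
      show ?case
      proof
        assume "t \<in> I"
        then have s: "spanned e (f t)" and b: "B (f t) (e k) = c k t" for k using elim by auto
        have fX: "f t \<in> X" using s by (simp add: spanned_def)
        have pX: "proj e n (f t) \<in> X" for n by (rule proj_mem[OF e])
        have qX: "q n t \<in> X" for n unfolding q_def by (intro sum_mem orthosys_mem[OF e])
        \<comment> \<open>From index N on no coordinate of \<open>f t\<close> is cut off, since each
          is bounded by the norm.\<close>
        obtain N :: nat where N: "nrm (f t) \<le> N" using real_arch_simple by blast
        have ck: "\<bar>c k t\<bar> \<le> nrm (f t)" for k
        proof -
          have "(B (f t) (e k))\<^sup>2 \<le> (\<Sum>j<Suc k. (B (f t) (e j))\<^sup>2)"
            by (rule member_le_sum) auto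
          also have "\<dots> \<le> (nrm (f t))\<^sup>2" unfolding nrm_sq[OF fX] by (rule bessel[OF e fX])
          finally show ?thesis using nrm_nonneg[OF fX] by (simp add: b abs_le_square_iff[symmetric])
        qed
        have d: "nrm (\<lambda>x. proj e n (f t) x - q n t x) \<le> sqrt (n * (1/2^n)\<^sup>2)" if "n \<ge> N" for n
        proof -
          have "(\<lambda>x. proj e n (f t) x - q n t x) = (\<lambda>x. \<Sum>k<n. (c k t - r n (c k t)) * e k x)"
            by (simp add: proj_def q_def b sum_subtractf left_diff_distrib)
          then have "nrm (\<lambda>x. proj e n (f t) x - q n t x) \<le> sqrt (\<Sum>k<n. (c k t - r n (c k t))\<^sup>2)"
            unfolding nrm_def using B_combination_self_le[OF e, of "\<lambda>k. c k t - r n (c k t)" n] by simp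
          also have "\<dots> \<le> sqrt (\<Sum>k<n. (1/2^n)\<^sup>2)"
          proof (intro real_sqrt_le_mono sum_mono)
            fix k
            have "\<bar>c k t\<bar> \<le> n" using ck[of k] N that by linarith
            then show "(c k t - r n (c k t))\<^sup>2 \<le> (1/2^n)\<^sup>2"
              using r_err by (simp add: power2_commute)
          qed
          finally show ?thesis by simp
        qed
        have "(\<lambda>n. real n * (1/2^n)\<^sup>2) \<longlonglongrightarrow> 0"
        proof -
          have "(\<lambda>n. real n * (1/4)^n) \<longlonglongrightarrow> 0"
            by (rule powser_times_n_limit_0) simp
          moreover have "(1/2^n)\<^sup>2 = (1/4::real)^n" for n
            by (simp add: power_divide power2_eq_square flip: power_mult_distrib)
          ultimately show ?thesis by simp
        qed
        from tendsto_real_sqrt[OF this] have "(\<lambda>n. sqrt (n * (1/2^n)\<^sup>2)) \<longlonglongrightarrow> 0" by simp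
        then have "(\<lambda>n. nrm (\<lambda>x. f t x - proj e n (f t) x) + sqrt (n * (1/2^n)\<^sup>2)) \<longlonglongrightarrow> 0 + 0"
          using spanned_iff_residual[OF e fX] s by (intro tendsto_add) auto
        then have "(\<lambda>n. nrm (\<lambda>x. f t x - proj e n (f t) x) + sqrt (n * (1/2^n)\<^sup>2)) \<longlonglongrightarrow> 0" by simp
        then have "(\<lambda>n. nrm (\<lambda>x. f t x - q n t x)) \<longlonglongrightarrow> 0"
        proof (rule tendsto_sandwich[OF _ _ tendsto_const, rotated 2])
          show "\<forall>\<^sub>F n in sequentially. 0 \<le> nrm (\<lambda>x. f t x - q n t x)"
            using nrm_nonneg[OF diff_mem[OF fX qX]] by simp
          show "\<forall>\<^sub>F n in sequentially. nrm (\<lambda>x. f t x - q n t x)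
               \<le> nrm (\<lambda>x. f t x - proj e n (f t) x) + sqrt (n * (1/2^n)\<^sup>2)"
            using eventually_ge_at_top[of N]
          proof eventually_elim
            case (elim n)
            show ?case using nrm_diff_triangle[OF fX pX[of n] qX[of n]] d[OF elim] by linarith
          qed
        qed
        then show "f t \<in> X \<and> (\<lambda>n. nrm (\<lambda>x. f t x - q n t x)) \<longlonglongrightarrow> 0" using fX by simp
      qed
    qed
  qed
qed

end

section \<open>Square-integrable functions\<close>

text \<open>On a product type \<open>lebesgue\<close> is the completion of
  \<open>lborel \<Otimes>\<^sub>M lborel\<close>, not the product of the completed measures. A null
  set is therefore first enclosed in a Borel null set, whose cylinder is null.\<close>

lemma AE_lebesgue_prod_fst:
  fixes P :: "'a::euclidean_space \<Rightarrow> bool"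
  assumes "AE x in lebesgue. P x"
  shows "AE z in (lebesgue :: ('a \<times> 'b::euclidean_space) measure). P (fst z)"
proof -
  have "AE x in lborel. P x" using assms by (simp add: AE_completion_iff)
  then obtain N where N: "N \<in> null_sets lborel" "{x. \<not> P x} \<subseteq> N"
    unfolding eventually_ae_filter by auto
  have "N \<times> (UNIV :: 'b set) \<in> null_sets (lborel \<Otimes>\<^sub>M lborel)"
    using N(1) by (intro lborel.times_in_null_sets1) auto
  then have "AE z in (lborel :: ('a \<times> 'b) measure). P (fst z)"
    unfolding lborel_prod using N(2) by (intro AE_I') auto
  then show ?thesis by (rule AE_completion)
qed

lemma AE_lebesgue_prod_snd:
  fixes P :: "'b::euclidean_space \<Rightarrow> bool"
  assumes "AE x in lebesgue. P x"
  shows "AE z in (lebesgue :: ('a::euclidean_space \<times> 'b) measure). P (snd z)"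
proof -
  have "AE x in lborel. P x" using assms by (simp add: AE_completion_iff)
  then obtain N where N: "N \<in> null_sets lborel" "{x. \<not> P x} \<subseteq> N"
    unfolding eventually_ae_filter by auto
  have "(UNIV :: 'a set) \<times> N \<in> null_sets (lborel \<Otimes>\<^sub>M lborel)"
    using N(1) by (intro lborel.times_in_null_sets2) auto
  then have "AE z in (lborel :: ('a \<times> 'b) measure). P (snd z)"
    unfolding lborel_prod using N(2) by (intro AE_I') auto
  then show ?thesis by (rule AE_completion)
qed

lemma lebesgue_borel_representative:
  fixes f :: "'a::euclidean_space \<Rightarrow> real"
  assumes "f \<in> borel_measurable lebesgue"
  obtains f' where "f' \<in> borel_measurable borel" "AE x in lebesgue. f x = f' x"
proof -
  obtain f' where "f' \<in> borel_measurable lborel" "AE x in lborel. f x = f' x"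
    using completion_ex_borel_measurable_real[OF assms] by auto
  then show ?thesis using that[of f'] by (auto intro: AE_completion)
qed

lemma measurable_lebesgue_fst:
  fixes f :: "'a::euclidean_space \<Rightarrow> real"
  assumes "f \<in> borel_measurable lebesgue"
  shows "(\<lambda>z. f (fst z)) \<in> borel_measurable (lebesgue :: ('a \<times> 'b::euclidean_space) measure)"
proof -
  obtain f' where f': "f' \<in> borel_measurable borel" "AE x in lebesgue. f x = f' x"
    using lebesgue_borel_representative[OF assms] .
  have "(\<lambda>z::'a \<times> 'b. f' (fst z)) \<in> borel_measurable borel"
    by (rule measurable_compose[OF borel_measurable_continuous_onI[OF continuous_on_fst[OF continuous_on_id]] f'(1)])
  then have "(\<lambda>z::'a \<times> 'b. f' (fst z)) \<in> borel_measurable lebesgue"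
    by (simp add: measurable_completion)
  then show ?thesis
    by (rule borel_measurable_AE) (use AE_lebesgue_prod_fst[OF f'(2)] in \<open>auto simp: eq_commute\<close>)
qed

lemma measurable_lebesgue_snd:
  fixes f :: "'b::euclidean_space \<Rightarrow> real"
  assumes "f \<in> borel_measurable lebesgue"
  shows "(\<lambda>z. f (snd z)) \<in> borel_measurable (lebesgue :: ('a::euclidean_space \<times> 'b) measure)"
proof -
  obtain f' where f': "f' \<in> borel_measurable borel" "AE x in lebesgue. f x = f' x"
    using lebesgue_borel_representative[OF assms] .
  have "(\<lambda>z::'a \<times> 'b. f' (snd z)) \<in> borel_measurable borel"
    by (rule measurable_compose[OF borel_measurable_continuous_onI[OF continuous_on_snd[OF continuous_on_id]] f'(1)])
  then have "(\<lambda>z::'a \<times> 'b. f' (snd z)) \<in> borel_measurable lebesgue"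
    by (simp add: measurable_completion)
  then show ?thesis
    by (rule borel_measurable_AE) (use AE_lebesgue_prod_snd[OF f'(2)] in \<open>auto simp: eq_commute\<close>)
qed

text \<open>Fubini is applied to Borel representatives and the result carried back through the
  completion. The Poincare and Ehrling arguments integrate such products of a function of x and a
  function of y.\<close>

lemma has_bochner_integral_lebesgue_prod:
  fixes f :: "'a::euclidean_space \<Rightarrow> real" and g :: "'b::euclidean_space \<Rightarrow> real"
  assumes f: "integrable lebesgue f" and g: "integrable lebesgue g"
  shows "has_bochner_integral lebesgue (\<lambda>z. f (fst z) * g (snd z)) ((LINT x|lebesgue. f x) * (LINT y|lebesgue. g y))"
proof -
  obtain f' where f': "f' \<in> borel_measurable borel" "AE x in lebesgue. f x = f' x"
    using lebesgue_borel_representative f by blast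
  obtain g' where g': "g' \<in> borel_measurable borel" "AE x in lebesgue. g x = g' x"
    using lebesgue_borel_representative g by blast
  note [measurable] = f'(1) g'(1) borel_measurable_integrable[OF f] borel_measurable_integrable[OF g]
  have f'L: "f' \<in> borel_measurable lebesgue" and g'L: "g' \<in> borel_measurable lebesgue"
    using f'(1) g'(1) by (simp_all add: measurable_completion)
  have if': "integrable lborel f'" and ig': "integrable lborel g'"
  proof -
    have "integrable lebesgue f'" using integrable_cong_AE[OF _ f'L f'(2)] f by simp
    then show "integrable lborel f'" by (simp add: integrable_completion)
    have "integrable lebesgue g'" using integrable_cong_AE[OF _ g'L g'(2)] g by simp
    then show "integrable lborel g'" by (simp add: integrable_completion)
  qed
  have If: "(LINT x|lebesgue. f x) = (LINT x|lborel. f' x)"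
    using integral_cong_AE[OF _ f'L f'(2)] integral_completion[of f' lborel] by simp
  have Ig: "(LINT x|lebesgue. g x) = (LINT x|lborel. g' x)"
    using integral_cong_AE[OF _ g'L g'(2)] integral_completion[of g' lborel] by simp
  let ?h = "\<lambda>z::'a\<times>'b. f' (fst z) * g' (snd z)"
  have ih: "integrable (lborel \<Otimes>\<^sub>M lborel) ?h"
  proof (rule lborel_pair.Fubini_integrable)
    show "integrable lborel (\<lambda>x. LINT y|lborel. norm (?h (x, y)))"
      using if' by (simp add: abs_mult)
    show "AE x in lborel. integrable lborel (\<lambda>y. ?h (x, y))" using ig' by simp
  qed simp
  have Ih: "integral\<^sup>L (lborel \<Otimes>\<^sub>M lborel) ?h = (LINT x|lborel. f' x) * (LINT y|lborel. g' y)"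
    using lborel_pair.integral_fst'[OF ih] by simp
  have hm: "?h \<in> borel_measurable (lborel :: ('a\<times>'b) measure)"
    using borel_measurable_integrable[OF ih] by (simp add: lborel_prod)
  have 1: "has_bochner_integral lebesgue ?h ((LINT x|lebesgue. f x) * (LINT y|lebesgue. g y))"
    unfolding If Ig Ih[symmetric] lborel_prod
    using ih hm by (simp add: has_bochner_integral_iff integrable_completion integral_completion lborel_prod)
  have ae: "AE z in (lebesgue :: ('a\<times>'b) measure). ?h z = f (fst z) * g (snd z)"
    using AE_lebesgue_prod_fst[OF f'(2)] AE_lebesgue_prod_snd[OF g'(2)] by eventually_elim simp
  show ?thesis
    using 1 hm
    by (subst has_bochner_integral_cong_AE[OF _ _ ae, symmetric])
       (auto simp: measurable_completion intro!: borel_measurable_times measurable_lebesgue_fst measurable_lebesgue_snd)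
qed

section \<open>The semi-inner product space of square-integrable functions\<close>

lemma abs_mult_le_squares: "\<bar>a * b\<bar> \<le> a\<^sup>2 + (b::real)\<^sup>2"
proof -
  have "0 \<le> (\<bar>a\<bar> - \<bar>b\<bar>)\<^sup>2" by simp
  then have "2 * (\<bar>a\<bar> * \<bar>b\<bar>) \<le> a\<^sup>2 + b\<^sup>2" by (simp add: power2_diff)
  moreover have "0 \<le> \<bar>a\<bar> * \<bar>b\<bar>" by simp
  ultimately show ?thesis unfolding abs_mult by linarith
qed

lemma square_sum_le: "(a + b)\<^sup>2 \<le> 2 * a\<^sup>2 + 2 * (b::real)\<^sup>2"
  using zero_le_power2[of "a - b"] by (simp add: power2_sum power2_diff)

lemma square_diff_le: "(a - b)\<^sup>2 \<le> 2 * a\<^sup>2 + 2 * (b::real)\<^sup>2"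
  using square_sum_le[of a "-b"] by simp

definition sq_int :: "'c measure \<Rightarrow> ('c \<Rightarrow> real) \<Rightarrow> bool" where
  "sq_int M f \<longleftrightarrow> f \<in> borel_measurable M \<and> integrable M (\<lambda>x. (f x)\<^sup>2)"

lemma sq_int_mult: 
  assumes "sq_int M f" "sq_int M g" shows "integrable M (\<lambda>x. f x * g x)"
proof (rule Bochner_Integration.integrable_bound)
  show "integrable M (\<lambda>x. (f x)\<^sup>2 + (g x)\<^sup>2)" using assms by (auto simp: sq_int_def)
  show "(\<lambda>x. f x * g x) \<in> borel_measurable M" using assms by (auto simp: sq_int_def)
qed (use abs_mult_le_squares in auto)

lemma sq_int_add:
  assumes "sq_int M f" "sq_int M g" shows "sq_int M (\<lambda>x. f x + g x)"
proof -
  have [measurable]: "f \<in> borel_measurable M" "g \<in> borel_measurable M" using assms by (auto simp: sq_int_def)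
  have "integrable M (\<lambda>x. (f x + g x)\<^sup>2)"
  proof (rule Bochner_Integration.integrable_bound)
    show "integrable M (\<lambda>x. 2 * (f x)\<^sup>2 + 2 * (g x)\<^sup>2)" using assms by (auto simp: sq_int_def)
  qed (use square_sum_le in auto)
  then show ?thesis by (simp add: sq_int_def)
qed

lemma sq_int_scale: "sq_int M f \<Longrightarrow> sq_int M (\<lambda>x. c * f x)"
  by (auto simp: sq_int_def power_mult_distrib)

lemma sq_int_diff:
  assumes "sq_int M f" "sq_int M g" shows "sq_int M (\<lambda>x. f x - g x)"
  using sq_int_add[OF assms(1) sq_int_scale[OF assms(2), of "-1"]] by simp

lemma sq_int_zero: "sq_int M (\<lambda>x. 0)"
  by (simp add: sq_int_def)

lemma semi_inner_space_sq_int: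
  "semi_inner_space {f. sq_int M f} (\<lambda>f g. LINT x|M. f x * g x)"
  by unfold_locales 
     (simp_all add: sq_int_zero sq_int_add sq_int_scale distrib_right sq_int_mult mult.assoc, simp add: mult.commute)

lemma sq_int_cauchy_schwarz:
  assumes "sq_int M f" "sq_int M g"
  shows "\<bar>LINT x|M. f x * g x\<bar> \<le> sqrt (LINT x|M. (f x)\<^sup>2) * sqrt (LINT x|M. (g x)\<^sup>2)"
  using semi_inner_space.cauchy_schwarz[OF semi_inner_space_sq_int, of f M g] assms
  by (simp add: semi_inner_space.nrm_def[OF semi_inner_space_sq_int] power2_eq_square)

text \<open>The part of \<open>\<integral>(V k - V) Y\<close> where \<open>\<bar>V k - V\<bar> \<le> m \<bar>Y\<bar>\<close> tends to zero by dominated convergence;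
  on the rest \<open>\<bar>Y\<bar> \<le> \<bar>V k - V\<bar> / m\<close>, so it is at most of order \<open>1 / m\<close>.\<close>

lemma sq_int_ae_limit:
  fixes V :: "nat \<Rightarrow> 'c \<Rightarrow> real"
  assumes V: "\<And>k. sq_int M (V k)" and bd: "\<And>k. (LINT x|M. (V k x)\<^sup>2) \<le> C"
    and Wm[measurable]: "W \<in> borel_measurable M"
    and lim: "AE x in M. (\<lambda>k. V k x) \<longlonglongrightarrow> W x"
  shows "sq_int M W" 
    and "\<And>Y. sq_int M Y \<Longrightarrow> (\<lambda>k. LINT x|M. V k x * Y x) \<longlonglongrightarrow> (LINT x|M. W x * Y x)"
proof -
  have [measurable]: "V k \<in> borel_measurable M" for k using V by (simp add: sq_int_def)
  have "(\<integral>\<^sup>+x. ennreal ((W x)\<^sup>2) \<partial>M) = (\<integral>\<^sup>+x. liminf (\<lambda>k. ennreal ((V k x)\<^sup>2)) \<partial>M)"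
  proof (rule nn_integral_cong_AE)
    show "AE x in M. ennreal ((W x)\<^sup>2) = liminf (\<lambda>k. ennreal ((V k x)\<^sup>2))"
      using lim
    proof eventually_elim
      case (elim x)
      then have "(\<lambda>k. ennreal ((V k x)\<^sup>2)) \<longlonglongrightarrow> ennreal ((W x)\<^sup>2)" by (intro tendsto_intros)
      then show ?case using lim_imp_Liminf trivial_limit_sequentially by metis
    qed
  qed
  also have "\<dots> \<le> liminf (\<lambda>k. \<integral>\<^sup>+x. ennreal ((V k x)\<^sup>2) \<partial>M)"
    by (rule nn_integral_liminf) measurable
  also have "\<dots> \<le> ennreal C"
  proof (rule Liminf_le)
    have "(\<integral>\<^sup>+x. ennreal ((V k x)\<^sup>2) \<partial>M) = ennreal (LINT x|M. (V k x)\<^sup>2)" for k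
      using V[of k] by (intro nn_integral_eq_integral) (auto simp: sq_int_def)
    then show "\<forall>\<^sub>F k in sequentially. (\<integral>\<^sup>+x. ennreal ((V k x)\<^sup>2) \<partial>M) \<le> ennreal C"
      using bd by (simp add: ennreal_leI)
  qed simp
  finally have le: "(\<integral>\<^sup>+x. ennreal ((W x)\<^sup>2) \<partial>M) \<le> ennreal C" .
  then have "integrable M (\<lambda>x. (W x)\<^sup>2)"
    by (intro integrableI_bounded) (auto intro: le_less_trans)
  then show W: "sq_int M W" by (simp add: sq_int_def)
  have C0: "C \<ge> 0" by (rule order_trans[OF _ bd[of 0]]) simp
  have bW: "(LINT x|M. (W x)\<^sup>2) \<le> C"
    using le W C0 by (simp add: sq_int_def nn_integral_eq_integral)
  fix Y assume Y: "sq_int M Y"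
  then have [measurable]: "Y \<in> borel_measurable M" by (simp add: sq_int_def)
  have D: "sq_int M (\<lambda>x. V k x - W x)" for k by (rule sq_int_diff[OF V W])
  have bD: "(LINT x|M. (V k x - W x)\<^sup>2) \<le> 4 * C" for k
  proof -
    have "(LINT x|M. (V k x - W x)\<^sup>2) \<le> (LINT x|M. 2 * (V k x)\<^sup>2 + 2 * (W x)\<^sup>2)"
      using V W D square_diff_le by (intro integral_mono) (auto simp: sq_int_def)
    also have "\<dots> \<le> 4 * C" using V W bd[of k] bW by (auto simp: sq_int_def)
    finally show ?thesis .
  qed
  have key: "\<exists>N. \<forall>k\<ge>N. \<bar>(LINT x|M. V k x * Y x) - (LINT x|M. W x * Y x)\<bar> < \<epsilon>" if \<epsilon>: "\<epsilon> > 0" for \<epsilon> :: real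
  proof -
    \<comment> \<open>As m exceeds 8 C / \<epsilon>, the bound \<open>bD\<close> limits the
      contribution of the second part to 4 C / m < \<epsilon> / 2.\<close>
    define m where "m = 8 * C / \<epsilon> + 1"
    have m: "m > 0" "4 * C / m < \<epsilon> / 2" 
      using C0 \<epsilon> by (auto simp: m_def field_simps add_nonneg_pos)
    let ?f = "\<lambda>k x. min \<bar>V k x - W x\<bar> (m * \<bar>Y x\<bar>) * \<bar>Y x\<bar>"
    have l1: "AE x in M. (\<lambda>k. ?f k x) \<longlonglongrightarrow> 0"
      using lim
    proof eventually_elim
      case (elim x)
      then have "(\<lambda>k. min \<bar>V k x - W x\<bar> (m * \<bar>Y x\<bar>) * \<bar>Y x\<bar>) \<longlonglongrightarrow> min \<bar>W x - W x\<bar> (m * \<bar>Y x\<bar>) * \<bar>Y x\<bar>"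
        by (intro tendsto_intros)
      then show ?case using m by (simp add: min_def split: if_splits)
    qed
    have nn: "0 \<le> ?f k x" for k x using m by simp
    have l2: "norm (?f k x) \<le> m * (Y x)\<^sup>2" for k x
    proof -
      have "?f k x \<le> m * \<bar>Y x\<bar> * \<bar>Y x\<bar>" by (rule mult_right_mono[OF min.cobounded2]) simp
      also have "m * \<bar>Y x\<bar> * \<bar>Y x\<bar> = m * (Y x)\<^sup>2" by (simp add: power2_eq_square mult.assoc)
      finally show ?thesis by (simp only: real_norm_def abs_of_nonneg[OF nn])
    qed
    have "integrable M (\<lambda>x. m * (Y x)\<^sup>2)" using Y by (simp add: sq_int_def)
    then have "(\<lambda>k. LINT x|M. ?f k x) \<longlonglongrightarrow> (LINT x|M. 0)"
      by (rule integral_dominated_convergence[rotated 2, OF _ l1 AE_I2[OF l2]]) measurable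
    then have "(\<lambda>k. LINT x|M. ?f k x) \<longlonglongrightarrow> 0" by simp
    from LIMSEQ_D[OF this half_gt_zero[OF \<epsilon>]]
    obtain N where N: "\<And>k. k \<ge> N \<Longrightarrow> \<bar>LINT x|M. ?f k x\<bar> < \<epsilon> / 2" by auto
    have if_: "integrable M (?f k)" for k
    proof (rule Bochner_Integration.integrable_bound)
      show "integrable M (\<lambda>x. (V k x - W x) * Y x)" by (rule sq_int_mult[OF D Y])
      show "AE x in M. norm (?f k x) \<le> norm ((V k x - W x) * Y x)"
        using m by (auto simp: abs_mult intro!: mult_right_mono)
    qed simp
    have "\<bar>(LINT x|M. V k x * Y x) - (LINT x|M. W x * Y x)\<bar> < \<epsilon>" if k: "k \<ge> N" for k
    proof -
      have "(LINT x|M. V k x * Y x) - (LINT x|M. W x * Y x) = (LINT x|M. (V k x - W x) * Y x)"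
        using sq_int_mult[OF V Y] sq_int_mult[OF W Y] by (simp add: left_diff_distrib)
      also have "\<bar>\<dots>\<bar> \<le> (LINT x|M. \<bar>(V k x - W x) * Y x\<bar>)" by (rule integral_abs_bound)
      also have "\<dots> \<le> (LINT x|M. ?f k x + (V k x - W x)\<^sup>2 / m)"
      proof (rule integral_mono)
        show "integrable M (\<lambda>x. \<bar>(V k x - W x) * Y x\<bar>)" using sq_int_mult[OF D Y] by simp
        show "integrable M (\<lambda>x. ?f k x + (V k x - W x)\<^sup>2 / m)"
          using if_ D by (auto simp: sq_int_def)
        fix x
        show "\<bar>(V k x - W x) * Y x\<bar> \<le> ?f k x + (V k x - W x)\<^sup>2 / m"
        proof (cases "\<bar>V k x - W x\<bar> \<le> m * \<bar>Y x\<bar>")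
          case True
          then show ?thesis using m by (simp add: abs_mult min_def)
        next
          case False
          then have "\<bar>Y x\<bar> \<le> \<bar>V k x - W x\<bar> / m" using m by (simp add: field_simps)
          then have "\<bar>V k x - W x\<bar> * \<bar>Y x\<bar> \<le> \<bar>V k x - W x\<bar> * (\<bar>V k x - W x\<bar> / m)"
            by (intro mult_left_mono) auto
          moreover have "0 \<le> ?f k x" by (rule nn)
          ultimately show ?thesis by (simp add: abs_mult power2_eq_square)
        qed
      qed
      also have "\<dots> = (LINT x|M. ?f k x) + (LINT x|M. (V k x - W x)\<^sup>2) / m"
        using if_ D by (subst Bochner_Integration.integral_add) (auto simp: sq_int_def)
      also have "\<dots> < \<epsilon> / 2 + \<epsilon> / 2"
      proof (rule add_strict_mono)
        show "(LINT x|M. ?f k x) < \<epsilon> / 2" using N[OF k] by linarith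
        have "(LINT x|M. (V k x - W x)\<^sup>2) / m \<le> 4 * C / m" using bD m by (simp add: divide_right_mono)
        then show "(LINT x|M. (V k x - W x)\<^sup>2) / m < \<epsilon> / 2" using m by linarith
      qed
      finally show ?thesis by simp
    qed
    then show ?thesis by blast
  qed
  show "(\<lambda>k. LINT x|M. V k x * Y x) \<longlonglongrightarrow> (LINT x|M. W x * Y x)"
    unfolding LIMSEQ_iff real_norm_def using key by blast
qed

section \<open>Subsequences and completeness of L^2\<close>

lemma tendsto_if_subseq_tendsto:
  fixes X :: "nat \<Rightarrow> real"
  assumes "\<And>r::nat \<Rightarrow> nat. strict_mono r \<Longrightarrow> \<exists>q::nat \<Rightarrow> nat. strict_mono q \<and> (\<lambda>n. X (r (q n))) \<longlonglongrightarrow> L"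
  shows "X \<longlonglongrightarrow> L"
proof (rule ccontr)
  assume "\<not> X \<longlonglongrightarrow> L"
  then obtain \<epsilon> where \<epsilon>: "\<epsilon> > 0" "\<forall>N. \<exists>n\<ge>N. \<not> norm (X n - L) < \<epsilon>" 
    unfolding LIMSEQ_iff by blast
  then have "infinite {n. \<not> norm (X n - L) < \<epsilon>}" by (auto simp: infinite_nat_iff_unbounded_le)
  from infinite_enumerate[OF this] obtain r :: "nat \<Rightarrow> nat" 
    where r: "strict_mono r" "\<And>n. \<not> norm (X (r n) - L) < \<epsilon>" by auto
  obtain q where "strict_mono q" "(\<lambda>n. X (r (q n))) \<longlonglongrightarrow> L" using assms[OF r(1)] by blast
  then show False using r(2) \<epsilon>(1) unfolding LIMSEQ_iff by blast
qed

text \<open>Along \<open>r\<close> the increments h k have squared L^2 norm at most (1/8)^k, so the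
  sum of 4^k (h k)^2 is integrable and hence finite almost everywhere. Finiteness forces \<bar>h
  k\<bar> \<le> sqrt S / 2^k, and \<open>f (r k)\<close> converges pointwise. The rate 1/8 leaves
  room both for the weight 4^k and for summation over k.\<close>

lemma riesz_fischer:
  fixes f :: "nat \<Rightarrow> 'c \<Rightarrow> real"
  assumes f: "\<And>n. sq_int M (f n)"
    and cauchy: "\<And>\<epsilon>. \<epsilon> > 0 \<Longrightarrow> \<exists>N. \<forall>i\<ge>N. \<forall>j\<ge>N. (LINT x|M. (f i x - f j x)\<^sup>2) < \<epsilon>"
  obtains z where "sq_int M z" "(\<lambda>n. LINT x|M. (f n x - z x)\<^sup>2) \<longlonglongrightarrow> 0"
proof -
  have fm[measurable]: "f n \<in> borel_measurable M" for n using f by (simp add: sq_int_def)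
  have D: "sq_int M (\<lambda>x. f i x - f j x)" for i j by (rule sq_int_diff[OF f f])
  have "\<forall>k::nat. \<exists>N. \<forall>i\<ge>N. \<forall>j\<ge>N. (LINT x|M. (f i x - f j x)\<^sup>2) < (1/8)^k"
    by (intro allI cauchy) simp
  from choice[OF this] 
  obtain N where N: "\<And>k i j. i \<ge> N k \<Longrightarrow> j \<ge> N k \<Longrightarrow> (LINT x|M. (f i x - f j x)\<^sup>2) < (1/8)^k"
    by blast
  define r where "r = (\<lambda>k. k + (\<Sum>j\<le>k. N j))"
  have rN: "N k \<le> r k" for k
  proof -
    have "N k \<le> (\<Sum>j\<le>k. N j)" by (rule member_le_sum) auto
    then show ?thesis by (simp add: r_def)
  qed
  have rS: "r k \<le> r (Suc k)" "k \<le> r k" for k by (simp_all add: r_def)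
  define h where "h = (\<lambda>k x. f (r (Suc k)) x - f (r k) x)"
  have hm[measurable]: "h k \<in> borel_measurable M" for k unfolding h_def by measurable
  have hb: "(LINT x|M. (h k x)\<^sup>2) \<le> (1/8)^k" for k
    unfolding h_def using N[of k "r (Suc k)" "r k"] rN[of k] rS(1)[of k] by simp
  have "(\<integral>\<^sup>+x. (\<Sum>k. ennreal (4^k * (h k x)\<^sup>2)) \<partial>M) = (\<Sum>k. \<integral>\<^sup>+x. ennreal (4^k * (h k x)\<^sup>2) \<partial>M)"
    by (rule nn_integral_suminf) measurable
  also have "\<dots> \<le> (\<Sum>k. ennreal ((1/2)^k))"
  proof (rule suminf_le)
    fix k
    have "(\<integral>\<^sup>+x. ennreal (4^k * (h k x)\<^sup>2) \<partial>M) = ennreal (4^k * (LINT x|M. (h k x)\<^sup>2))"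
      using D[of "r (Suc k)" "r k"] by (subst nn_integral_eq_integral) (auto simp: sq_int_def h_def)
    also have "\<dots> \<le> ennreal (4^k * (1/8)^k)" using hb by (intro ennreal_leI mult_left_mono) auto
    also have "4^k * (1/8)^k = (1/2::real)^k" by (simp flip: power_mult_distrib)
    finally show "(\<integral>\<^sup>+x. ennreal (4^k * (h k x)\<^sup>2) \<partial>M) \<le> ennreal ((1/2)^k)" .
  qed auto
  also have "\<dots> < \<infinity>"
    by (subst suminf_ennreal_eq[OF _ geometric_sums]) auto
  finally have fin: "(\<integral>\<^sup>+x. (\<Sum>k. ennreal (4^k * (h k x)\<^sup>2)) \<partial>M) \<noteq> \<infinity>" by simp
  have "AE x in M. (\<Sum>k. ennreal (4^k * (h k x)\<^sup>2)) \<noteq> \<infinity>"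
    by (rule nn_integral_PInf_AE[OF _ fin]) measurable
  then have conv: "AE x in M. convergent (\<lambda>k. f (r k) x)"
  proof eventually_elim
    case (elim x)
    then have sm: "summable (\<lambda>k. 4^k * (h k x)\<^sup>2)"
      by (intro summable_suminf_not_top) auto
    define S where "S = (\<Sum>k. 4^k * (h k x)\<^sup>2)"
    have "\<bar>h k x\<bar> \<le> sqrt S * (1/2)^k" for k
    proof -
      have "(2^k * \<bar>h k x\<bar>)\<^sup>2 = (\<Sum>j\<in>{k}. 4^j * (h j x)\<^sup>2)"
      proof -
        have "(2^k)\<^sup>2 = (4::real)^k" by (simp add: power2_eq_square flip: power_mult_distrib)
        then show ?thesis by (simp add: power_mult_distrib)
      qed
      also have "\<dots> \<le> S" unfolding S_def by (rule sum_le_suminf[OF sm]) auto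
      finally have "2^k * \<bar>h k x\<bar> \<le> sqrt S" by (intro real_le_rsqrt) 
      then show ?thesis by (simp add: field_simps)
    qed
    then have "summable (\<lambda>k. h k x)"
      by (intro summable_comparison_test[of "\<lambda>k. h k x" "\<lambda>k. sqrt S * (1/2)^k"] summable_mult) auto
    then have "convergent (\<lambda>n. \<Sum>k<n. h k x)" by (simp add: summable_iff_convergent)
    moreover have "(\<Sum>k<n. h k x) = f (r n) x - f (r 0) x" for n
      unfolding h_def using sum_lessThan_telescope[of "\<lambda>k. f (r k) x" n] by simp
    ultimately have "convergent (\<lambda>n. f (r n) x - f (r 0) x)" by simp
    then show ?case using convergent_diff_const_right_iff by blast
  qed
  define z where "z = (\<lambda>x. lim (\<lambda>k. f (r k) x))"
  have zm[measurable]: "z \<in> borel_measurable M" unfolding z_def by measurable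
  have lim: "AE x in M. (\<lambda>k. f (r k) x) \<longlonglongrightarrow> z x"
    using conv by eventually_elim (simp add: z_def convergent_LIMSEQ_iff)
  have lim_i: "sq_int M (\<lambda>x. f i x - z x) \<and> (LINT x|M. (f i x - z x)\<^sup>2) \<le> (1/8)^k" if i: "i \<ge> N k" for i k
  proof -
    have rj: "r (j + k) \<ge> N k" for j
      using rN[of k] by (induction j) (auto intro: order_trans rS(1))
    have 1: "(LINT x|M. (f i x - f (r (j + k)) x)\<^sup>2) \<le> (1/8)^k" for j
      using N[OF i rj] by (simp add: less_imp_le)
    have ae: "AE x in M. (\<lambda>j. f i x - f (r (j + k)) x) \<longlonglongrightarrow> f i x - z x"
      using lim by eventually_elim (intro tendsto_intros LIMSEQ_ignore_initial_segment)
    have s: "sq_int M (\<lambda>x. f i x - z x)"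
      by (rule sq_int_ae_limit(1)[OF D 1 _ ae]) measurable
    \<comment> \<open>The norm a of f i - z is estimated by duality: a^2 is the limit in j of the
      pairings of f i - f (r (j + k)) with f i - z, each of which is at most sqrt ((1/8)^k) times
      a.\<close>
    define a where "a = sqrt (LINT x|M. (f i x - z x)\<^sup>2)"
    have a: "a \<ge> 0" "(LINT x|M. (f i x - z x)\<^sup>2) = a * a" by (simp_all add: a_def)
    have c: "(\<lambda>j. LINT x|M. (f i x - f (r (j + k)) x) * (f i x - z x)) \<longlonglongrightarrow> (LINT x|M. (f i x - z x) * (f i x - z x))"
      by (rule sq_int_ae_limit(2)[OF D 1 _ ae s]) measurable
    have b: "(LINT x|M. (f i x - f (r (j + k)) x) * (f i x - z x)) \<le> sqrt ((1/8)^k) * a" for j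
    proof -
      have "(LINT x|M. (f i x - f (r (j + k)) x) * (f i x - z x)) 
          \<le> sqrt (LINT x|M. (f i x - f (r (j + k)) x)\<^sup>2) * a"
        unfolding a_def by (rule order_trans[OF abs_ge_self sq_int_cauchy_schwarz[OF D s]])
      also have "\<dots> \<le> sqrt ((1/8)^k) * a"
        by (intro mult_right_mono real_sqrt_le_mono 1 a)
      finally show ?thesis .
    qed
    have "a * a \<le> sqrt ((1/8)^k) * a"
      unfolding a(2)[symmetric] using LIMSEQ_le_const2[OF c, of "sqrt ((1/8)^k) * a"] b
      by (simp add: power2_eq_square)
    then have "a \<le> sqrt ((1/8)^k)" using a(1) by (cases "a = 0") auto
    then have "a * a \<le> sqrt ((1/8)^k) * sqrt ((1/8)^k)" using a(1) by (intro mult_mono) auto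
    also have "\<dots> = (1/8)^k" by simp
    finally have "a * a \<le> (1/8)^k" .
    then show ?thesis using s a(2) by simp
  qed
  have z: "sq_int M z"
    using sq_int_diff[OF f conjunct1[OF lim_i[OF order_refl]], of "N 0" 0] by simp
  have "(\<lambda>n. LINT x|M. (f n x - z x)\<^sup>2) \<longlonglongrightarrow> 0"
    unfolding LIMSEQ_iff
  proof (intro allI impI)
    fix \<epsilon> :: real assume "\<epsilon> > 0"
    then obtain k where k: "(1/8)^k < \<epsilon>" using real_arch_pow_inv[of \<epsilon> "1/8"] by auto
    have "\<bar>LINT x|M. (f n x - z x)\<^sup>2\<bar> < \<epsilon>" if "n \<ge> N k" for n
      using lim_i[OF that] k by simp
    then show "\<exists>no. \<forall>n\<ge>no. norm ((LINT x|M. (f n x - z x)\<^sup>2) - 0) < \<epsilon>" by auto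
  qed
  with z show ?thesis using that by blast
qed

section \<open>The spaces \<open>X_space\<close>\<close>

text \<open>A square root of the Gagliardo integrand: the exponent is half of that in
  \<open>frac_op\<close>. Up to its constant the form \<open>frac_op\<close> thus becomes an L^2
  product over pairs of points, and the results on \<open>sq_int\<close> apply to it.\<close>

definition gagliardo :: "real \<Rightarrow> ('a::euclidean_space \<Rightarrow> real) \<Rightarrow> 'a \<times> 'a \<Rightarrow> real" where
  "gagliardo a v z = (v (fst z) - v (snd z)) * norm (fst z - snd z) powr - ((real DIM('a) + 2 * a) / 2)"

lemma gagliardo_mult:
  fixes u v :: "'a::euclidean_space \<Rightarrow> real"
  shows "gagliardo a u (x, y) * gagliardo a v (x, y) =
    (u x - u y) * (v x - v y) / norm (x - y) powr (real DIM('a) + 2 * a)"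
proof -
  let ?p = "(real DIM('a) + 2 * a) / 2"
  have "norm (x - y) powr - ?p * norm (x - y) powr - ?p = norm (x - y) powr (- ?p + - ?p)"
    by (simp only: powr_add)
  also have "- ?p + - ?p = - (real DIM('a) + 2 * a)" by simp
  finally have A: "norm (x - y) powr - ?p * norm (x - y) powr - ?p = 1 / norm (x - y) powr (real DIM('a) + 2 * a)"
    by (simp only: powr_minus_divide)
  have B: "(u x - u y) * q * ((v x - v y) * q) = (u x - u y) * (v x - v y) * (q * q)" for q
    by (simp only: mult_ac)
  show ?thesis unfolding gagliardo_def fst_conv snd_conv B A by simp
qed

lemma gagliardo_square:
  fixes v :: "'a::euclidean_space \<Rightarrow> real"
  shows "(gagliardo a v (x, y))\<^sup>2 = (v x - v y)\<^sup>2 / norm (x - y) powr (real DIM('a) + 2 * a)"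
  using gagliardo_mult[of a v x y v] by (simp add: power2_eq_square)

lemma gagliardo_add: "gagliardo a (\<lambda>x. u x + v x) z = gagliardo a u z + gagliardo a v z"
  and gagliardo_diff: "gagliardo a (\<lambda>x. u x - v x) z = gagliardo a u z - gagliardo a v z"
  and gagliardo_scale: "gagliardo a (\<lambda>x. c * v x) z = c * gagliardo a v z"
  by (simp_all add: gagliardo_def algebra_simps)

lemma gagliardo_measurable:
  fixes v :: "'a::euclidean_space \<Rightarrow> real"
  assumes "v \<in> borel_measurable lebesgue"
  shows "gagliardo a v \<in> borel_measurable lebesgue"
proof -
  have [measurable]: "(\<lambda>z::'a\<times>'a. norm (fst z - snd z)) \<in> borel_measurable borel"
    by (intro borel_measurable_continuous_onI continuous_intros)
  have "(\<lambda>z::'a\<times>'a. norm (fst z - snd z) powr c) \<in> borel_measurable borel" for c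
    by measurable
  then have "(\<lambda>z::'a\<times>'a. norm (fst z - snd z) powr c) \<in> borel_measurable lebesgue" for c
    by (simp add: measurable_completion)
  then show ?thesis
    unfolding gagliardo_def[abs_def]
    by (intro borel_measurable_times borel_measurable_diff measurable_lebesgue_fst measurable_lebesgue_snd assms)
qed

lemma frac_op_gagliardo:
  fixes u v :: "'a::euclidean_space \<Rightarrow> real"
  shows "frac_op a u v = frac_const DIM('a) a / 2 * (LINT z|lebesgue. gagliardo a u z * gagliardo a v z)"
  unfolding frac_op_def by (simp add: case_prod_unfold gagliardo_mult[symmetric])

lemma frac_const_pos: "0 < a \<Longrightarrow> a < 1 \<Longrightarrow> 0 < frac_const N a"
  unfolding frac_const_def by (intro divide_pos_pos mult_pos_pos Gamma_real_pos) auto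

lemma X_space_iff:
  fixes v :: "'a::euclidean_space \<Rightarrow> real"
  shows "v \<in> X_space \<Omega> a \<longleftrightarrow> sq_int lebesgue v \<and> sq_int lebesgue (gagliardo a v) \<and> (AE x in lebesgue. x \<notin> \<Omega> \<longrightarrow> v x = 0)"
proof -
  have "(\<lambda>(x, y). (v x - v y)\<^sup>2 / norm (x - y) powr (real DIM('a) + 2 * a)) = (\<lambda>z. (gagliardo a v z)\<^sup>2)"
    by (auto simp: gagliardo_square)
  then show ?thesis
    unfolding X_space_def frac_sobolev_def sq_int_def using gagliardo_measurable[of v a] by auto
qed

lemma X_space_L2: "v \<in> X_space \<Omega> a \<Longrightarrow> v \<in> L2_space \<Omega>"
  by (auto simp: X_space_iff L2_space_def sq_int_def)

lemma L2_space_sq_int: "v \<in> L2_space \<Omega> \<Longrightarrow> sq_int lebesgue v"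
  by (auto simp: L2_space_def sq_int_def)

lemma L2_pairing_eq:
  assumes \<Omega>: "\<Omega> \<in> sets lebesgue" and u: "u \<in> borel_measurable lebesgue" and v: "v \<in> L2_space \<Omega>"
  shows "L2_pairing \<Omega> u v = (LINT x|lebesgue. u x * v x)"
proof -
  have m: "v \<in> borel_measurable lebesgue" and z: "AE x in lebesgue. x \<notin> \<Omega> \<longrightarrow> v x = 0"
    using v by (auto simp: L2_space_def)
  have "(LINT x|lebesgue. indicator \<Omega> x *\<^sub>R (u x * v x)) = (LINT x|lebesgue. u x * v x)"
  proof (rule integral_cong_AE)
    show "AE x in lebesgue. indicator \<Omega> x *\<^sub>R (u x * v x) = u x * v x"
      using z by eventually_elim (auto simp: indicator_def)
  qed (use u m \<Omega> in measurable)
  then show ?thesis by (simp add: L2_pairing_def set_lebesgue_integral_def)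
qed

lemma semi_inner_space_X:
  fixes \<Omega> :: "'a::euclidean_space set"
  assumes a: "0 < a" "a < 1"
  shows "semi_inner_space (X_space \<Omega> a) (frac_op a)"
proof
  let ?G = "gagliardo a :: ('a \<Rightarrow> real) \<Rightarrow> _"
  have c: "0 < frac_const DIM('a) a" by (rule frac_const_pos[OF a])
  have g0: "?G (\<lambda>x. 0) = (\<lambda>z. 0)" by (simp add: gagliardo_def fun_eq_iff)
  have gadd: "?G (\<lambda>x. u x + v x) = (\<lambda>z. ?G u z + ?G v z)" for u v by (simp add: gagliardo_add fun_eq_iff)
  have gsc: "?G (\<lambda>x. c * v x) = (\<lambda>z. c * ?G v z)" for c v by (simp add: gagliardo_scale fun_eq_iff)
  show "(\<lambda>x. 0) \<in> X_space \<Omega> a" by (simp add: X_space_iff sq_int_zero g0)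
  fix u v w :: "'a \<Rightarrow> real" and r :: real
  show "(\<lambda>x. u x + v x) \<in> X_space \<Omega> a" if "u \<in> X_space \<Omega> a" "v \<in> X_space \<Omega> a"
    using that by (auto simp: X_space_iff sq_int_add gadd)
  show "(\<lambda>x. r * v x) \<in> X_space \<Omega> a" if "v \<in> X_space \<Omega> a"
    using that by (auto simp: X_space_iff sq_int_scale gsc)
  show "frac_op a (\<lambda>x. u x + v x) w = frac_op a u w + frac_op a v w"
    if "u \<in> X_space \<Omega> a" "v \<in> X_space \<Omega> a" "w \<in> X_space \<Omega> a"
  proof -
    have "integrable lebesgue (\<lambda>z. ?G u z * ?G w z)" "integrable lebesgue (\<lambda>z. ?G v z * ?G w z)"
      using that by (auto simp: X_space_iff intro!: sq_int_mult)
    then show ?thesis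
      unfolding frac_op_gagliardo gadd by (simp add: distrib_left distrib_right)
  qed
  show "frac_op a (\<lambda>x. r * u x) w = r * frac_op a u w"
    unfolding frac_op_gagliardo gsc by (simp add: mult.assoc)
  show "frac_op a u v = frac_op a v u" 
    unfolding frac_op_gagliardo by (simp add: mult.commute)
  show "0 \<le> frac_op a u u"
    unfolding frac_op_gagliardo using c by simp
qed

lemma nrm_X:
  assumes "0 < a" "a < 1"
  shows "semi_inner_space.nrm (frac_op a) = (X_norm a :: ('a::euclidean_space \<Rightarrow> real) \<Rightarrow> real)"
  by (rule ext) (simp add: semi_inner_space.nrm_def[OF semi_inner_space_X[OF assms]] X_norm_def)

lemma frac_op_self: "frac_op a v v = frac_const DIM('a) a / 2 * (LINT z|lebesgue. (gagliardo a v z)\<^sup>2)"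
  for v :: "'a::euclidean_space \<Rightarrow> real"
  by (simp add: frac_op_gagliardo power2_eq_square)

text \<open>A unit ball outside \<Omega> but at bounded distance suffices: for x in \<Omega> and y
  in the ball \<open>v y = 0\<close>, so (v x)^2 is at most \<open>(2 * R + 2) powr ?P\<close> times
  the squared \<open>gagliardo\<close> quotient, and integration over such pairs gives the
  bound.\<close>

lemma poincare:
  fixes \<Omega> :: "'a::euclidean_space set"
  assumes bd: "bounded \<Omega>" and a: "0 < a" "a < 1"
  obtains C where "C \<ge> 0" "\<And>v. v \<in> X_space \<Omega> a \<Longrightarrow> (LINT x|lebesgue. (v x)\<^sup>2) \<le> C * frac_op a v v"
proof -
  have "\<exists>b>0. \<forall>x\<in>\<Omega>. norm x < b" using bd unfolding bounded_pos_less .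
  then obtain R where R: "R > 0" "\<forall>x\<in>\<Omega>. norm x < R" by blast
  obtain e :: 'a where e: "e \<in> Basis" by (rule that[OF SOME_Basis])
  \<comment> \<open>With the centre at distance R + 1 from the origin, points y of the ball satisfy
    R < norm y < R + 2; they avoid \<Omega> and lie within 2 R + 2 of each of its points.\<close>
  define p where "p = (R + 1) *\<^sub>R e"
  have np: "norm p = R + 1" using R e by (simp add: p_def)
  let ?B = "ball p 1"
  let ?P = "real DIM('a) + 2 * a"
  have P: "?P > 0" using a by (simp add: add_pos_pos)
  have By: "R < norm y" "norm y < R + 2" if "y \<in> ?B" for y
    using that np norm_triangle_ineq2[of p y] norm_triangle_ineq2[of y p] 
    by (auto simp: dist_norm norm_minus_commute)
  have mB: "0 < measure lebesgue ?B" by simp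
  have iB: "integrable lebesgue (indicator ?B :: 'a \<Rightarrow> real)"
    using lmeasurable_ball unfolding lmeasurable_iff_integrable .
  define C where "C = (2 * R + 2) powr ?P / measure lebesgue ?B * (2 / frac_const DIM('a) a)"
  have cpos: "0 < frac_const DIM('a) a" by (rule frac_const_pos[OF a])
  show ?thesis
  proof (rule that[of C])
    show "C \<ge> 0" using mB cpos by (auto simp: C_def)
    fix v :: "'a \<Rightarrow> real" assume v: "v \<in> X_space \<Omega> a"
    have v0: "AE x in lebesgue. x \<notin> \<Omega> \<longrightarrow> v x = 0" and vs: "sq_int lebesgue v" "sq_int lebesgue (gagliardo a v)"
      using v by (auto simp: X_space_iff)
    have iv: "integrable lebesgue (\<lambda>x. (v x)\<^sup>2)" using vs by (simp add: sq_int_def)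
    have h: "has_bochner_integral lebesgue (\<lambda>z. (v (fst z))\<^sup>2 * indicator ?B (snd z)) 
       ((LINT x|lebesgue. (v x)\<^sup>2) * measure lebesgue ?B)"
      using has_bochner_integral_lebesgue_prod[OF iv iB] by simp
    have "(LINT x|lebesgue. (v x)\<^sup>2) * measure lebesgue ?B = (LINT z|lebesgue. (v (fst z))\<^sup>2 * indicator ?B (snd z :: 'a))"
      using h by (simp add: has_bochner_integral_iff)
    also have "\<dots> \<le> (LINT z|lebesgue. (2 * R + 2) powr ?P * (gagliardo a v z)\<^sup>2)"
    proof (rule integral_mono_AE)
      show "integrable lebesgue (\<lambda>z. (v (fst z))\<^sup>2 * indicator ?B (snd z :: 'a))"
        using h by (simp add: has_bochner_integral_iff)
      show "integrable lebesgue (\<lambda>z. (2 * R + 2) powr ?P * (gagliardo a v z)\<^sup>2)"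
        using vs by (simp add: sq_int_def)
      show "AE z in lebesgue. (v (fst z))\<^sup>2 * indicator ?B (snd z) \<le> (2 * R + 2) powr ?P * (gagliardo a v z)\<^sup>2"
        using AE_lebesgue_prod_fst[OF v0] AE_lebesgue_prod_snd[OF v0]
      proof eventually_elim
        case (elim z)
        obtain x y where z: "z = (x, y)" by (cases z)
        show ?case
        proof (cases "x \<in> \<Omega> \<and> y \<in> ?B")
          case True
          have ny: "norm x < R" "R < norm y" "norm y < R + 2" using True R By by auto
          then have "y \<notin> \<Omega>" using R(2) by force
          then have vy: "v y = 0" using elim z by simp
          have n: "norm (x - y) > 0" "norm (x - y) \<le> 2 * R + 2" 
            using ny norm_triangle_ineq4[of x y] by auto
          have "(v x)\<^sup>2 = norm (x - y) powr ?P * (gagliardo a v z)\<^sup>2"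
            using n unfolding z gagliardo_square by (simp add: vy)
          also have "\<dots> \<le> (2 * R + 2) powr ?P * (gagliardo a v z)\<^sup>2"
            using n P by (intro mult_right_mono powr_mono2) auto
          finally show ?thesis using True by (simp add: z)
        next
          case False
          then have E: "(v (fst z))\<^sup>2 * indicator ?B (snd z) = 0" using elim z by (auto simp: indicator_def)
          show ?thesis unfolding E by simp
        qed
      qed
    qed
    also have "\<dots> = (2 * R + 2) powr ?P * (2 / frac_const DIM('a) a) * frac_op a v v"
      using cpos by (simp add: frac_op_self)
    finally have "(LINT x|lebesgue. (v x)\<^sup>2) 
        \<le> (2 * R + 2) powr ?P * (2 / frac_const DIM('a) a) * frac_op a v v / measure lebesgue ?B"
      unfolding pos_le_divide_eq[OF mB] .
    then show "(LINT x|lebesgue. (v x)\<^sup>2) \<le> C * frac_op a v v" by (simp add: C_def mult.commute)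
  qed
qed

text \<open>L^2 convergence gives almost everywhere convergence along subsequences, hence also
  convergence of the \<open>gagliardo\<close> quotients almost everywhere on pairs, where
  \<open>sq_int_ae_limit\<close> supplies both membership of the limit and weak convergence. The
  limit is the same along all subsequences, so the whole sequence converges.\<close>

lemma X_space_L2_limit:
  fixes v :: "nat \<Rightarrow> 'a::euclidean_space \<Rightarrow> real"
  assumes a: "0 < a" "a < 1" and v: "\<And>n. v n \<in> X_space \<Omega> a" 
    and bd: "\<And>n. frac_op a (v n) (v n) \<le> C"
    and cauchy: "\<And>\<epsilon>. \<epsilon> > 0 \<Longrightarrow> \<exists>N. \<forall>i\<ge>N. \<forall>j\<ge>N. (LINT x|lebesgue. (v i x - v j x)\<^sup>2) < \<epsilon>"
  obtains z where "z \<in> X_space \<Omega> a" "(\<lambda>n. LINT x|lebesgue. (v n x - z x)\<^sup>2) \<longlonglongrightarrow> 0"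
    "\<And>y. y \<in> X_space \<Omega> a \<Longrightarrow> (\<lambda>n. frac_op a (v n) y) \<longlonglongrightarrow> frac_op a z y"
proof -
  have s: "sq_int lebesgue (v n)" "sq_int lebesgue (gagliardo a (v n))" "AE x in lebesgue. x \<notin> \<Omega> \<longrightarrow> v n x = 0" for n
    using v by (auto simp: X_space_iff)
  obtain z where z: "sq_int lebesgue z" "(\<lambda>n. LINT x|lebesgue. (v n x - z x)\<^sup>2) \<longlonglongrightarrow> 0"
    using riesz_fischer[OF s(1) cauchy] by blast
  have zm: "z \<in> borel_measurable lebesgue" using z by (simp add: sq_int_def)
  have cpos: "0 < frac_const DIM('a) a" by (rule frac_const_pos[OF a])
  define C' where "C' = 2 * C / frac_const DIM('a) a"
  have bd': "(LINT x|lebesgue. (gagliardo a (v n) x)\<^sup>2) \<le> C'" for n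
    using bd[of n] cpos unfolding frac_op_self C'_def by (simp add: field_simps)
  have sub: "\<exists>q::nat \<Rightarrow> nat. strict_mono q \<and> (AE x in lebesgue. (\<lambda>n. v (r (q n)) x) \<longlonglongrightarrow> z x)"
    if r: "strict_mono r" for r :: "nat \<Rightarrow> nat"
  proof -
    have i: "integrable lebesgue (\<lambda>x. (v (r n) x - z x)\<^sup>2)" for n
      using sq_int_diff[OF s(1) z(1)] by (simp add: sq_int_def)
    have "(\<lambda>n. LINT x|lebesgue. norm ((v (r n) x - z x)\<^sup>2)) \<longlonglongrightarrow> 0"
      using LIMSEQ_subseq_LIMSEQ[OF z(2) r] by (simp add: o_def)
    from tendsto_L1_AE_subseq[OF i this]
    obtain q :: "nat \<Rightarrow> nat" where q: "strict_mono q" "AE x in lebesgue. (\<lambda>n. (v (r (q n)) x - z x)\<^sup>2) \<longlonglongrightarrow> 0"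
      by blast
    from q(2) have "AE x in lebesgue. (\<lambda>n. v (r (q n)) x) \<longlonglongrightarrow> z x"
    proof eventually_elim
      case (elim x)
      from tendsto_real_sqrt[OF elim] have "(\<lambda>n. \<bar>v (r (q n)) x - z x\<bar>) \<longlonglongrightarrow> 0" by simp
      then have "(\<lambda>n. v (r (q n)) x - z x) \<longlonglongrightarrow> 0" by (simp add: tendsto_rabs_zero_iff)
      then show ?case by (simp add: LIM_zero_iff)
    qed
    with q(1) show ?thesis by blast
  qed
  have gl: "AE x in lebesgue. (\<lambda>n. gagliardo a (v (r n)) x) \<longlonglongrightarrow> gagliardo a z x"
    if "AE x in lebesgue. (\<lambda>n. v (r n) x) \<longlonglongrightarrow> z x" for r
    using AE_lebesgue_prod_fst[OF that] AE_lebesgue_prod_snd[OF that]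
    unfolding gagliardo_def by eventually_elim (intro tendsto_intros)
  have gm: "gagliardo a z \<in> borel_measurable lebesgue" by (rule gagliardo_measurable[OF zm])
  obtain q0 :: "nat \<Rightarrow> nat" where q0: "AE x in lebesgue. (\<lambda>n. v (q0 n) x) \<longlonglongrightarrow> z x"
    using sub[OF strict_mono_id] by auto
  have gz: "sq_int lebesgue (gagliardo a z)"
    by (rule sq_int_ae_limit(1)[OF s(2) bd' gm gl[OF q0]])
  have "AE x in lebesgue. \<forall>n. x \<notin> \<Omega> \<longrightarrow> v n x = 0" using s(3) unfolding AE_all_countable by blast
  then have z0: "AE x in lebesgue. x \<notin> \<Omega> \<longrightarrow> z x = 0"
    using q0
  proof eventually_elim
    case (elim x)
    then show ?case by (auto simp: LIMSEQ_const_iff)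
  qed
  have zX: "z \<in> X_space \<Omega> a" using z gz z0 by (simp add: X_space_iff)
  have "(\<lambda>n. frac_op a (v n) y) \<longlonglongrightarrow> frac_op a z y" if y: "y \<in> X_space \<Omega> a" for y
  proof (rule tendsto_if_subseq_tendsto)
    fix r :: "nat \<Rightarrow> nat" assume "strict_mono r"
    from sub[OF this] obtain q :: "nat \<Rightarrow> nat" where q: "strict_mono q" "AE x in lebesgue. (\<lambda>n. v (r (q n)) x) \<longlonglongrightarrow> z x"
      by blast
    have "sq_int lebesgue (gagliardo a y)" using y by (simp add: X_space_iff)
    from sq_int_ae_limit(2)[OF s(2) bd' gm gl[OF q(2)] this]
    have "(\<lambda>n. frac_op a (v (r (q n))) y) \<longlonglongrightarrow> frac_op a z y"
      unfolding frac_op_gagliardo by (intro tendsto_intros)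
    with q(1) show "\<exists>q::nat \<Rightarrow> nat. strict_mono q \<and> (\<lambda>n. frac_op a (v (r (q n))) y) \<longlonglongrightarrow> frac_op a z y" by blast
  qed
  with zX z(2) show ?thesis using that by blast
qed

section \<open>Lipschitz cut-off functions and approximation of indicators\<close>

lemma nn_integral_lborel_translate:
  fixes k :: "'a::euclidean_space \<Rightarrow> ennreal"
  assumes [measurable]: "k \<in> borel_measurable borel"
  shows "(\<integral>\<^sup>+y. k (y - x) \<partial>lborel) = (\<integral>\<^sup>+y. k y \<partial>lborel)"
proof -
  have "(\<integral>\<^sup>+y. k y \<partial>lborel) = (\<integral>\<^sup>+y. k y \<partial>distr lborel borel ((+) (- x)))"
    by (simp add: lborel_distr_plus)
  also have "\<dots> = (\<integral>\<^sup>+y. k (- x + y) \<partial>lborel)"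
    by (rule nn_integral_distr) measurable
  finally show ?thesis by simp
qed

text \<open>On the dyadic shell where norm z is about 2^(-j), the size of the integrand times the
  volume is of order 2^((2 a - 2) j); where norm z is about 2^j it is of order 2^(-2 a j). Both
  series converge because 0 < a < 1. Full balls stand in for the shells, which only enlarges the
  bound.\<close>

lemma nn_integral_singular_kernel_finite:
  assumes a: "0 < a" "a < 1"
  shows "(\<integral>\<^sup>+z. ennreal (min 1 ((norm z)\<^sup>2) * norm (z::'a::euclidean_space) powr - (real DIM('a) + 2 * a)) \<partial>lborel) < \<infinity>"
proof -
  let ?N = "DIM('a)"
  let ?P = "real DIM('a) + 2 * a"
  have P: "?P > 0" using a by (simp add: add_pos_pos)
  let ?k = "\<lambda>z::'a. min 1 ((norm z)\<^sup>2) * norm z powr - ?P"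
  let ?\<omega> = "unit_ball_vol (real DIM('a))"
  have \<omega>: "?\<omega> \<ge> 0" by simp
  \<comment> \<open>For norm z between 2^(-j-1) and 2^(-j) the integrand is at most 2^(-2 j) times
    2^((j+1) P), which is \<open>c j\<close>, with P standing for \<open>?P\<close>; for norm z
    \<ge> 2^j it is at most 2^(-j P), which is \<open>d j\<close>.\<close>
  define c where "c = (\<lambda>j::nat. 2 powr (?P + j * (?P - 2)))"
  define d where "d = (\<lambda>j::nat. 2 powr (- (j * ?P)))"
  let ?A = "\<lambda>j::nat. cball (0::'a) (2 powr - j)"
  let ?B = "\<lambda>j::nat. cball (0::'a) (2 powr (real j + 1))"
  have [measurable]: "cball (0::'a) r \<in> sets borel" for r by simp
  have le_suminf: "f j \<le> suminf f" for f :: "nat \<Rightarrow> ennreal" and j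
    using sum_le_suminf[of f "{j}"] by simp
  have pt: "ennreal (?k z) \<le> (\<Sum>j. ennreal (c j) * indicator (?A j) z) + (\<Sum>j. ennreal (d j) * indicator (?B j) z)" for z
  proof (cases "z = 0")
    case False
    then have nz: "norm z > 0" by simp
    show ?thesis
    proof (cases "norm z \<ge> 1")
      case True
      define j where "j = nat \<lfloor>log 2 (norm z)\<rfloor>"
      have "log 2 (norm z) \<ge> 0" using True nz by (subst zero_le_log_cancel_iff) auto
      then have "\<lfloor>log 2 (norm z)\<rfloor> = int j" by (simp add: j_def)
      then have j: "2 powr j \<le> norm z" "norm z < 2 powr (j + 1)"
        using floor_log_eq_powr_iff[OF nz, of 2 "int j"] by (auto simp: add.commute)
      have "?k z \<le> 1 * norm z powr - ?P" by (intro mult_right_mono) auto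
      also have "\<dots> \<le> (2 powr j) powr - ?P"
        using powr_mono2'[of "- ?P" "2 powr j" "norm z"] j P by simp
      also have "\<dots> = d j" by (simp add: powr_powr d_def algebra_simps)
      finally have "?k z \<le> d j" .
      moreover have zB: "z \<in> ?B j" using j(2) by (simp add: add.commute)
      ultimately have "ennreal (?k z) \<le> ennreal (d j) * indicator (?B j) z"
        unfolding indicator_simps(1)[OF zB] mult_1_right by (intro ennreal_leI)
      also have "\<dots> \<le> (\<Sum>j. ennreal (d j) * indicator (?B j) z)"
        by (rule le_suminf[of "\<lambda>j. ennreal (d j) * indicator (?B j) z"])
      finally show ?thesis by (rule order_trans) simp
    next
      case False
      define j where "j = nat \<lfloor>log 2 (1 / norm z)\<rfloor>"
      have "log 2 (1 / norm z) \<ge> 0" using False nz by (subst zero_le_log_cancel_iff) auto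
      then have "\<lfloor>log 2 (1 / norm z)\<rfloor> = int j" by (simp add: j_def)
      then have j': "2 powr j \<le> 1 / norm z" "1 / norm z < 2 powr (j + 1)"
        using floor_log_eq_powr_iff[of "1 / norm z" 2 "int j"] nz by (auto simp: add.commute)
      then have j: "norm z \<le> 2 powr - j" "2 powr - (real j + 1) \<le> norm z"
      proof -
        have "1 / (1 / norm z) \<le> 1 / 2 powr j" using j'(1) nz by (intro divide_left_mono) auto
        then show "norm z \<le> 2 powr - j" by (simp add: powr_minus_divide)
        have "1 / 2 powr (real j + 1) \<le> 1 / (1 / norm z)"
          using j'(2) nz by (intro divide_left_mono) (auto simp: add.commute)
        then show "2 powr - (real j + 1) \<le> norm z" unfolding powr_minus_divide by simp
      qed
      have "?k z \<le> (norm z)\<^sup>2 * norm z powr - ?P" by (intro mult_right_mono) auto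
      also have "\<dots> \<le> (2 powr - j)\<^sup>2 * (2 powr - (real j + 1)) powr - ?P"
        using powr_mono2'[of "- ?P" "2 powr - (real j + 1)" "norm z"] j P nz
        by (intro mult_mono power_mono) auto
      also have "\<dots> = 2 powr (- 2 * real j) * 2 powr ((real j + 1) * ?P)"
        by (simp add: powr_powr powr_realpow[symmetric] power2_eq_square powr_add[symmetric] algebra_simps)
      also have "\<dots> = c j" by (simp add: c_def powr_add[symmetric] algebra_simps)
      finally have "?k z \<le> c j" .
      moreover have zA: "z \<in> ?A j" using j(1) by simp
      ultimately have "ennreal (?k z) \<le> ennreal (c j) * indicator (?A j) z"
        unfolding indicator_simps(1)[OF zA] mult_1_right by (intro ennreal_leI)
      also have "\<dots> \<le> (\<Sum>j. ennreal (c j) * indicator (?A j) z)"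
        by (rule le_suminf[of "\<lambda>j. ennreal (c j) * indicator (?A j) z"])
      finally show ?thesis by (rule order_trans) simp
    qed
  qed simp
  have "(\<integral>\<^sup>+z. ennreal (?k z) \<partial>lborel) \<le> 
      (\<integral>\<^sup>+z. (\<Sum>j. ennreal (c j) * indicator (?A j) z) + (\<Sum>j. ennreal (d j) * indicator (?B j) z) \<partial>lborel)"
    by (intro nn_integral_mono pt)
  also have "\<dots> = (\<integral>\<^sup>+z. (\<Sum>j. ennreal (c j) * indicator (?A j) z) \<partial>lborel) + (\<integral>\<^sup>+z. (\<Sum>j. ennreal (d j) * indicator (?B j) z) \<partial>lborel)"
    by (rule nn_integral_add) measurable
  also have "\<dots> = (\<Sum>j. \<integral>\<^sup>+z. ennreal (c j) * indicator (?A j) z \<partial>lborel) + (\<Sum>j. \<integral>\<^sup>+z. ennreal (d j) * indicator (?B j) z \<partial>lborel)"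
    by (intro arg_cong2[where f = "(+)"] nn_integral_suminf) measurable
  also have "\<dots> = (\<Sum>j. ennreal (?\<omega> * 2 powr ?P * (2 powr (2 * a - 2)) ^ j)) + (\<Sum>j. ennreal (?\<omega> * 2 ^ ?N * (2 powr (- 2 * a)) ^ j))"
  proof (intro arg_cong2[where f = "(+)"] arg_cong[where f = suminf] ext)
    fix j
    have "(\<integral>\<^sup>+z. ennreal (c j) * indicator (?A j) z \<partial>lborel) = ennreal (c j) * ennreal (?\<omega> * (2 powr - j) ^ ?N)"
      by (subst nn_integral_cmult_indicator) (auto simp: emeasure_cball add.commute)
    also have "\<dots> = ennreal (c j * (?\<omega> * (2 powr - j) ^ ?N))"
      by (subst ennreal_mult) (auto simp: c_def)
    also have "c j * (?\<omega> * (2 powr - j) ^ ?N) = ?\<omega> * (c j * 2 powr (- j * ?N))"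
      by (simp add: powr_realpow[symmetric] powr_powr)
    also have "c j * 2 powr (- j * ?N) = 2 powr ?P * (2 powr (2 * a - 2)) ^ j"
      unfolding c_def by (simp add: powr_realpow[symmetric] powr_powr powr_add[symmetric] algebra_simps)
    finally show "(\<integral>\<^sup>+z. ennreal (c j) * indicator (?A j) z \<partial>lborel) = ennreal (?\<omega> * 2 powr ?P * (2 powr (2 * a - 2)) ^ j)"
      by (simp add: mult.assoc)
    have "(\<integral>\<^sup>+z. ennreal (d j) * indicator (?B j) z \<partial>lborel) = ennreal (d j) * ennreal (?\<omega> * (2 powr (real j + 1)) ^ ?N)"
      by (subst nn_integral_cmult_indicator) (auto simp: emeasure_cball add.commute)
    also have "\<dots> = ennreal (d j * (?\<omega> * (2 powr (real j + 1)) ^ ?N))"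
      by (subst ennreal_mult) (auto simp: d_def)
    also have "d j * (?\<omega> * (2 powr (real j + 1)) ^ ?N) = ?\<omega> * (d j * 2 powr ((real j + 1) * ?N))"
      by (simp add: powr_realpow[symmetric] powr_powr)
    also have "d j * 2 powr ((real j + 1) * ?N) = 2 ^ ?N * (2 powr (- 2 * a)) ^ j"
      unfolding d_def by (simp add: powr_realpow[symmetric] powr_powr powr_add[symmetric] algebra_simps)
    finally show "(\<integral>\<^sup>+z. ennreal (d j) * indicator (?B j) z \<partial>lborel) = ennreal (?\<omega> * 2 ^ ?N * (2 powr (- 2 * a)) ^ j)"
      by (simp add: mult.assoc)
  qed
  also have "\<dots> < \<infinity>"
  proof -
    have fin: "(\<Sum>j. ennreal (C * q ^ j)) < \<infinity>" if "C \<ge> 0" "0 \<le> q" "q < 1" for C q :: real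
      using that by (subst suminf_ennreal_eq[OF _ sums_mult[OF geometric_sums]]) auto
    have q: "2 powr (2 * a - 2) < (1::real)" "2 powr (- 2 * a) < (1::real)"
      using a powr_less_mono[of "2 * a - 2" 0 2] powr_less_mono[of "- 2 * a" 0 2] by auto
    have "(\<Sum>j. ennreal (?\<omega> * 2 powr ?P * (2 powr (2 * a - 2)) ^ j)) < \<infinity>"
      by (rule fin[OF mult_nonneg_nonneg[OF \<omega> powr_ge_zero] powr_ge_zero q(1)])
    moreover have "(\<Sum>j. ennreal (?\<omega> * 2 ^ ?N * (2 powr (- 2 * a)) ^ j)) < \<infinity>"
      by (rule fin[OF mult_nonneg_nonneg[OF \<omega>] powr_ge_zero q(2)]) simp
    ultimately show ?thesis by simp
  qed
  finally show ?thesis .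
qed

text \<open>The squared difference of the values is at most K min(1, norm (x - y)^2) and vanishes
  unless x or y lies in \<Omega>. For each of the two cases the kernel is integrated first over the
  other variable, which gives a finite constant by translation invariance; what remains is the
  measure of a ball.\<close>

lemma lipschitz_in_X_space:
  fixes \<phi> :: "'a::euclidean_space \<Rightarrow> real"
  assumes a: "0 < a" "a < 1" and bd: "bounded \<Omega>"
    and L: "\<And>x y. \<bar>\<phi> x - \<phi> y\<bar> \<le> L * norm (x - y)"
    and b: "\<And>x. 0 \<le> \<phi> x" "\<And>x. \<phi> x \<le> 1"
    and z: "\<And>x. x \<notin> \<Omega> \<Longrightarrow> \<phi> x = 0"
  shows "\<phi> \<in> X_space \<Omega> a"
proof -
  let ?P = "real DIM('a) + 2 * a"
  have "L-lipschitz_on UNIV \<phi>" if "L \<ge> 0"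
    using L that by (auto simp: lipschitz_on_def dist_norm)
  moreover have "L \<ge> 0"
  proof -
    obtain e :: 'a where e: "e \<in> Basis" by (rule that[OF SOME_Basis])
    have "0 \<le> L * norm (e - 0)" by (rule order_trans[OF abs_ge_zero L])
    then show ?thesis using e by simp
  qed
  ultimately have "continuous_on UNIV \<phi>" using lipschitz_on_continuous_on by blast
  then have \<phi>m[measurable]: "\<phi> \<in> borel_measurable borel" by (rule borel_measurable_continuous_onI)
  obtain R where R: "\<And>x. x \<in> \<Omega> \<Longrightarrow> x \<in> cball 0 R"
    using bd by (auto simp: bounded_iff)
  let ?S = "cball (0::'a) R"
  define K where "K = max 1 (L\<^sup>2)"
  define k where "k = (\<lambda>z::'a. min 1 ((norm z)\<^sup>2) * norm z powr - ?P)"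
  have km[measurable]: "k \<in> borel_measurable borel" unfolding k_def by measurable
  have k0: "k z \<ge> 0" for z by (simp add: k_def)
  have ksym: "k (x - y) = k (y - x)" for x y by (simp add: k_def norm_minus_commute)
  have sq: "sq_int lebesgue \<phi>"
  proof -
    have "integrable lebesgue (\<lambda>x. (\<phi> x)\<^sup>2)"
    proof (rule Bochner_Integration.integrable_bound)
      show "integrable lebesgue (indicator ?S :: 'a \<Rightarrow> real)"
        using lmeasurable_cball unfolding lmeasurable_iff_integrable .
      show "(\<lambda>x. (\<phi> x)\<^sup>2) \<in> borel_measurable lebesgue" by (simp add: measurable_completion)
      show "AE x in lebesgue. norm ((\<phi> x)\<^sup>2) \<le> norm (indicator ?S x :: real)"
      proof (rule AE_I2)
        fix x
        show "norm ((\<phi> x)\<^sup>2) \<le> norm (indicator ?S x :: real)"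
          using z[of x] R[of x] b[of x] by (cases "x \<in> ?S") (auto intro: power_le_one)
      qed
    qed
    then show ?thesis by (simp add: sq_int_def measurable_completion)
  qed
  have pt: "(gagliardo a \<phi> (x, y))\<^sup>2 \<le> (indicator ?S x + indicator ?S y) * (K * k (y - x))" for x y
  proof (cases "x \<in> \<Omega> \<or> y \<in> \<Omega>")
    case True
    have "(\<phi> x - \<phi> y)\<^sup>2 \<le> K * min 1 ((norm (x - y))\<^sup>2)"
    proof -
      have "\<bar>\<phi> x - \<phi> y\<bar> \<le> 1" using b[of x] b[of y] by linarith
      then have "(\<phi> x - \<phi> y)\<^sup>2 \<le> 1" by (simp add: abs_square_le_1)
      moreover have "(\<phi> x - \<phi> y)\<^sup>2 \<le> L\<^sup>2 * (norm (x - y))\<^sup>2"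
        using power_mono[OF L[of x y], of 2] by (simp add: power_mult_distrib)
      moreover have "L\<^sup>2 * (norm (x - y))\<^sup>2 \<le> K * (norm (x - y))\<^sup>2" by (intro mult_right_mono) (auto simp: K_def)
      ultimately show ?thesis by (auto simp: min_def K_def)
    qed
    then have "(\<phi> x - \<phi> y)\<^sup>2 * norm (x - y) powr - ?P \<le> K * min 1 ((norm (x - y))\<^sup>2) * norm (x - y) powr - ?P"
      by (intro mult_right_mono) auto
    moreover have "(gagliardo a \<phi> (x, y))\<^sup>2 = (\<phi> x - \<phi> y)\<^sup>2 * norm (x - y) powr - ?P"
      unfolding gagliardo_square powr_minus_divide by simp
    moreover have "K * k (y - x) = K * min 1 ((norm (x - y))\<^sup>2) * norm (x - y) powr - ?P"
      unfolding k_def norm_minus_commute[of y x] by (rule mult.assoc[symmetric])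
    ultimately have "(gagliardo a \<phi> (x, y))\<^sup>2 \<le> 1 * (K * k (y - x))" by linarith
    also have "\<dots> \<le> (indicator ?S x + indicator ?S y) * (K * k (y - x))"
      using True R k0 by (intro mult_right_mono) (auto simp: indicator_def K_def)
    finally show ?thesis .
  next
    case False
    then have "(gagliardo a \<phi> (x, y))\<^sup>2 = 0" using z by (simp add: gagliardo_square)
    moreover have "0 \<le> (indicator ?S x + indicator ?S y) * (K * k (y - x))"
      using k0 by (intro mult_nonneg_nonneg) (auto simp: K_def)
    ultimately show ?thesis by linarith
  qed
  have gm[measurable]: "gagliardo a \<phi> \<in> borel_measurable (lborel \<Otimes>\<^sub>M lborel)"
    unfolding gagliardo_def[abs_def] by measurable
  define I where "I = (\<integral>\<^sup>+z. ennreal (K * k z) \<partial>lborel)"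
  have K0: "K \<ge> 0" by (simp add: K_def)
  have Ifin: "I < \<infinity>"
  proof -
    have "I = ennreal K * (\<integral>\<^sup>+z. ennreal (k z) \<partial>lborel)"
      unfolding I_def by (simp add: ennreal_mult K0 k0 nn_integral_cmult)
    also have "\<dots> < \<infinity>" using nn_integral_singular_kernel_finite[OF a, where 'a = 'a] 
      by (simp add: k_def ennreal_mult_less_top)
    finally show ?thesis .
  qed
  have S: "(\<integral>\<^sup>+x. indicator ?S x * I \<partial>lborel) < \<infinity>"
    using Ifin emeasure_compact_finite[OF compact_cball, of 0 R] 
    by (subst nn_integral_multc) (auto simp: ennreal_mult_less_top intro!: borel_measurable_indicator)
  have iS: "(indicator ?S :: 'a \<Rightarrow> ennreal) \<in> borel_measurable borel"
    by (intro borel_measurable_indicator) simp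
  have Sm: "(\<lambda>z. indicator ?S (fst z) :: ennreal) \<in> borel_measurable (lborel \<Otimes>\<^sub>M lborel)"
    "(\<lambda>z. indicator ?S (snd z) :: ennreal) \<in> borel_measurable (lborel \<Otimes>\<^sub>M lborel)"
    using measurable_compose[OF borel_measurable_continuous_onI[OF continuous_on_fst[OF continuous_on_id]] iS]
      measurable_compose[OF borel_measurable_continuous_onI[OF continuous_on_snd[OF continuous_on_id]] iS]
    unfolding lborel_prod by auto
  have Kk: "(\<lambda>z. ennreal (K * k z)) \<in> borel_measurable borel" by measurable
  have km': "(\<lambda>z. ennreal (K * k (snd z - fst z))) \<in> borel_measurable (lborel \<Otimes>\<^sub>M lborel)"
    "(\<lambda>z. ennreal (K * k (fst z - snd z))) \<in> borel_measurable (lborel \<Otimes>\<^sub>M lborel)"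
    using measurable_compose[OF borel_measurable_continuous_onI Kk, of "\<lambda>z. snd z - fst z"]
      measurable_compose[OF borel_measurable_continuous_onI Kk, of "\<lambda>z. fst z - snd z"]
    unfolding lborel_prod by (auto simp: continuous_on_diff continuous_on_fst continuous_on_snd)
  have "(\<integral>\<^sup>+z. ennreal ((gagliardo a \<phi> z)\<^sup>2) \<partial>(lborel \<Otimes>\<^sub>M lborel)) 
      \<le> (\<integral>\<^sup>+z. indicator ?S (fst z) * ennreal (K * k (snd z - fst z)) + indicator ?S (snd z) * ennreal (K * k (fst z - snd z)) \<partial>(lborel \<Otimes>\<^sub>M lborel))"
  proof (rule nn_integral_mono)
    fix z :: "'a \<times> 'a"
    obtain x y where z: "z = (x, y)" by (cases z)
    have i: "ennreal (indicator A w * c) = indicator A w * ennreal c" for A and w :: 'a and c :: real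
      by (simp add: indicator_def)
    have "ennreal ((gagliardo a \<phi> z)\<^sup>2) \<le> ennreal (indicator ?S x * (K * k (y - x)) + indicator ?S y * (K * k (y - x)))"
      unfolding z using pt[of x y] by (intro ennreal_leI) (simp add: distrib_right)
    also have "\<dots> = indicator ?S x * ennreal (K * k (y - x)) + indicator ?S y * ennreal (K * k (x - y))"
      using K0 k0 by (subst ennreal_plus) (auto simp: i ksym[of y x])
    finally show "ennreal ((gagliardo a \<phi> z)\<^sup>2) \<le> indicator ?S (fst z) * ennreal (K * k (snd z - fst z)) + indicator ?S (snd z) * ennreal (K * k (fst z - snd z))"
      by (simp add: z)
  qed
  also have "\<dots> = (\<integral>\<^sup>+z. indicator ?S (fst z) * ennreal (K * k (snd z - fst z)) \<partial>(lborel \<Otimes>\<^sub>M lborel)) + (\<integral>\<^sup>+z. indicator ?S (snd z) * ennreal (K * k (fst z - snd z)) \<partial>(lborel \<Otimes>\<^sub>M lborel))"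
    by (rule nn_integral_add) (intro borel_measurable_times_ennreal Sm km')+
  also have "(\<integral>\<^sup>+z. indicator ?S (fst z) * ennreal (K * k (snd z - fst z)) \<partial>(lborel \<Otimes>\<^sub>M lborel)) = (\<integral>\<^sup>+x. indicator ?S x * I \<partial>lborel)"
    unfolding I_def by (subst lborel.nn_integral_fst[symmetric]) 
      (auto intro!: borel_measurable_times_ennreal Sm km' simp: Kk nn_integral_cmult nn_integral_lborel_translate[where k = "\<lambda>z. ennreal (K * k z)"])
  also have "(\<integral>\<^sup>+z. indicator ?S (snd z) * ennreal (K * k (fst z - snd z)) \<partial>(lborel \<Otimes>\<^sub>M lborel)) = (\<integral>\<^sup>+x. indicator ?S x * I \<partial>lborel)"
    unfolding I_def by (subst lborel_pair.nn_integral_snd[symmetric]) 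
      (auto intro!: borel_measurable_times_ennreal Sm km' simp: Kk nn_integral_cmult nn_integral_lborel_translate[where k = "\<lambda>z. ennreal (K * k z)"])
  also have "\<dots> + \<dots> < \<infinity>" using S by simp
  finally have "(\<integral>\<^sup>+z. ennreal ((gagliardo a \<phi> z)\<^sup>2) \<partial>lborel) < \<infinity>" by (simp add: lborel_prod)
  then have "integrable lborel (\<lambda>z. (gagliardo a \<phi> z)\<^sup>2)"
    using gm by (intro integrableI_bounded) (auto simp: lborel_prod)
  then have "integrable lebesgue (\<lambda>z. (gagliardo a \<phi> z)\<^sup>2)"
    using gm by (subst integrable_completion) (auto simp: lborel_prod)
  moreover have "gagliardo a \<phi> \<in> borel_measurable lebesgue"
    by (rule gagliardo_measurable) (simp add: measurable_completion)
  ultimately show ?thesis using sq z by (simp add: X_space_iff sq_int_def)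
qed

text \<open>Regularity of the measure places A between a compact K and an open U, up to measure
  \<eta>. The distance to the complement of U, divided by the gap \<open>\<rho>\<close> and capped
  at 1, is Lipschitz, equals 1 on K and vanishes off U.\<close>

lemma indicator_approx_in_X_space:
  fixes \<Omega> :: "'a::euclidean_space set"
  assumes a: "0 < a" "a < 1" and \<Omega>: "bounded \<Omega>" "open \<Omega>" 
    and A: "A \<in> sets lebesgue" "A \<subseteq> \<Omega>" and \<eta>: "\<eta> > 0"
  obtains \<phi> where "\<phi> \<in> X_space \<Omega> a" "(LINT x|lebesgue. (\<phi> x - indicator A x)\<^sup>2) \<le> \<eta>"
proof -
  obtain K where K: "closed K" "K \<subseteq> A" "A - K \<in> lmeasurable" "emeasure lebesgue (A - K) < ennreal (\<eta>/2)"
    using sets_lebesgue_inner_closed[OF A(1), of "\<eta>/2"] \<eta> by auto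
  obtain T where T: "open T" "A \<subseteq> T" "T - A \<in> lmeasurable" "emeasure lebesgue (T - A) < ennreal (\<eta>/2)"
    using sets_lebesgue_outer_open[OF A(1), of "\<eta>/2"] \<eta> by auto
  define U where "U = T \<inter> \<Omega>"
  have U: "open U" "A \<subseteq> U" "U \<subseteq> \<Omega>" "U \<subseteq> T" using T \<Omega> A by (auto simp: U_def)
  have "bounded K" using bounded_subset[OF \<Omega>(1)] K(2) A(2) by blast
  then have "compact K" using K(1) by (simp add: compact_eq_bounded_closed)
  moreover have "closed (-U)" "K \<inter> - U = {}" using U K(2) by (auto simp: closed_Compl)
  ultimately obtain \<rho> where \<rho>: "\<rho> > 0" "\<forall>x\<in>K. \<forall>y\<in>-U. \<rho> \<le> dist x y"
    using separate_compact_closed by blast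
  \<comment> \<open>\<open>infdist\<close> to the empty set is 0, so \<open>\<phi>\<close> could not
    equal 1 on K if U were the whole space.\<close>
  have ne: "-U \<noteq> {}"
  proof
    assume "-U = {}"
    then have "\<Omega> = UNIV" using U by auto
    then show False using \<Omega>(1) by simp
  qed
  define \<phi> where "\<phi> = (\<lambda>x. min 1 (infdist x (-U) / \<rho>))"
  have \<phi>K: "\<phi> x = 1" if "x \<in> K" for x
  proof -
    have "\<rho> \<le> infdist x (-U)"
      unfolding infdist_notempty[OF ne] using \<rho> that ne by (intro cINF_greatest) auto
    then show ?thesis using \<rho>(1) by (simp add: \<phi>_def field_simps)
  qed
  have \<phi>U: "\<phi> x = 0" if "x \<notin> U" for x
    using that by (simp add: \<phi>_def)
  have b: "0 \<le> \<phi> x" "\<phi> x \<le> 1" for x using \<rho>(1) infdist_nonneg[of x "-U"] by (auto simp: \<phi>_def)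
  have lip: "\<bar>\<phi> x - \<phi> y\<bar> \<le> (1/\<rho>) * norm (x - y)" for x y
  proof -
    have "\<bar>\<phi> x - \<phi> y\<bar> \<le> \<bar>infdist x (-U) / \<rho> - infdist y (-U) / \<rho>\<bar>"
      unfolding \<phi>_def by (auto simp: min_def abs_if)
    also have "\<dots> = \<bar>infdist x (-U) - infdist y (-U)\<bar> / \<rho>"
      using \<rho>(1) by (simp flip: diff_divide_distrib add: abs_divide)
    also have "\<dots> \<le> dist x y / \<rho>"
      using \<rho>(1) infdist_triangle_abs by (intro divide_right_mono) auto
    finally show ?thesis by (simp add: dist_norm)
  qed
  have X: "\<phi> \<in> X_space \<Omega> a"
    by (rule lipschitz_in_X_space[OF a \<Omega>(1) lip b]) (use \<phi>U U in auto)
  then have m[measurable]: "\<phi> \<in> borel_measurable lebesgue" by (simp add: X_space_iff sq_int_def)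
  have iK: "integrable lebesgue (indicator (A - K) :: 'a \<Rightarrow> real)" and iT: "integrable lebesgue (indicator (T - A) :: 'a \<Rightarrow> real)"
    using K T by (auto simp: lmeasurable_iff_integrable)
  have pt: "(\<phi> x - indicator A x)\<^sup>2 \<le> indicator (A - K) x + indicator (T - A) x" for x
  proof -
    have sq: "(\<phi> x - indicator A x)\<^sup>2 \<le> 1" 
      using b[of x] by (auto simp: indicator_def abs_square_le_1)
    show ?thesis
      using sq \<phi>K[of x] \<phi>U[of x] K(2) U by (auto simp: indicator_def split: if_splits)
  qed
  have "(LINT x|lebesgue. (\<phi> x - indicator A x)\<^sup>2) \<le> (LINT x|lebesgue. indicator (A - K) x + indicator (T - A) x)"
  proof (rule integral_mono)
    show i: "integrable lebesgue (\<lambda>x. indicator (A - K) x + indicator (T - A) x :: real)"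
      using iK iT by simp
    show "integrable lebesgue (\<lambda>x. (\<phi> x - indicator A x)\<^sup>2)"
      using pt A(1) by (intro Bochner_Integration.integrable_bound[OF i]) (auto simp: )
  qed (rule pt)
  also have "\<dots> = measure lebesgue (A - K) + measure lebesgue (T - A)"
    using iK iT by simp
  also have "\<dots> \<le> \<eta>/2 + \<eta>/2"
    using K(3,4) T(3,4) \<eta> by (intro add_mono) (auto simp: emeasure_eq_measure2 dest: less_imp_le)
  finally show ?thesis using that X by simp
qed

section \<open>An interpolation inequality of Ehrling type\<close>

text \<open>On a cell \<open>Q\<close> of a grid of mesh \<open>\<delta>\<close>, the integral of \<open>v\<^sup>2\<close> is \<open>(\<integral>\<^sub>Q v)\<^sup>2 / \<bar>Q\<bar>\<close> plus
  \<open>\<integral>\<integral>\<^sub>Q\<^sub>\<times>\<^sub>Q (v x - v y)\<^sup>2 / (2 \<bar>Q\<bar>)\<close>; the latter is controlled by the Gagliardo seminorm with a factor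
  \<open>\<delta> powr (2 \<sigma>)\<close>, the former by the functional after approximating indicators of cells in \<open>X_space\<close>.
  No compact embedding is needed.\<close>

definition cell :: "real \<Rightarrow> 'a::euclidean_space \<Rightarrow> 'a" where
  "cell \<delta> x = (\<Sum>i\<in>Basis. of_int \<lfloor>(x \<bullet> i) / \<delta>\<rfloor> *\<^sub>R i)"

lemma cell_inner: "i \<in> Basis \<Longrightarrow> cell \<delta> x \<bullet> i = of_int \<lfloor>(x \<bullet> i) / \<delta>\<rfloor>"
  by (simp add: cell_def)

lemma cell_eq_iff: "cell \<delta> x = cell \<delta> y \<longleftrightarrow> (\<forall>i\<in>Basis. \<lfloor>(x \<bullet> i) / \<delta>\<rfloor> = \<lfloor>(y \<bullet> i) / \<delta>\<rfloor>)"
  by (subst euclidean_eq_iff) (simp add: cell_inner)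

lemma cell_bounds:
  assumes "\<delta> > 0" "i \<in> Basis"
  shows "\<delta> * (cell \<delta> x \<bullet> i) \<le> x \<bullet> i" "x \<bullet> i < \<delta> * (cell \<delta> x \<bullet> i) + \<delta>"
proof -
  let ?f = "of_int \<lfloor>(x \<bullet> i) / \<delta>\<rfloor> :: real"
  have "?f * \<delta> \<le> x \<bullet> i" unfolding pos_le_divide_eq[OF assms(1), symmetric] by linarith
  moreover have "x \<bullet> i < (?f + 1) * \<delta>" unfolding pos_divide_less_eq[OF assms(1), symmetric] by linarith
  ultimately show "\<delta> * (cell \<delta> x \<bullet> i) \<le> x \<bullet> i" "x \<bullet> i < \<delta> * (cell \<delta> x \<bullet> i) + \<delta>"
    by (simp_all add: cell_inner[OF assms(2)] algebra_simps)
qed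

lemma same_cell_norm_le:
  fixes x y :: "'a::euclidean_space"
  assumes "\<delta> > 0" "cell \<delta> x = cell \<delta> y"
  shows "norm (x - y) \<le> real DIM('a) * \<delta>"
proof -
  have "norm (x - y) \<le> (\<Sum>i\<in>Basis. \<bar>(x - y) \<bullet> i\<bar>)" by (rule norm_le_l1)
  also have "\<dots> \<le> (\<Sum>i\<in>(Basis :: 'a set). \<delta>)"
  proof (rule sum_mono)
    fix i :: 'a assume "i \<in> Basis"
    then show "\<bar>(x - y) \<bullet> i\<bar> \<le> \<delta>"
      using cell_bounds[OF assms(1), of i x] cell_bounds[OF assms(1), of i y] assms(2)
      by (simp add: inner_diff_left abs_le_iff)
  qed
  finally show ?thesis by simp
qed

lemma cell_sets: "{x::'a::euclidean_space. cell \<delta> x = z} \<in> sets borel"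
proof -
  have "{x::'a. cell \<delta> x = z} = {x\<in>space borel. \<forall>i\<in>Basis. of_int \<lfloor>(x \<bullet> i) / \<delta>\<rfloor> = z \<bullet> i}"
    by (subst euclidean_eq_iff) (simp add: cell_inner)
  also have "\<dots> \<in> sets borel" by measurable
  finally show ?thesis .
qed

text \<open>The half-open cube lies between the open and the closed box, which have the same
  measure.\<close>

lemma cell_measure:
  fixes y :: "'a::euclidean_space"
  assumes \<delta>: "\<delta> > 0"
  shows "{x. cell \<delta> x = cell \<delta> y} \<in> lmeasurable" "measure lebesgue {x. cell \<delta> x = cell \<delta> y} = \<delta> ^ DIM('a)"
proof -
  let ?Q = "{x. cell \<delta> x = cell \<delta> y}"
  let ?l = "\<delta> *\<^sub>R cell \<delta> y" and ?u = "\<delta> *\<^sub>R cell \<delta> y + (\<Sum>i\<in>Basis. \<delta> *\<^sub>R i) :: 'a"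
  have ui: "?u \<bullet> i = \<delta> * (cell \<delta> y \<bullet> i) + \<delta>" if "i \<in> Basis" for i
    using that by (simp add: inner_add_left inner_sum_left inner_Basis if_distrib sum.delta' cong: if_cong)
  have 1: "box ?l ?u \<subseteq> ?Q"
  proof
    fix x assume x: "x \<in> box ?l ?u"
    have "\<lfloor>(x \<bullet> i) / \<delta>\<rfloor> = \<lfloor>(y \<bullet> i) / \<delta>\<rfloor>" if i: "i \<in> Basis" for i
    proof -
      have "\<delta> * of_int \<lfloor>(y \<bullet> i) / \<delta>\<rfloor> < x \<bullet> i" "x \<bullet> i < \<delta> * of_int \<lfloor>(y \<bullet> i) / \<delta>\<rfloor> + \<delta>"
        using x i ui[OF i] by (auto simp: mem_box cell_inner)
      then show ?thesis using \<delta> by (intro floor_unique) (auto simp: field_simps)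
    qed
    then show "x \<in> ?Q" by (simp add: cell_eq_iff)
  qed
  have 2: "?Q \<subseteq> cbox ?l ?u"
  proof
    fix x assume "x \<in> ?Q"
    then have c: "cell \<delta> x = cell \<delta> y" by simp
    show "x \<in> cbox ?l ?u"
      unfolding mem_box using cell_bounds[OF \<delta>, of _ x] ui unfolding c by (auto intro: less_imp_le)
  qed
  have Qs: "?Q \<in> sets lebesgue" using cell_sets[of \<delta> "cell \<delta> y"] by simp
  show "?Q \<in> lmeasurable"
    by (rule fmeasurableI2[OF lmeasurable_cbox 2 Qs])
  then have Qm: "?Q \<in> lmeasurable" .
  have lu: "?l \<bullet> i \<le> ?u \<bullet> i" "(?u - ?l) \<bullet> i = \<delta>" if "i \<in> Basis" for i
    using \<delta> ui[OF that] that by (simp_all add: inner_diff_left)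
  have b: "measure lebesgue (box ?l ?u) = \<delta> ^ DIM('a)"
    using lu by (simp add: measure_lborel_box_eq box_eq_empty)
  have c: "measure lebesgue (cbox ?l ?u) = \<delta> ^ DIM('a)"
    using lu by (simp add: measure_lborel_cbox_eq)
  have "\<delta> ^ DIM('a) \<le> measure lebesgue ?Q"
    unfolding b[symmetric] by (rule measure_mono_fmeasurable[OF 1 _ Qm]) simp
  moreover have "measure lebesgue ?Q \<le> \<delta> ^ DIM('a)"
    unfolding c[symmetric] by (rule measure_mono_fmeasurable[OF 2 Qs lmeasurable_cbox])
  ultimately show "measure lebesgue ?Q = \<delta> ^ DIM('a)" by simp
qed

lemma finite_cells:
  fixes \<Omega> :: "'a::euclidean_space set"
  assumes "\<delta> > 0" "bounded \<Omega>"
  shows "finite (cell \<delta> ` \<Omega>)"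
proof -
  obtain R where R: "\<And>x. x \<in> \<Omega> \<Longrightarrow> norm x \<le> R" using assms(2) by (auto simp: bounded_iff)
  let ?I = "{\<lfloor>- R / \<delta>\<rfloor>..\<lfloor>R / \<delta>\<rfloor>}"
  have "cell \<delta> ` \<Omega> \<subseteq> (\<lambda>f. \<Sum>i\<in>Basis. of_int (f i) *\<^sub>R i) ` (PiE Basis (\<lambda>_. ?I))"
  proof
    fix z assume "z \<in> cell \<delta> ` \<Omega>"
    then obtain x where x: "x \<in> \<Omega>" "z = cell \<delta> x" by blast
    let ?f = "restrict (\<lambda>i. \<lfloor>(x \<bullet> i) / \<delta>\<rfloor>) Basis"
    have F: "?f \<in> PiE Basis (\<lambda>_. ?I)"
    proof (rule restrict_PiE_iff[THEN iffD2], intro ballI)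
      fix i :: 'a assume "i \<in> Basis"
      then have "\<bar>x \<bullet> i\<bar> \<le> R" using Basis_le_norm[of i x] R[OF x(1)] by linarith
      then have "- R / \<delta> \<le> (x \<bullet> i) / \<delta>" "(x \<bullet> i) / \<delta> \<le> R / \<delta>"
        using assms(1) divide_right_mono[of "- R" "x \<bullet> i" \<delta>] by (auto intro!: divide_right_mono)
      then show "\<lfloor>(x \<bullet> i) / \<delta>\<rfloor> \<in> ?I" by (auto intro: floor_mono)
    qed
    have G: "z = (\<Sum>i\<in>Basis. of_int (?f i) *\<^sub>R i)" by (simp add: x cell_def)
    show "z \<in> (\<lambda>f. \<Sum>i\<in>Basis. of_int (f i) *\<^sub>R i) ` (PiE Basis (\<lambda>_. ?I))"
      using imageI[OF F, of "\<lambda>f. \<Sum>i\<in>(Basis :: 'a set). of_int (f i) *\<^sub>R i"] unfolding G .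
  qed
  then show ?thesis by (rule finite_subset) (auto intro!: finite_PiE)
qed

lemma ehrling:
  fixes \<Omega> :: "'a::euclidean_space set"
  assumes \<Omega>: "bounded \<Omega>" "open \<Omega>" and s: "0 < s" "s < 1" and \<sigma>: "0 < \<sigma>" "\<sigma> < 1" and \<epsilon>: "\<epsilon> > 0"
  obtains C where "C \<ge> 0"
    "\<And>v A. v \<in> X_space \<Omega> \<sigma> \<Longrightarrow> A \<ge> 0 \<Longrightarrow>
      (\<And>\<phi>. \<phi> \<in> X_space \<Omega> s \<Longrightarrow> \<bar>LINT x|lebesgue. v x * \<phi> x\<bar> \<le> A * X_norm s \<phi>) \<Longrightarrow>
      (LINT x|lebesgue. (v x)\<^sup>2) \<le> \<epsilon> * frac_op \<sigma> v v + C * A\<^sup>2"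
proof -
  let ?N = "DIM('a)"
  let ?P = "real ?N + 2 * \<sigma>"
  let ?c = "frac_const ?N \<sigma>"
  have P: "?P > 0" using \<sigma> by (simp add: add_pos_pos)
  have c: "?c > 0" by (rule frac_const_pos[OF \<sigma>])
  \<comment> \<open>Chosen so that \<open>D powr ?P / \<delta> ^ ?N / ?c\<close> equals \<epsilon> /
    2, where D bounds the distance of two points in one cell. Twice this quantity is the coefficient
    of \<open>frac_op \<sigma> v v\<close> at the end.\<close>
  define \<delta> where "\<delta> = (\<epsilon> * ?c / (2 * real ?N powr ?P)) powr (1 / (2 * \<sigma>))"
  have base: "\<epsilon> * ?c / (2 * real ?N powr ?P) > 0" using \<epsilon> c by simp
  then have \<delta>: "\<delta> > 0" unfolding \<delta>_def powr_gt_zero by linarith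
  have \<delta>\<sigma>: "\<delta> powr (2 * \<sigma>) = \<epsilon> * ?c / (2 * real ?N powr ?P)"
  proof -
    have e: "1 / (2 * \<sigma>) * (2 * \<sigma>) = 1" using \<sigma> by simp
    show ?thesis unfolding \<delta>_def powr_powr e by (rule powr_one[OF less_imp_le[OF base]])
  qed
  define D where "D = real ?N * \<delta>"
  have DP: "D powr ?P / \<delta> ^ ?N / ?c = \<epsilon> / 2"
  proof -
    have "D powr ?P = real ?N powr ?P * (\<delta> powr real ?N * \<delta> powr (2 * \<sigma>))"
      using \<delta> by (simp add: D_def powr_mult powr_add)
    also have "\<delta> powr real ?N = \<delta> ^ ?N" using \<delta> by (simp add: powr_realpow)
    finally show ?thesis using \<delta> c unfolding \<delta>\<sigma> by simp
  qed
  define Z where "Z = cell \<delta> ` \<Omega>"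
  have Z: "finite Z" unfolding Z_def by (rule finite_cells[OF \<delta> \<Omega>(1)])
  define Q where "Q = (\<lambda>z::'a. {x. cell \<delta> x = z})"
  have Qm: "Q z \<in> lmeasurable" "measure lebesgue (Q z) = \<delta> ^ ?N" if "z \<in> Z" for z
    using that cell_measure[OF \<delta>] by (auto simp: Z_def Q_def)
  have \<Omega>s: "\<Omega> \<in> sets lebesgue" using \<Omega>(2) by simp
  have Qs: "Q z \<in> sets lebesgue" for z unfolding Q_def using cell_sets[of \<delta> z] by simp
  \<comment> \<open>Replacing the indicator of a cell by \<open>\<phi> z\<close> costs 2 \<eta> I,
    with I the integral of v^2. With this \<eta> the total cost is at most half of \<delta>^N I and
    is absorbed on the left.\<close>
  define \<eta> where "\<eta> = \<delta> ^ ?N / (4 * (real (card Z) + 1))"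
  have \<eta>: "\<eta> > 0" using \<delta> by (simp add: \<eta>_def)
  have "\<exists>\<phi>. \<phi> \<in> X_space \<Omega> s \<and> (LINT x|lebesgue. (\<phi> x - indicator (Q z \<inter> \<Omega>) x)\<^sup>2) \<le> \<eta>" for z
    using indicator_approx_in_X_space[OF s \<Omega>, of "Q z \<inter> \<Omega>" \<eta>] Qs \<Omega>s \<eta> by blast
  then obtain \<phi> where \<phi>: "\<And>z. \<phi> z \<in> X_space \<Omega> s" 
    "\<And>z. (LINT x|lebesgue. (\<phi> z x - indicator (Q z \<inter> \<Omega>) x)\<^sup>2) \<le> \<eta>"
    by metis
  \<comment> \<open>The approximants are fixed before v and A, so this constant is uniform in
    both.\<close>
  define C where "C = 4 * (\<Sum>z\<in>Z. (X_norm s (\<phi> z))\<^sup>2) / \<delta> ^ ?N"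
  show ?thesis
  proof (rule that[of C])
    show "C \<ge> 0" using \<delta> by (auto simp: C_def intro!: divide_nonneg_nonneg sum_nonneg)
    fix v :: "'a \<Rightarrow> real" and A :: real
    assume v: "v \<in> X_space \<Omega> \<sigma>" and A: "A \<ge> 0"
      and vA: "\<And>\<phi>. \<phi> \<in> X_space \<Omega> s \<Longrightarrow> \<bar>LINT x|lebesgue. v x * \<phi> x\<bar> \<le> A * X_norm s \<phi>"
    have v0: "AE x in lebesgue. x \<notin> \<Omega> \<longrightarrow> v x = 0" and vs: "sq_int lebesgue v" "sq_int lebesgue (gagliardo \<sigma> v)"
      using v by (auto simp: X_space_iff)
    have [measurable]: "v \<in> borel_measurable lebesgue" using vs by (simp add: sq_int_def)
    define I where "I = (LINT x|lebesgue. (v x)\<^sup>2)"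
    have I0: "I \<ge> 0" by (simp add: I_def)
    let ?J = "\<lambda>z x. indicator (Q z) x :: real"
    have i1: "integrable lebesgue (?J z)" if "z \<in> Z" for z
      using Qm(1)[OF that] by (simp add: lmeasurable_iff_integrable)
    have s1: "sq_int lebesgue (?J z)" if "z \<in> Z" for z
    proof -
      have "(\<lambda>x. (?J z x)\<^sup>2) = ?J z" by (auto simp: indicator_def)
      then show ?thesis using i1[OF that] Qs by (simp add: sq_int_def)
    qed
    have iv: "integrable lebesgue (\<lambda>x. ?J z x * v x)" if "z \<in> Z" for z
      by (rule sq_int_mult[OF s1[OF that] vs(1)])
    have iv2: "integrable lebesgue (\<lambda>x. ?J z x * (v x)\<^sup>2)" for z
      using integrable_mult_indicator[OF Qs, of "\<lambda>x. (v x)\<^sup>2" z] vs by (simp add: sq_int_def)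
    let ?q = "\<lambda>z w. ?J z (fst w) * ?J z (snd w) * (v (fst w) - v (snd w))\<^sup>2"
    have var: "has_bochner_integral lebesgue (?q z) 
        (2 * \<delta> ^ ?N * (LINT x|lebesgue. ?J z x * (v x)\<^sup>2) - 2 * (LINT x|lebesgue. ?J z x * v x)\<^sup>2)"
      if z: "z \<in> Z" for z
    proof -
      let ?a = "\<lambda>x. ?J z x * (v x)\<^sup>2" and ?b = "\<lambda>x. ?J z x * v x"
      have m: "(LINT x|lebesgue. ?J z x) = \<delta> ^ ?N" using Qm(2)[OF z] by simp
      have e: "?q z = (\<lambda>w. ?a (fst w) * ?J z (snd w) - 2 * (?b (fst w) * ?b (snd w)) + ?J z (fst w) * ?a (snd w))"
        by (simp add: fun_eq_iff power2_diff algebra_simps)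
      have "has_bochner_integral lebesgue (?q z)
         ((LINT x|lebesgue. ?a x) * (LINT x|lebesgue. ?J z x) - 2 * ((LINT x|lebesgue. ?b x) * (LINT x|lebesgue. ?b x)) 
          + (LINT x|lebesgue. ?J z x) * (LINT x|lebesgue. ?a x))"
        unfolding e
        by (intro has_bochner_integral_add has_bochner_integral_diff has_bochner_integral_mult_right 
            has_bochner_integral_lebesgue_prod iv2 iv[OF z] i1[OF z])
      then show ?thesis unfolding m by (simp add: power2_eq_square algebra_simps)
    qed
    have sumI: "I = (\<Sum>z\<in>Z. LINT x|lebesgue. ?J z x * (v x)\<^sup>2)"
    proof -
      have "I = (LINT x|lebesgue. (\<Sum>z\<in>Z. ?J z x * (v x)\<^sup>2))"
        unfolding I_def
      proof (rule integral_cong_AE)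
        show "AE x in lebesgue. (v x)\<^sup>2 = (\<Sum>z\<in>Z. ?J z x * (v x)\<^sup>2)"
          using v0
        proof eventually_elim
          case (elim x)
          show ?case
          proof (cases "x \<in> \<Omega>")
            case True
            have "(\<Sum>z\<in>Z. ?J z x * (v x)\<^sup>2) = (\<Sum>z\<in>Z. if z = cell \<delta> x then (v x)\<^sup>2 else 0)"
              by (intro sum.cong) (auto simp: Q_def indicator_def)
            also have "\<dots> = (v x)\<^sup>2" using Z True by (simp add: Z_def)
            finally show ?thesis by simp
          qed (use elim in simp)
        qed
      qed (use Qs in measurable)
      then show ?thesis by (simp add: iv2)
    qed
    have Gag: "(\<Sum>z\<in>Z. LINT w|lebesgue. ?q z w) \<le> D powr ?P * (LINT w|lebesgue. (gagliardo \<sigma> v w)\<^sup>2)"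
    proof -
      have "(\<Sum>z\<in>Z. LINT w|lebesgue. ?q z w) = (LINT w|lebesgue. (\<Sum>z\<in>Z. ?q z w))"
        using var by (subst Bochner_Integration.integral_sum) (auto simp: has_bochner_integral_iff)
      also have "\<dots> \<le> (LINT w|lebesgue. D powr ?P * (gagliardo \<sigma> v w)\<^sup>2)"
      proof (rule integral_mono)
        show "integrable lebesgue (\<lambda>w. \<Sum>z\<in>Z. ?q z w)"
          using var by (intro Bochner_Integration.integrable_sum) (auto simp: has_bochner_integral_iff)
        show "integrable lebesgue (\<lambda>w. D powr ?P * (gagliardo \<sigma> v w)\<^sup>2)" using vs by (simp add: sq_int_def)
        fix w :: "'a \<times> 'a"
        obtain x y where w: "w = (x, y)" by (cases w)
        have "(\<Sum>z\<in>Z. ?q z w) = (\<Sum>z\<in>Z. if z = cell \<delta> x then (if cell \<delta> y = cell \<delta> x then (v x - v y)\<^sup>2 else 0) else 0)"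
          by (intro sum.cong) (auto simp: w Q_def indicator_def)
        also have "\<dots> \<le> (if cell \<delta> y = cell \<delta> x then (v x - v y)\<^sup>2 else 0)"
          using Z by simp
        also have "\<dots> \<le> D powr ?P * (gagliardo \<sigma> v w)\<^sup>2"
        proof (cases "cell \<delta> y = cell \<delta> x \<and> x \<noteq> y")
          case True
          then have n: "0 < norm (x - y)" "norm (x - y) \<le> D"
            using same_cell_norm_le[OF \<delta>, of x y] by (auto simp: D_def)
          then have "(v x - v y)\<^sup>2 = norm (x - y) powr ?P * (gagliardo \<sigma> v w)\<^sup>2"
            unfolding w gagliardo_square by simp
          also have "\<dots> \<le> D powr ?P * (gagliardo \<sigma> v w)\<^sup>2"
            using n P by (intro mult_right_mono powr_mono2) auto
          finally show ?thesis using True by simp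
        qed auto
        finally show "(\<Sum>z\<in>Z. ?q z w) \<le> D powr ?P * (gagliardo \<sigma> v w)\<^sup>2" .
      qed
      finally show ?thesis by simp
    qed
    have cellavg: "(LINT x|lebesgue. ?J z x * v x)\<^sup>2 \<le> 2 * A\<^sup>2 * (X_norm s (\<phi> z))\<^sup>2 + 2 * \<eta> * I" if z: "z \<in> Z" for z
    proof -
      have p: "sq_int lebesgue (\<phi> z)" using \<phi>(1) by (simp add: X_space_iff)
      let ?i = "indicator (Q z \<inter> \<Omega>) :: 'a \<Rightarrow> real"
      have "integrable lebesgue ?i"
        by (rule integrable_real_indicator) 
           (use Qs \<Omega>s fmeasurableD2[OF Qm(1)[OF z]] emeasure_mono[of "Q z \<inter> \<Omega>" "Q z" lebesgue] in \<open>auto simp: top.not_eq_extremum intro: le_less_trans\<close>)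
      moreover have "(\<lambda>x. (?i x)\<^sup>2) = ?i" by (auto simp: indicator_def)
      ultimately have i: "sq_int lebesgue ?i" using Qs \<Omega>s by (simp add: sq_int_def)
      have d: "sq_int lebesgue (\<lambda>x. \<phi> z x - ?i x)" by (rule sq_int_diff[OF p i])
      have "(LINT x|lebesgue. ?J z x * v x) = (LINT x|lebesgue. v x * ?i x)"
      proof (rule integral_cong_AE)
        show "AE x in lebesgue. ?J z x * v x = v x * ?i x"
          using v0 by eventually_elim (auto simp: indicator_def)
      qed (use Qs \<Omega>s in measurable)
      also have "\<dots> = (LINT x|lebesgue. v x * \<phi> z x) - (LINT x|lebesgue. v x * (\<phi> z x - ?i x))"
        using sq_int_mult[OF vs(1) p] sq_int_mult[OF vs(1) i] by (simp add: right_diff_distrib)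
      finally have "(LINT x|lebesgue. ?J z x * v x)\<^sup>2 
          \<le> 2 * (LINT x|lebesgue. v x * \<phi> z x)\<^sup>2 + 2 * (LINT x|lebesgue. v x * (\<phi> z x - ?i x))\<^sup>2"
        by (simp add: square_diff_le)
      moreover have "(LINT x|lebesgue. v x * \<phi> z x)\<^sup>2 \<le> (A * X_norm s (\<phi> z))\<^sup>2"
        using power_mono[OF vA[OF \<phi>(1)[of z]], of 2] by simp
      moreover have "(LINT x|lebesgue. v x * (\<phi> z x - ?i x))\<^sup>2 \<le> \<eta> * I"
      proof -
        have "(LINT x|lebesgue. v x * (\<phi> z x - ?i x))\<^sup>2 
            \<le> (sqrt I * sqrt (LINT x|lebesgue. (\<phi> z x - ?i x)\<^sup>2))\<^sup>2"
          using power_mono[OF sq_int_cauchy_schwarz[OF vs(1) d], of 2] by (simp add: I_def)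
        also have "\<dots> = I * (LINT x|lebesgue. (\<phi> z x - ?i x)\<^sup>2)"
          using I0 by (simp add: power_mult_distrib)
        also have "\<dots> \<le> I * \<eta>" using \<phi>(2)[of z] I0 by (intro mult_left_mono)
        finally show ?thesis by (simp add: mult.commute)
      qed
      ultimately show ?thesis by (simp add: power_mult_distrib)
    qed
    let ?S = "\<Sum>z\<in>Z. (LINT x|lebesgue. ?J z x * v x)\<^sup>2"
    have "(\<Sum>z\<in>Z. LINT w|lebesgue. ?q z w) = (\<Sum>z\<in>Z. 2 * \<delta> ^ ?N * (LINT x|lebesgue. ?J z x * (v x)\<^sup>2) - 2 * (LINT x|lebesgue. ?J z x * v x)\<^sup>2)"
      using var by (intro sum.cong) (auto simp: has_bochner_integral_iff)
    also have "\<dots> = 2 * \<delta> ^ ?N * I - 2 * ?S"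
      by (simp add: sum_subtractf sumI sum_distrib_left)
    finally have "2 * \<delta> ^ ?N * I \<le> 2 * ?S + D powr ?P * (LINT w|lebesgue. (gagliardo \<sigma> v w)\<^sup>2)"
      using Gag by linarith
    also have "(LINT w|lebesgue. (gagliardo \<sigma> v w)\<^sup>2) = 2 * frac_op \<sigma> v v / ?c"
      using c by (simp add: frac_op_self)
    also have "D powr ?P * (2 * frac_op \<sigma> v v / ?c) = 2 * (D powr ?P / ?c * frac_op \<sigma> v v)" by simp
    finally have 1: "\<delta> ^ ?N * I \<le> ?S + D powr ?P / ?c * frac_op \<sigma> v v" by linarith
    have "?S \<le> (\<Sum>z\<in>Z. 2 * A\<^sup>2 * (X_norm s (\<phi> z))\<^sup>2 + 2 * \<eta> * I)" by (intro sum_mono cellavg)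
    also have "\<dots> = 2 * A\<^sup>2 * (\<Sum>z\<in>Z. (X_norm s (\<phi> z))\<^sup>2) + real (card Z) * (2 * \<eta> * I)"
      by (simp add: sum.distrib sum_distrib_left)
    also have "real (card Z) * (2 * \<eta> * I) \<le> \<delta> ^ ?N / 2 * I"
    proof -
      have "real (card Z) * 2 * \<eta> \<le> \<delta> ^ ?N / 2" using \<delta> by (simp add: \<eta>_def field_simps)
      from mult_right_mono[OF this I0] show ?thesis by (simp add: mult.assoc)
    qed
    finally have "\<delta> ^ ?N * I / 2 \<le> 2 * A\<^sup>2 * (\<Sum>z\<in>Z. (X_norm s (\<phi> z))\<^sup>2) + D powr ?P / ?c * frac_op \<sigma> v v"
      using 1 by linarith
    then have "I \<le> 2 / \<delta> ^ ?N * (2 * A\<^sup>2 * (\<Sum>z\<in>Z. (X_norm s (\<phi> z))\<^sup>2) + D powr ?P / ?c * frac_op \<sigma> v v)"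
      using \<delta> by (simp add: field_simps)
    also have "\<dots> = C * A\<^sup>2 + 2 * (D powr ?P / \<delta> ^ ?N / ?c) * frac_op \<sigma> v v"
      by (simp add: C_def algebra_simps)
    also have "\<dots> = \<epsilon> * frac_op \<sigma> v v + C * A\<^sup>2" unfolding DP by simp
    finally show "(LINT x|lebesgue. (v x)\<^sup>2) \<le> \<epsilon> * frac_op \<sigma> v v + C * A\<^sup>2" by (simp add: I_def)
  qed
qed

section \<open>Smooth step functions and the lemma of du Bois-Reymond\<close>

text \<open>For n = 0 this is the classical smooth function that is flat at 0. The powers of 1/t are
  carried along because they appear under differentiation, which does not leave the span of the
  family.\<close>

definition flat_fun :: "nat \<Rightarrow> real \<Rightarrow> real" where
  "flat_fun n t = (if t > 0 then (1 / t) ^ n * exp (- (1 / t)) else 0)"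

lemma flat_fun_bound: "((\<lambda>t. (1 / t) ^ n * exp (- (1 / t))) \<longlongrightarrow> (0::real)) (at_right 0)"
proof -
  have "((\<lambda>t. (inverse t) ^ n / exp (inverse t)) \<longlongrightarrow> (0::real)) (at_right 0)"
    by (rule filterlim_compose[OF tendsto_power_div_exp_0 filterlim_inverse_at_top_right])
  then show ?thesis by (simp add: exp_minus field_simps inverse_eq_divide)
qed

text \<open>Only t = 0 is delicate: there the right difference quotient of \<open>flat_fun n\<close>
  is \<open>flat_fun (Suc n)\<close>, which tends to 0 because the exponential beats every power of
  1/t.\<close>

lemma flat_fun_deriv:
  "(flat_fun n has_real_derivative flat_fun (Suc (Suc n)) t + - real n * flat_fun (Suc n) t) (at t)"
proof (cases t "0 :: real" rule: linorder_cases)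
  case less
  have "((\<lambda>_. 0) has_real_derivative 0) (at t)" by simp
  moreover have "\<forall>\<^sub>F x in nhds t. 0 = flat_fun n x"
  proof (rule eventually_nhds_in_open[THEN eventually_mono])
    show "open {..<(0::real)}" "t \<in> {..<0}" using less by auto
  qed (simp add: flat_fun_def)
  ultimately have "(flat_fun n has_real_derivative 0) (at t)"
    using DERIV_cong_ev[of t t "\<lambda>_. 0" "flat_fun n" 0 0] by simp
  then show ?thesis using less by (simp add: flat_fun_def)
next
  case greater
  have "((\<lambda>t. (1 / t) ^ n * exp (- (1 / t))) has_real_derivative flat_fun (Suc (Suc n)) t + - real n * flat_fun (Suc n) t) (at t)"
  proof -
    have "((\<lambda>t. (1 / t) ^ n * exp (- (1 / t))) has_real_derivative
       (real n * (1 / t) ^ (n - 1) * (- (1 / t ^ 2))) * exp (- (1 / t)) + (1 / t) ^ n * (exp (- (1 / t)) * (1 / t ^ 2))) (at t)"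
      using greater by (auto intro!: derivative_eq_intros simp: power2_eq_square)
    also have "(real n * (1 / t) ^ (n - 1) * (- (1 / t ^ 2))) * exp (- (1 / t)) + (1 / t) ^ n * (exp (- (1 / t)) * (1 / t ^ 2))
       = flat_fun (Suc (Suc n)) t + - real n * flat_fun (Suc n) t"
      using greater by (cases n) (simp_all add: flat_fun_def power2_eq_square field_simps)
    finally show ?thesis .
  qed
  moreover have "\<forall>\<^sub>F x in nhds t. (1 / x) ^ n * exp (- (1 / x)) = flat_fun n x"
  proof (rule eventually_nhds_in_open[THEN eventually_mono])
    show "open {(0::real)<..}" "t \<in> {0<..}" using greater by auto
  qed (simp add: flat_fun_def)
  ultimately show ?thesis
    using DERIV_cong_ev[of t t "\<lambda>x. (1 / x) ^ n * exp (- (1 / x))" "flat_fun n"] by simp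
next
  case equal
  have "((\<lambda>h. (flat_fun n (0 + h) - flat_fun n 0) / h) \<longlongrightarrow> 0) (at (0::real))"
    unfolding filterlim_at_split
  proof
    have "\<forall>\<^sub>F h in at_left (0::real). 0 = (flat_fun n (0 + h) - flat_fun n 0) / h"
      unfolding eventually_at_filter by (auto simp: flat_fun_def)
    then show "((\<lambda>h. (flat_fun n (0 + h) - flat_fun n 0) / h) \<longlongrightarrow> 0) (at_left (0::real))"
      by (rule Lim_transform_eventually[OF tendsto_const])
    have "\<forall>\<^sub>F h in at_right (0::real). (1 / h) ^ Suc n * exp (- (1 / h)) = (flat_fun n (0 + h) - flat_fun n 0) / h"
      unfolding eventually_at_filter by (auto simp: flat_fun_def)
    then show "((\<lambda>h. (flat_fun n (0 + h) - flat_fun n 0) / h) \<longlongrightarrow> 0) (at_right (0::real))"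
      by (rule Lim_transform_eventually[OF flat_fun_bound])
  qed
  then show ?thesis using equal by (simp add: DERIV_def flat_fun_def)
qed

text \<open>A class closed under differentiation, so that smoothness requires no formula for higher
  derivatives: every member has a derivative in the class, and induction on the order does the rest.
  The rule \<open>primitive\<close> admits the integral of a bump function.\<close>

inductive_set smooth_class :: "(real \<Rightarrow> real) set" where
  flat: "flat_fun n \<in> smooth_class"
| const: "(\<lambda>t. c) \<in> smooth_class"
| affine: "f \<in> smooth_class \<Longrightarrow> (\<lambda>t. f (a * t + b)) \<in> smooth_class"
| add: "f \<in> smooth_class \<Longrightarrow> g \<in> smooth_class \<Longrightarrow> (\<lambda>t. f t + g t) \<in> smooth_class"
| mult: "f \<in> smooth_class \<Longrightarrow> g \<in> smooth_class \<Longrightarrow> (\<lambda>t. f t * g t) \<in> smooth_class"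
| primitive: "f \<in> smooth_class \<Longrightarrow> (\<And>t. (F has_real_derivative f t) (at t)) \<Longrightarrow> F \<in> smooth_class"

lemma smooth_class_deriv:
  "f \<in> smooth_class \<Longrightarrow> \<exists>f'\<in>smooth_class. \<forall>t. (f has_real_derivative f' t) (at t)"
proof (induction rule: smooth_class.induct)
  case (flat n)
  show ?case
    by (rule bexI[of _ "\<lambda>t. flat_fun (Suc (Suc n)) t + (\<lambda>t. - real n) t * flat_fun (Suc n) t"])
       (use flat_fun_deriv in simp, intro smooth_class.intros)
next
  case (const c)
  show ?case by (rule bexI[of _ "\<lambda>t. 0"]) (auto intro: smooth_class.const)
next
  case (affine f a b)
  then obtain f' where f': "f' \<in> smooth_class" "\<And>t. (f has_real_derivative f' t) (at t)" by blast
  have "((\<lambda>t. f (a * t + b)) has_real_derivative (f' (a * t + b) * a)) (at t)" for t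
    by (rule DERIV_chain2[OF f'(2)]) (auto intro!: derivative_eq_intros)
  moreover have "(\<lambda>t. f' (a * t + b) * a) \<in> smooth_class"
    by (rule smooth_class.mult[OF smooth_class.affine[OF f'(1)] smooth_class.const])
  ultimately show ?case by (intro bexI[of _ "\<lambda>t. f' (a * t + b) * a"]) auto
next
  case (add f g)
  then obtain f' g' where f': "f' \<in> smooth_class" "\<And>t. (f has_real_derivative f' t) (at t)" 
    and g': "g' \<in> smooth_class" "\<And>t. (g has_real_derivative g' t) (at t)" by blast
  show ?case
    by (rule bexI[OF _ smooth_class.add[OF f'(1) g'(1)]]) (use DERIV_add[OF f'(2) g'(2)] in blast)
next
  case (mult f g)
  then obtain f' g' where f': "f' \<in> smooth_class" "\<And>t. (f has_real_derivative f' t) (at t)" 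
    and g': "g' \<in> smooth_class" "\<And>t. (g has_real_derivative g' t) (at t)" by blast
  show ?case
    by (rule bexI[OF _ smooth_class.add[OF smooth_class.mult[OF f'(1) mult.hyps(2)] smooth_class.mult[OF g'(1) mult.hyps(1)]]])
       (use DERIV_mult[OF f'(2) g'(2)] in blast)
next
  case (primitive f F)
  then show ?case by blast
qed

lemma smooth_class_continuous: 
  assumes "f \<in> smooth_class" shows "continuous_on S f"
proof -
  obtain f' where f': "\<And>t. (f has_real_derivative f' t) (at t)" using smooth_class_deriv[OF assms] by blast
  show ?thesis by (rule DERIV_continuous_on[OF has_field_derivative_at_within[OF f']])
qed

lemma smooth_class_smooth: "f \<in> smooth_class \<Longrightarrow> smooth_on f UNIV"
  unfolding smooth_on_def
proof
  fix k show "f \<in> smooth_class \<Longrightarrow> Ck_on k f UNIV"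
  proof (induction k arbitrary: f)
    case 0
    then show ?case using smooth_class_continuous by simp
  next
    case (Suc k)
    then obtain f' where f': "f' \<in> smooth_class" "\<And>t. (f has_real_derivative f' t) (at t)" using smooth_class_deriv by blast
    have fd: "frechet_derivative f (at t) = (*) (f' t)" for t
      using frechet_derivative_at[OF f'(2)[unfolded has_field_derivative_def, of t]] by simp
    have "f differentiable at t" for t
      using f'(2)[of t] unfolding has_field_derivative_def differentiable_def by blast
    then show ?case using Suc.IH[OF f'(1)] by (simp add: fd)
  qed
qed

text \<open>The step is the primitive of the bump \<open>\<rho>\<close>, which is positive exactly
  on (0, 1), divided by its total integral.\<close>

lemma smooth_step:
  obtains R r :: "real \<Rightarrow> real" where "R \<in> smooth_class" "\<And>t. (R has_real_derivative r t) (at t)"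
    "continuous_on UNIV r" "\<And>t. r t \<ge> 0" "\<And>t. r t \<noteq> 0 \<Longrightarrow> 0 < t \<and> t < 1"
    "\<And>t. t \<le> 0 \<Longrightarrow> R t = 0" "\<And>t. t \<ge> 1 \<Longrightarrow> R t = 1" "\<And>t. 0 \<le> R t \<and> R t \<le> 1"
proof -
  define \<rho> where "\<rho> = (\<lambda>t. flat_fun 0 t * flat_fun 0 ((-1) * t + 1))"
  have \<rho>S: "\<rho> \<in> smooth_class"
    unfolding \<rho>_def by (rule smooth_class.mult[OF smooth_class.flat smooth_class.affine[OF smooth_class.flat]])
  have \<rho>0: "\<rho> t \<ge> 0" for t by (simp add: \<rho>_def flat_fun_def)
  have \<rho>nz: "\<rho> t \<noteq> 0 \<longleftrightarrow> 0 < t \<and> t < 1" for t by (auto simp: \<rho>_def flat_fun_def)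
  have \<rho>z: "\<rho> t = 0" if "t \<le> 0 \<or> 1 \<le> t" for t using \<rho>nz[of t] that by linarith
  have \<rho>c: "continuous_on S \<rho>" for S by (rule smooth_class_continuous[OF \<rho>S])
  \<comment> \<open>The lower limit -1 instead of 0 makes every t \<ge> 0 an interior point of
    {-1..t+1}, so the derivative at 0 is two-sided.\<close>
  define G where "G = (\<lambda>t. integral {-1..t} \<rho>)"
  have G0: "G t = 0" if "t \<le> 0" for t
  proof -
    have "integral {-1..t} \<rho> = integral {-1..t} (\<lambda>_. 0)"
      using that by (intro Henstock_Kurzweil_Integration.integral_cong \<rho>z) auto
    then show ?thesis by (simp add: G_def)
  qed
  have int: "\<rho> integrable_on {a..b}" for a b by (rule integrable_continuous_real[OF \<rho>c])
  have comb: "G a + integral {a..b} \<rho> = G b" if "-1 \<le> a" "a \<le> b" for a b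
    unfolding G_def by (rule Henstock_Kurzweil_Integration.integral_combine[OF that int])
  have G1: "G t = G 1" if "t \<ge> 1" for t
  proof -
    have "integral {1..t} \<rho> = integral {1..t} (\<lambda>_. 0)"
      using that by (intro Henstock_Kurzweil_Integration.integral_cong \<rho>z) auto
    then show ?thesis using comb[of 1 t] that by simp
  qed
  have Gd: "(G has_real_derivative \<rho> t) (at t)" for t
  proof (cases "t < 0")
    case True
    have "((\<lambda>_. 0) has_real_derivative 0) (at t)" by simp
    moreover have "\<forall>\<^sub>F x in nhds t. 0 = G x"
    proof (rule eventually_nhds_in_open[THEN eventually_mono])
      show "open {..<(0::real)}" "t \<in> {..<0}" using True by auto
    qed (simp add: G0)
    ultimately have "(G has_real_derivative 0) (at t)"
      using DERIV_cong_ev[of t t "\<lambda>_. 0" G 0 0] by simp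
    moreover have "\<rho> t = 0" using \<rho>nz[of t] True by auto
    ultimately show ?thesis by simp
  next
    case False
    have "(G has_real_derivative \<rho> t) (at t within {-1..t+1})"
      unfolding G_def using False by (intro integral_has_real_derivative \<rho>c) auto
    moreover have "at t within {-1..t+1} = at t"
      using False by (intro at_within_interior) auto
    ultimately show ?thesis by simp
  qed
  have Gmono: "G a \<le> G b" if "a \<le> b" for a b
    using DERIV_nonneg_imp_nondecreasing[OF that, of G] Gd \<rho>0 by blast
  have "G 1 \<noteq> 0"
  proof
    assume "G 1 = 0"
    then have "\<forall>x\<in>{-1..1}. \<rho> x = 0"
      unfolding G_def by (subst (asm) integral_eq_0_iff) (auto simp: \<rho>c \<rho>0)
    then have "\<rho> (1/2) = 0" by simp
    then show False using \<rho>nz[of "1/2"] by simp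
  qed
  then have Gp: "G 1 > 0" using Gmono[of 0 1] G0[of 0] by simp
  define R where "R = (\<lambda>t. (\<lambda>_. 1 / G 1) t * G t)"
  show ?thesis
  proof (rule that[of R "\<lambda>t. \<rho> t / G 1"])
    show "R \<in> smooth_class" 
      unfolding R_def by (rule smooth_class.mult[OF smooth_class.const smooth_class.primitive[OF \<rho>S Gd]])
    show "(R has_real_derivative \<rho> t / G 1) (at t)" for t
      unfolding R_def using DERIV_cmult[OF Gd, of "1 / G 1" t] by simp
    show "continuous_on UNIV (\<lambda>t. \<rho> t / G 1)" using Gp by (intro continuous_intros \<rho>c) auto
    show "\<rho> t / G 1 \<ge> 0" for t using Gp \<rho>0 by simp
    show "0 < t \<and> t < 1" if "\<rho> t / G 1 \<noteq> 0" for t using that \<rho>nz by auto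
    show "R t = 0" if "t \<le> 0" for t using G0[OF that] by (simp add: R_def)
    show "R t = 1" if "t \<ge> 1" for t using G1[OF that] Gp by (simp add: R_def)
    show "0 \<le> R t \<and> R t \<le> 1" for t
    proof -
      have "G 0 \<le> G t" if "t \<ge> 0" using Gmono[OF that] .
      then have "0 \<le> G t" using G0 by (cases "t \<ge> 0") force+
      moreover have "G t \<le> G 1" using Gmono[of t 1] G1[of t] by (cases "t \<le> 1") auto
      ultimately show ?thesis using Gp by (simp add: R_def)
    qed
  qed
qed

text \<open>The test functions \<open>\<phi> n\<close> are smooth versions of the indicator of
  {t1<..t2}: a step up just after t1 and a step down just after t2, each of width 1/(n+1). Their
  derivatives are differences of approximate identities, so the left side of the weak identity tends
  to f t1 - f t2 by continuity of f, and the right side converges by dominated convergence.\<close>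

lemma du_bois_reymond:
  fixes f p :: "real \<Rightarrow> real"
  assumes f: "continuous_on {0<..} f"
    and p: "\<And>a b. 0 < a \<Longrightarrow> set_integrable lebesgue {a..b} p"
    and weak: "\<And>\<phi>. test_function {0<..} \<phi> \<Longrightarrow>
        (LINT t:{0<..}|lebesgue. deriv \<phi> t * f t) = - (LINT t:{0<..}|lebesgue. \<phi> t * p t)"
    and t: "0 < t1" "t1 \<le> t2"
  shows "f t2 - f t1 = (LINT t:{t1<..t2}|lebesgue. p t)"
proof -
  obtain R r :: "real \<Rightarrow> real" where RS: "R \<in> smooth_class" and Rd: "\<And>t. (R has_real_derivative r t) (at t)"
    and rc: "continuous_on UNIV r" and r0: "\<And>t. r t \<ge> 0" and rnz: "\<And>t. r t \<noteq> 0 \<Longrightarrow> 0 < t \<and> t < 1"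
    and R0: "\<And>t. t \<le> 0 \<Longrightarrow> R t = 0" and R1: "\<And>t. t \<ge> 1 \<Longrightarrow> R t = 1" and Rb: "\<And>t. 0 \<le> R t \<and> R t \<le> 1"
    using smooth_step by blast
  \<comment> \<open>Each step is completed within time 1, so \<open>?K\<close> contains the supports
    of all test functions.\<close>
  let ?K = "{t1..t2+1}"
  define k where "k = (\<lambda>(n::nat) a t. real (Suc n) * r (real (Suc n) * (t - a)))"
  \<comment> \<open>The sign is written as multiplication by a constant function, so that membership
    in \<open>smooth_class\<close> follows from its rules; \<open>\<phi>_eq\<close> is the readable
    form.\<close>
  define \<phi> where "\<phi> = (\<lambda>(n::nat) t. R (real (Suc n) * t + - (real (Suc n) * t1)) + (\<lambda>_. - 1) t * R (real (Suc n) * t + - (real (Suc n) * t2)))"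
  have \<phi>_eq: "\<phi> n t = R (real (Suc n) * (t - t1)) - R (real (Suc n) * (t - t2))" for n t
    by (simp add: \<phi>_def right_diff_distrib)
  have kd: "((\<lambda>t. R (real (Suc n) * (t - a))) has_real_derivative k n a t) (at t)" for n a t
  proof -
    have "((\<lambda>t. real (Suc n) * (t - a)) has_real_derivative real (Suc n)) (at t)"
      by (auto intro!: derivative_eq_intros)
    from DERIV_chain2[OF Rd this] show ?thesis unfolding k_def by (simp only: mult.commute)
  qed
  have \<phi>d: "(\<phi> n has_real_derivative k n t1 t - k n t2 t) (at t)" for n t
    unfolding \<phi>_eq[abs_def] by (rule DERIV_diff[OF kd kd])
  have kc: "continuous_on S (k n a)" for S n a
    unfolding k_def by (intro continuous_intros continuous_on_compose2[OF rc]) auto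
  have \<phi>supp: "\<phi> n t = 0" if "t \<notin> ?K" for n t
  proof (cases "t < t1")
    case True
    then have "real (Suc n) * (t - t1) \<le> 0" "real (Suc n) * (t - t2) \<le> 0" 
      using t by (auto intro!: mult_nonneg_nonpos)
    then show ?thesis unfolding \<phi>_eq using R0 by simp
  next
    case False
    then have "t > t2 + 1" using that by auto
    then have "1 * 1 \<le> real (Suc n) * (t - t1)" "1 * 1 \<le> real (Suc n) * (t - t2)"
      using t by (intro mult_mono; simp)+
    then show ?thesis unfolding \<phi>_eq using R1 by simp
  qed
  have test: "test_function {0<..} (\<phi> n)" for n
    unfolding test_function_def
  proof (intro conjI exI[of _ ?K])
    show "smooth_on (\<phi> n) UNIV"
      unfolding \<phi>_def
      by (rule smooth_class_smooth[OF smooth_class.add[OF smooth_class.affine[OF RS] smooth_class.mult[OF smooth_class.const smooth_class.affine[OF RS]]]])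
  qed (use t \<phi>supp in auto)
  have kz: "k n a s = 0" if "s \<notin> {a<..<a + 1 / real (Suc n)}" for n a s
  proof (rule ccontr)
    assume "k n a s \<noteq> 0"
    then have "0 < real (Suc n) * (s - a)" "real (Suc n) * (s - a) < 1" 
      using rnz[of "real (Suc n) * (s - a)"] by (auto simp: k_def)
    then have "a < s" "s < a + 1 / real (Suc n)" 
      by (auto simp: zero_less_mult_iff field_simps simp del: of_nat_Suc)
    with that show False by auto
  qed
  have k0: "k n a s \<ge> 0" for n a s by (simp add: k_def r0)
  have ki: "integral ?K (k n a) = 1" if "a \<in> {t1, t2}" for n a
  proof -
    have "(k n a has_integral R (real (Suc n) * (t2 + 1 - a)) - R (real (Suc n) * (t1 - a))) ?K"
      using kd t by (intro fundamental_theorem_of_calculus)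
        (auto simp flip: has_real_derivative_iff_has_vector_derivative intro: has_field_derivative_at_within)
    moreover have "1 * 1 \<le> real (Suc n) * (t2 + 1 - a)" 
      using that t by (intro mult_mono) auto
    moreover have "real (Suc n) * (t1 - a) \<le> 0" using that t by (auto intro!: mult_nonneg_nonpos)
    ultimately show ?thesis using R0 R1 by (simp add: integral_unique)
  qed
  have fc: "continuous_on ?K f" using f t by (auto intro: continuous_on_subset)
  have A: "(\<lambda>n. integral ?K (\<lambda>s. k n a s * f s)) \<longlonglongrightarrow> f a" if a: "a \<in> {t1, t2}" for a
    unfolding LIMSEQ_iff
  proof (intro allI impI)
    fix \<epsilon> :: real assume \<epsilon>: "\<epsilon> > 0"
    have "a \<in> ?K" using a t by auto
    then obtain d where d: "d > 0" "\<And>s. s \<in> ?K \<Longrightarrow> dist s a < d \<Longrightarrow> dist (f s) (f a) < \<epsilon>/2"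
      using fc \<epsilon> unfolding continuous_on_iff by (metis half_gt_zero)
    obtain N :: nat where N: "1 / real (Suc N) < d" using d(1) nat_approx_posE by blast
    have "\<bar>integral ?K (\<lambda>s. k n a s * f s) - f a\<bar> < \<epsilon>" if n: "n \<ge> N" for n
    proof -
      have nd: "1 / real (Suc n) < d"
        using N n frac_le[of 1 1 "real (Suc N)" "real (Suc n)"] by linarith
      have i1: "(\<lambda>s. k n a s * f s) integrable_on ?K"
        by (intro integrable_continuous_real continuous_intros kc fc)
      have i2: "(\<lambda>s. k n a s * f a) integrable_on ?K"
        by (intro integrable_continuous_real continuous_intros kc)
      have "integral ?K (\<lambda>s. k n a s * f s) - f a = integral ?K (\<lambda>s. k n a s * f s) - integral ?K (\<lambda>s. k n a s * f a)"
        using ki[OF a, of n] by simp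
      also have "\<dots> = integral ?K (\<lambda>s. k n a s * f s - k n a s * f a)"
        by (rule Henstock_Kurzweil_Integration.integral_diff[OF i1 i2, symmetric])
      also have "\<bar>\<dots>\<bar> \<le> integral ?K (\<lambda>s. k n a s * (\<epsilon>/2))"
        unfolding real_norm_def[symmetric]
      proof (rule integral_norm_bound_integral)
        show "(\<lambda>s. k n a s * f s - k n a s * f a) integrable_on ?K" by (rule integrable_diff[OF i1 i2])
        show "(\<lambda>s. k n a s * (\<epsilon>/2)) integrable_on ?K" by (intro integrable_continuous_real continuous_intros kc) simp
        fix s assume s: "s \<in> ?K"
        show "norm (k n a s * f s - k n a s * f a) \<le> k n a s * (\<epsilon>/2)"
        proof (cases "s \<in> {a<..<a + 1 / real (Suc n)}")
          case True
          then have "dist s a < d" using nd by (auto simp: dist_real_def)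
          then have "\<bar>f s - f a\<bar> \<le> \<epsilon>/2" using d(2)[OF s] by (simp add: dist_real_def)
          then have "k n a s * \<bar>f s - f a\<bar> \<le> k n a s * (\<epsilon>/2)" by (rule mult_left_mono[OF _ k0])
          then show ?thesis using k0[of n a s] by (simp add: abs_mult flip: right_diff_distrib)
        qed (simp add: kz)
      qed
      also have "\<dots> = \<epsilon>/2" using ki[OF a, of n] by simp
      finally show ?thesis using \<epsilon> by linarith
    qed
    then show "\<exists>no. \<forall>n\<ge>no. norm (integral ?K (\<lambda>s. k n a s * f s) - f a) < \<epsilon>" by auto
  qed
  have L: "(LINT t:{0<..}|lebesgue. deriv (\<phi> n) t * f t) = integral ?K (\<lambda>s. k n t1 s * f s) - integral ?K (\<lambda>s. k n t2 s * f s)" for n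
  proof -
    have dphi: "deriv (\<phi> n) s = k n t1 s - k n t2 s" for s by (rule DERIV_imp_deriv[OF \<phi>d])
    have kK: "k n t1 s - k n t2 s = 0" if "s \<notin> ?K" for s
    proof -
      have "1 / real (Suc n) \<le> 1" by simp
      then have "s \<notin> {t1<..<t1 + 1 / real (Suc n)}" "s \<notin> {t2<..<t2 + 1 / real (Suc n)}"
        using that t unfolding greaterThanLessThan_iff atLeastAtMost_iff by linarith+
      then show ?thesis by (simp add: kz)
    qed
    have "(LINT t:{0<..}|lebesgue. deriv (\<phi> n) t * f t) = (LINT t:?K|lebesgue. (k n t1 t - k n t2 t) * f t)"
      unfolding set_lebesgue_integral_def dphi
      using kK t by (intro Bochner_Integration.integral_cong) (auto simp: indicator_def)
    also have "\<dots> = integral ?K (\<lambda>s. (k n t1 s - k n t2 s) * f s)"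
      by (intro set_lebesgue_integral_eq_integral(2) absolutely_integrable_continuous_real continuous_intros kc fc)
    also have "\<dots> = integral ?K (\<lambda>s. k n t1 s * f s - k n t2 s * f s)" by (simp add: left_diff_distrib)
    also have "\<dots> = integral ?K (\<lambda>s. k n t1 s * f s) - integral ?K (\<lambda>s. k n t2 s * f s)"
      by (intro Henstock_Kurzweil_Integration.integral_diff integrable_continuous_real continuous_intros kc fc)
    finally show ?thesis .
  qed
  have "(\<lambda>n. LINT t:{0<..}|lebesgue. deriv (\<phi> n) t * f t) \<longlonglongrightarrow> f t1 - f t2"
    unfolding L by (intro tendsto_diff A) auto
  moreover have "(\<lambda>n. LINT t:{0<..}|lebesgue. \<phi> n t * p t) \<longlonglongrightarrow> (LINT t:{t1<..t2}|lebesgue. p t)"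
    unfolding set_lebesgue_integral_def
  proof (rule integral_dominated_convergence)
    have pK: "integrable lebesgue (\<lambda>t. indicator ?K t *\<^sub>R p t)" using p[OF t(1)] by (simp add: set_integrable_def)
    then show "integrable lebesgue (\<lambda>t. norm (indicator ?K t *\<^sub>R p t))" by (rule integrable_norm)
    have pm: "(\<lambda>t. indicator ?K t *\<^sub>R p t) \<in> borel_measurable lebesgue" using pK by (rule borel_measurable_integrable)
    have "continuous_on UNIV (\<phi> n)" for n
      by (rule DERIV_continuous_on[OF has_field_derivative_at_within[OF \<phi>d]])
    then have \<phi>m: "\<phi> n \<in> borel_measurable lebesgue" for n
      by (simp add: measurable_completion borel_measurable_continuous_onI)
    have e: "indicator {0<..} t *\<^sub>R (\<phi> n t * p t) = \<phi> n t * (indicator ?K t *\<^sub>R p t)" for n t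
      using \<phi>supp[of t n] t by (auto simp: indicator_def)
    show "(\<lambda>t. indicator {0<..} t *\<^sub>R (\<phi> n t * p t)) \<in> borel_measurable lebesgue" for n
      unfolding e by (rule borel_measurable_times[OF \<phi>m pm])
    have e2: "indicator {t1<..t2} t *\<^sub>R p t = indicator {t1<..t2} t * (indicator ?K t *\<^sub>R p t)" for t
      by (auto simp: indicator_def)
    show "(\<lambda>t. indicator {t1<..t2} t *\<^sub>R p t) \<in> borel_measurable lebesgue"
      unfolding e2 by (rule borel_measurable_times[OF borel_measurable_indicator pm]) simp
    show "AE t in lebesgue. (\<lambda>n. indicator {0<..} t *\<^sub>R (\<phi> n t * p t)) \<longlonglongrightarrow> indicator {t1<..t2} t *\<^sub>R p t"
    proof (rule AE_I2)
      fix s :: real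
      have Rl: "(\<lambda>n. R (real (Suc n) * (s - a))) \<longlonglongrightarrow> (if a < s then 1 else 0)" for a
      proof (cases "a < s")
        case True
        obtain N :: nat where N: "1 / real (Suc N) < s - a" using True nat_approx_posE[of "s - a"] by auto
        have "\<forall>\<^sub>F n in sequentially. 1 = R (real (Suc n) * (s - a))"
          using eventually_ge_at_top[of N]
        proof eventually_elim
          case (elim n)
          have "1 \<le> real (Suc N) * (s - a)" using N by (simp add: field_simps)
          also have "\<dots> \<le> real (Suc n) * (s - a)" using elim True by (intro mult_right_mono) auto
          finally show ?case using R1 by simp
        qed
        then show ?thesis using True by (simp add: Lim_transform_eventually[OF tendsto_const])
      next
        case False
        then have "real (Suc n) * (s - a) \<le> 0" for n by (intro mult_nonneg_nonpos) auto
        then show ?thesis using False R0 by simp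
      qed
      have "(\<lambda>n. \<phi> n s) \<longlonglongrightarrow> (if t1 < s then 1 else 0) - (if t2 < s then 1 else 0)"
        unfolding \<phi>_eq by (intro tendsto_diff Rl)
      also have "(if t1 < s then 1 else 0) - (if t2 < s then 1 else 0) = (indicator {t1<..t2} s :: real)"
        using t by (auto simp: indicator_def)
      finally show "(\<lambda>n. indicator {0<..} s *\<^sub>R (\<phi> n s * p s)) \<longlonglongrightarrow> indicator {t1<..t2} s *\<^sub>R p s"
        unfolding e e2 by (intro tendsto_intros)
    qed
    show "AE t in lebesgue. norm (indicator {0<..} t *\<^sub>R (\<phi> n t * p t)) \<le> norm (indicator ?K t *\<^sub>R p t)" for n
    proof (rule AE_I2)
      fix s
      have "\<bar>\<phi> n s\<bar> \<le> 1" unfolding \<phi>_eq using Rb[of "real (Suc n) * (s - t1)"] Rb[of "real (Suc n) * (s - t2)"] by linarith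
      then show "norm (indicator {0<..} s *\<^sub>R (\<phi> n s * p s)) \<le> norm (indicator ?K s *\<^sub>R p s)"
        unfolding e by (simp add: abs_mult mult_left_le_one_le)
    qed
  qed
  ultimately have "f t1 - f t2 = - (LINT t:{t1<..t2}|lebesgue. p t)"
    unfolding weak[OF test] using LIMSEQ_unique tendsto_minus by blast
  then show ?thesis by simp
qed

section \<open>Window averages of square-integrable sequences\<close>

text \<open>The double integral of p(t) p(\<tau>) splits along the diagonal, a null set, into two
  parts that agree by symmetry. With P the primitive of p this says that the integral of p P is half
  the square of the total integral, for merely integrable p.\<close>

lemma integral_half_square:
  fixes p :: "real \<Rightarrow> real"
  assumes p: "integrable lborel p"
  shows "integrable lborel (\<lambda>t. p t * (\<integral>\<tau>. indicator {..t} \<tau> * p \<tau> \<partial>lborel))"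
    and "(\<integral>t. p t * (\<integral>\<tau>. indicator {..t} \<tau> * p \<tau> \<partial>lborel) \<partial>lborel) = (\<integral>t. p t \<partial>lborel)\<^sup>2 / 2"
proof -
  have [measurable]: "p \<in> borel_measurable borel" using borel_measurable_integrable[OF p] by simp
  let ?M = "lborel \<Otimes>\<^sub>M (lborel :: real measure) :: (real \<times> real) measure"
  let ?q = "\<lambda>z. p (fst z) * p (snd z)"
  have iq: "integrable ?M ?q"
  proof (rule lborel_pair.Fubini_integrable)
    show "integrable lborel (\<lambda>x. LINT y|lborel. norm (?q (x, y)))"
      using p by (simp add: abs_mult)
    show "AE x in lborel. integrable lborel (\<lambda>y. ?q (x, y))" using p by simp
  qed simp
  have Iq: "integral\<^sup>L ?M ?q = (\<integral>t. p t \<partial>lborel)\<^sup>2"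
    using lborel_pair.integral_fst'[OF iq] by (simp add: power2_eq_square)
  let ?A = "{z::real\<times>real. snd z \<le> fst z}" and ?B = "{z::real\<times>real. fst z < snd z}"
  have AB: "?A \<in> sets ?M" "?B \<in> sets ?M"
    unfolding lborel_prod sets_lborel
    by (intro borel_closed closed_Collect_le continuous_intros, intro borel_open open_Collect_less continuous_intros)
  let ?qA = "\<lambda>z. indicator ?A z *\<^sub>R ?q z" and ?qB = "\<lambda>z. indicator ?B z *\<^sub>R ?q z"
  have iA: "integrable ?M ?qA" and iB: "integrable ?M ?qB"
    by (rule integrable_mult_indicator[OF AB(1) iq], rule integrable_mult_indicator[OF AB(2) iq])
  have inner: "(\<integral>y. ?qA (x, y) \<partial>lborel) = p x * (\<integral>\<tau>. indicator {..x} \<tau> * p \<tau> \<partial>lborel)" for x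
  proof -
    have "(\<integral>y. ?qA (x, y) \<partial>lborel) = (\<integral>y. p x * (indicator {..x} y * p y) \<partial>lborel)"
      by (intro Bochner_Integration.integral_cong) (auto simp: indicator_def)
    then show ?thesis by simp
  qed
  show "integrable lborel (\<lambda>t. p t * (\<integral>\<tau>. indicator {..t} \<tau> * p \<tau> \<partial>lborel))"
    using lborel_pair.integrable_fst'[OF iA] unfolding inner .
  have IA: "integral\<^sup>L ?M ?qA = (\<integral>t. p t * (\<integral>\<tau>. indicator {..t} \<tau> * p \<tau> \<partial>lborel) \<partial>lborel)"
    using lborel_pair.integral_fst'[OF iA] unfolding inner by simp
  have "integral\<^sup>L ?M ?qB = (\<integral>x. \<integral>y. ?qB (x, y) \<partial>lborel \<partial>lborel)"
    using lborel_pair.integral_fst'[OF iB] by simp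
  also have "\<dots> = (\<integral>y. \<integral>x. ?qB (x, y) \<partial>lborel \<partial>lborel)"
    using lborel_pair.Fubini_integral[of "\<lambda>x y. ?qB (x, y)"] iB by (simp add: case_prod_unfold)
  also have "\<dots> = (\<integral>y. p y * (\<integral>\<tau>. indicator {..y} \<tau> * p \<tau> \<partial>lborel) \<partial>lborel)"
  proof (intro Bochner_Integration.integral_cong refl)
    fix y
    have e: "?qB (x, y) = indicator {..<y} x * (p x * p y)" for x by (auto simp: indicator_def)
    have "(\<integral>x. ?qB (x, y) \<partial>lborel) = (\<integral>x. p y * (indicator {..y} x * p x) \<partial>lborel)"
      unfolding e
    proof (rule integral_cong_AE)
      have "AE x in lborel. x \<noteq> y" by (rule AE_lborel_singleton)
      then show "AE x in lborel. indicator {..<y} x * (p x * p y) = p y * (indicator {..y} x * p x)"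
        by eventually_elim (auto simp: indicator_def)
    qed measurable
    then show "(\<integral>x. ?qB (x, y) \<partial>lborel) = p y * (\<integral>\<tau>. indicator {..y} \<tau> * p \<tau> \<partial>lborel)" by simp
  qed
  finally have "integral\<^sup>L ?M ?qB = integral\<^sup>L ?M ?qA" unfolding IA .
  moreover have "integral\<^sup>L ?M ?q = integral\<^sup>L ?M ?qA + integral\<^sup>L ?M ?qB"
  proof -
    have "?q = (\<lambda>z. ?qA z + ?qB z)" by (auto simp: indicator_def fun_eq_iff)
    then show ?thesis using Bochner_Integration.integral_add[OF iA iB] by simp
  qed
  ultimately show "(\<integral>t. p t * (\<integral>\<tau>. indicator {..t} \<tau> * p \<tau> \<partial>lborel) \<partial>lborel) = (\<integral>t. p t \<partial>lborel)\<^sup>2 / 2"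
    using Iq IA by simp
qed

text \<open>The window integral C is absolutely continuous with derivative p(t) = c(t + h) - c(t).
  On [t1, t2] it is C t1 plus a primitive of p, and \<open>integral_half_square\<close> evaluates
  the integral of C p as the increment of C^2 / 2.\<close>

lemma window_square_increment:
  fixes c :: "real \<Rightarrow> real"
  assumes ci: "\<And>a b. set_integrable lborel {a..b} c" and h: "h > 0" and t: "t1 \<le> t2"
  shows "set_integrable lborel {t1..t2} (\<lambda>t. integral {t..t+h} c * (c (t + h) - c t))"
    and "(integral {t2..t2+h} c)\<^sup>2 - (integral {t1..t1+h} c)\<^sup>2 =
       2 * (LBINT t:{t1..t2}. integral {t..t+h} c * (c (t + h) - c t))"
proof -
  have cI: "c integrable_on {a..b}" for a b using set_borel_integral_eq_integral(1)[OF ci] .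
  have shift: "set_integrable lborel {a..b} (\<lambda>t. c (t + h))" for a b
  proof -
    have "integrable lborel (\<lambda>t. indicator {a+h..b+h} t *\<^sub>R c t)" using ci by (simp add: set_integrable_def)
    then have "integrable lborel (\<lambda>t. indicator {a+h..b+h} (h + 1 * t) *\<^sub>R c (h + 1 * t))"
      by (rule lborel_integrable_real_affine) simp
    moreover have "(\<lambda>t. indicator {a+h..b+h} (h + 1 * t) *\<^sub>R c (h + 1 * t)) = (\<lambda>t. indicator {a..b} t *\<^sub>R c (t + h))"
      by (auto simp: indicator_def fun_eq_iff add.commute)
    ultimately show ?thesis by (simp add: set_integrable_def)
  qed
  define p where "p = (\<lambda>t. c (t + h) - c t)"
  have pi: "set_integrable lborel {a..b} p" for a b unfolding p_def by (rule set_integral_diff(1)[OF shift ci])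
  define q where "q = (\<lambda>t. indicator {t1..t2} t * p t)"
  have qi: "integrable lborel q" using pi[of t1 t2] by (simp add: q_def set_integrable_def)
  define C where "C = (\<lambda>t. integral {t..t+h} c)"
  have Ct: "C t = C t1 + (\<integral>\<tau>. indicator {..t} \<tau> * q \<tau> \<partial>lborel)" if t: "t \<in> {t1..t2}" for t
  proof -
    have "(\<integral>\<tau>. indicator {..t} \<tau> * q \<tau> \<partial>lborel) = (LBINT \<tau>:{t1..t}. p \<tau>)"
      unfolding set_lebesgue_integral_def q_def using t
      by (intro Bochner_Integration.integral_cong) (auto simp: indicator_def)
    also have "\<dots> = integral {t1..t} p" by (rule set_borel_integral_eq_integral(2)[OF pi])
    also have "\<dots> = integral {t1..t} (\<lambda>\<tau>. c (\<tau> + h)) - integral {t1..t} c"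
      unfolding p_def using set_borel_integral_eq_integral(1)[OF shift] cI
      by (intro Henstock_Kurzweil_Integration.integral_diff)
    also have "integral {t1..t} (\<lambda>\<tau>. c (\<tau> + h)) = integral {t1+h..t+h} c"
      using integral_shift_Icc_real[of t1 t c h] by (simp add: o_def add.commute)
    finally have "(\<integral>\<tau>. indicator {..t} \<tau> * q \<tau> \<partial>lborel) = integral {t1+h..t+h} c - integral {t1..t} c" .
    moreover have "integral {t1..t1+h} c + integral {t1+h..t+h} c = integral {t1..t+h} c"
      using t h cI by (intro Henstock_Kurzweil_Integration.integral_combine) auto
    moreover have "integral {t1..t} c + integral {t..t+h} c = integral {t1..t+h} c"
      using t h cI by (intro Henstock_Kurzweil_Integration.integral_combine) auto
    ultimately show ?thesis by (simp add: C_def)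
  qed
  let ?S = "\<integral>t. q t \<partial>lborel"
  have S: "C t2 = C t1 + ?S"
  proof -
    have "(\<integral>\<tau>. indicator {..t2} \<tau> * q \<tau> \<partial>lborel) = ?S"
      by (intro Bochner_Integration.integral_cong) (auto simp: q_def indicator_def)
    then show ?thesis using Ct[of t2] t by simp
  qed
  have e: "indicator {t1..t2} t *\<^sub>R (C t * p t) = C t1 * q t + q t * (\<integral>\<tau>. indicator {..t} \<tau> * q \<tau> \<partial>lborel)" for t
    using Ct[of t] by (cases "t \<in> {t1..t2}") (simp_all add: q_def algebra_simps)
  have "integrable lborel (\<lambda>t. indicator {t1..t2} t *\<^sub>R (C t * p t))"
    unfolding e using qi integral_half_square(1)[OF qi] by simp
  then show "set_integrable lborel {t1..t2} (\<lambda>t. integral {t..t+h} c * (c (t + h) - c t))"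
    by (simp add: set_integrable_def C_def p_def)
  have "(LBINT t:{t1..t2}. C t * p t) = C t1 * ?S + ?S\<^sup>2 / 2"
    unfolding set_lebesgue_integral_def e using qi integral_half_square[OF qi] by simp
  then have "(C t2)\<^sup>2 - (C t1)\<^sup>2 = 2 * (LBINT t:{t1..t2}. C t * p t)"
    unfolding S by (simp add: power2_sum)
  then show "(integral {t2..t2+h} c)\<^sup>2 - (integral {t1..t1+h} c)\<^sup>2 =
       2 * (LBINT t:{t1..t2}. integral {t..t+h} c * (c (t + h) - c t))"
    by (simp add: C_def p_def)
qed

text \<open>\<open>c\<close> lists the coordinates of a square-integrable curve in a Hilbert space and \<open>N\<close> is its squared
  norm; \<open>F h t\<close> is then the squared norm of the integral of the curve over \<open>[t, t + h]\<close>.\<close>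

locale sq_curve =
  fixes c :: "nat \<Rightarrow> real \<Rightarrow> real" and N :: "real \<Rightarrow> real"
  assumes c_borel: "\<And>k. c k \<in> borel_measurable borel"
    and c_sums: "\<And>t. (\<lambda>k. (c k t)\<^sup>2) sums N t"
    and N_int: "integrable lborel N"
begin

definition C :: "real \<Rightarrow> nat \<Rightarrow> real \<Rightarrow> real" where "C h k t = integral {t..t+h} (c k)"
definition F :: "real \<Rightarrow> real \<Rightarrow> real" where "F h t = (\<Sum>k. (C h k t)\<^sup>2)"

lemma N_nonneg: "0 \<le> N t"
  using sums_le[OF _ sums_zero c_sums[of t]] by simp

lemma partial_le_N: "(\<Sum>k<n. (c k t)\<^sup>2) \<le> N t"
  using sum_le_suminf[OF sums_summable[OF c_sums[of t]], of "{..<n}"] c_sums[of t] by (simp add: sums_iff)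

lemma c_sq_le_N: "(c k t)\<^sup>2 \<le> N t"
  using partial_le_N[where n = "Suc k" and t = t] sum_nonneg[of "{..<k}" "\<lambda>j. (c j t)\<^sup>2"] by simp

lemma c_sq_int: "sq_int lborel (c k)"
proof -
  have "integrable lborel (\<lambda>t. (c k t)\<^sup>2)"
    using c_borel[of k] c_sq_le_N N_nonneg by (intro Bochner_Integration.integrable_bound[OF N_int]) auto
  then show ?thesis using c_borel[of k] by (simp add: sq_int_def)
qed

lemma sq_int_indicator_Icc: "sq_int lborel (indicator {a..b::real} :: real \<Rightarrow> real)"
proof -
  have "(\<lambda>x. (indicator {a..b} x :: real)\<^sup>2) = indicator {a..b}" by (auto simp: indicator_def)
  moreover have "integrable lborel (indicator {a..b} :: real \<Rightarrow> real)"
    by (rule integrable_real_indicator) (auto simp: emeasure_lborel_Icc_eq)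
  ultimately show ?thesis by (simp add: sq_int_def)
qed

lemma c_set_integrable: "set_integrable lborel {a..b} (c k)"
  using sq_int_mult[OF sq_int_indicator_Icc c_sq_int] by (simp add: set_integrable_def)

lemma C_lborel: "C h k t = (\<integral>\<tau>. indicator {t..t+h} \<tau> * c k \<tau> \<partial>lborel)"
  unfolding C_def set_borel_integral_eq_integral(2)[OF c_set_integrable, symmetric] set_lebesgue_integral_def by simp

lemma C_borel[measurable]: "C h k \<in> borel_measurable borel"
proof -
  note [measurable] = c_borel[of k]
  have "(\<lambda>t. \<integral>\<tau>. (if t \<le> \<tau> \<and> \<tau> \<le> t + h then 1 else 0) * c k \<tau> \<partial>lborel) \<in> borel_measurable borel"
    by measurable
  moreover have "(\<lambda>t. \<integral>\<tau>. (if t \<le> \<tau> \<and> \<tau> \<le> t + h then 1 else 0) * c k \<tau> \<partial>lborel) = C h k"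
    unfolding C_lborel[abs_def] by (intro ext Bochner_Integration.integral_cong) (auto simp: indicator_def)
  ultimately show ?thesis by simp
qed

lemma N_window_integrable: "integrable lborel (\<lambda>\<tau>. indicator {a..b} \<tau> * N \<tau>)"
  using integrable_mult_indicator[OF _ N_int, of "{a..b}"] by simp

text \<open>Cauchy-Schwarz on a window of length h, coordinate by coordinate. The bound does not
  depend on n, so the series defining \<open>F h t\<close> converges.\<close>

lemma C_partial_le:
  assumes h: "h > 0"
  shows "(\<Sum>k<n. (C h k t)\<^sup>2) \<le> h * (\<integral>\<tau>. indicator {t..t+h} \<tau> * N \<tau> \<partial>lborel)"
proof -
  let ?i = "indicator {t..t+h} :: real \<Rightarrow> real"
  have ic: "integrable lborel (\<lambda>\<tau>. ?i \<tau> * (c k \<tau>)\<^sup>2)" for k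
    using integrable_mult_indicator[of "{t..t+h}" lborel "\<lambda>\<tau>. (c k \<tau>)\<^sup>2"] c_sq_int[of k] by (simp add: sq_int_def)
  have "(C h k t)\<^sup>2 \<le> h * (\<integral>\<tau>. ?i \<tau> * (c k \<tau>)\<^sup>2 \<partial>lborel)" for k
  proof -
    have i2: "(\<lambda>\<tau>. (?i \<tau> * c k \<tau>)\<^sup>2) = (\<lambda>\<tau>. ?i \<tau> * (c k \<tau>)\<^sup>2)" by (auto simp: indicator_def)
    have s: "sq_int lborel (\<lambda>\<tau>. ?i \<tau> * c k \<tau>)"
      unfolding sq_int_def i2 using ic[of k] c_borel[of k] by auto
    have "\<bar>\<integral>\<tau>. ?i \<tau> * c k \<tau> * ?i \<tau> \<partial>lborel\<bar> \<le> sqrt (\<integral>\<tau>. (?i \<tau> * c k \<tau>)\<^sup>2 \<partial>lborel) * sqrt (\<integral>\<tau>. (?i \<tau>)\<^sup>2 \<partial>lborel)"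
      by (rule sq_int_cauchy_schwarz[OF s sq_int_indicator_Icc])
    moreover have "(\<lambda>\<tau>. ?i \<tau> * c k \<tau> * ?i \<tau>) = (\<lambda>\<tau>. ?i \<tau> * c k \<tau>)" by (auto simp: indicator_def)
    moreover have "(\<lambda>\<tau>. (?i \<tau>)\<^sup>2) = ?i" by (auto simp: indicator_def)
    ultimately have "\<bar>C h k t\<bar> \<le> sqrt (\<integral>\<tau>. ?i \<tau> * (c k \<tau>)\<^sup>2 \<partial>lborel) * sqrt h"
      using h by (simp add: C_lborel i2)
    from power_mono[OF this, of 2] show ?thesis
      using h ic by (simp add: power_mult_distrib mult.commute)
  qed
  then have "(\<Sum>k<n. (C h k t)\<^sup>2) \<le> (\<Sum>k<n. h * (\<integral>\<tau>. ?i \<tau> * (c k \<tau>)\<^sup>2 \<partial>lborel))"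
    by (intro sum_mono)
  also have "\<dots> = h * (\<integral>\<tau>. ?i \<tau> * (\<Sum>k<n. (c k \<tau>)\<^sup>2) \<partial>lborel)"
  proof -
    have "(\<integral>\<tau>. ?i \<tau> * (\<Sum>k<n. (c k \<tau>)\<^sup>2) \<partial>lborel) = (\<Sum>k<n. \<integral>\<tau>. ?i \<tau> * (c k \<tau>)\<^sup>2 \<partial>lborel)"
      unfolding sum_distrib_left by (rule Bochner_Integration.integral_sum) (rule ic)
    then show ?thesis by (simp add: sum_distrib_left)
  qed
  also have "\<dots> \<le> h * (\<integral>\<tau>. ?i \<tau> * N \<tau> \<partial>lborel)"
  proof (rule mult_left_mono[OF integral_mono[OF _ N_window_integrable]])
    show "integrable lborel (\<lambda>\<tau>. ?i \<tau> * (\<Sum>k<n. (c k \<tau>)\<^sup>2))"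
      unfolding sum_distrib_left by (rule Bochner_Integration.integrable_sum) (rule ic)
    show "?i \<tau> * (\<Sum>k<n. (c k \<tau>)\<^sup>2) \<le> ?i \<tau> * N \<tau>" for \<tau> using partial_le_N by (intro mult_left_mono) auto
  qed (use h in auto)
  finally show ?thesis .
qed

lemma C_sums: 
  assumes h: "h > 0" shows "(\<lambda>k. (C h k t)\<^sup>2) sums F h t"
  unfolding F_def
proof (intro summable_sums bounded_imp_summable)
  show "(\<Sum>k\<le>n. (C h k t)\<^sup>2) \<le> h * (\<integral>\<tau>. indicator {t..t+h} \<tau> * N \<tau> \<partial>lborel)" for n
    using C_partial_le[OF h, where t = t and n = "Suc n"] by (simp only: lessThan_Suc_atMost)
qed simp

lemma F_nonneg: "h > 0 \<Longrightarrow> 0 \<le> F h t"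
  using sums_le[OF _ sums_zero C_sums[of h t]] by simp

lemma F_partial: "h > 0 \<Longrightarrow> (\<Sum>k<n. (C h k t)\<^sup>2) \<le> F h t"
  using sum_le_suminf[OF sums_summable[OF C_sums[of h t]], of "{..<n}"] by (simp add: F_def)

lemma F_le: "h > 0 \<Longrightarrow> F h t \<le> h * (\<integral>\<tau>. indicator {t..t+h} \<tau> * N \<tau> \<partial>lborel)"
  using C_sums[of h t] C_partial_le unfolding sums_def by (intro LIMSEQ_le_const2[of "\<lambda>n. \<Sum>k<n. (C h k t)\<^sup>2"]) auto

lemma F_borel[measurable]: "F h \<in> borel_measurable borel"
  unfolding F_def[abs_def] by measurable

text \<open>By Tonelli: a given \<tau> lies in the windows that start in [\<tau> - h, \<tau>], an
  interval of length h, and \<open>F_le\<close> contributes another factor h. The scaling h^2 is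
  what makes the later bounds on difference quotients uniform in h.\<close>

lemma F_integral:
  assumes h: "h > 0"
  shows "integrable lborel (F h)" "(\<integral>t. F h t \<partial>lborel) \<le> h\<^sup>2 * (\<integral>t. N t \<partial>lborel)"
proof -
  have [measurable]: "N \<in> borel_measurable borel" using N_int by auto
  have "(\<integral>\<^sup>+t. ennreal (F h t) \<partial>lborel) \<le> (\<integral>\<^sup>+t. ennreal h * (\<integral>\<^sup>+\<tau>. indicator {t..t+h} \<tau> * ennreal (N \<tau>) \<partial>lborel) \<partial>lborel)"
  proof (rule nn_integral_mono)
    fix t :: real
    have "(\<integral>\<^sup>+\<tau>. indicator {t..t+h} \<tau> * ennreal (N \<tau>) \<partial>lborel) = (\<integral>\<^sup>+\<tau>. ennreal (indicator {t..t+h} \<tau> * N \<tau>) \<partial>lborel)"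
      by (intro nn_integral_cong) (auto simp: indicator_def)
    also have "\<dots> = ennreal (\<integral>\<tau>. indicator {t..t+h} \<tau> * N \<tau> \<partial>lborel)"
      using N_nonneg by (intro nn_integral_eq_integral N_window_integrable) auto
    finally show "ennreal (F h t) \<le> ennreal h * (\<integral>\<^sup>+\<tau>. indicator {t..t+h} \<tau> * ennreal (N \<tau>) \<partial>lborel)"
      using F_le[OF h, of t] h N_nonneg by (simp add: ennreal_mult[symmetric] ennreal_leI)
  qed
  also have "\<dots> = ennreal h * (\<integral>\<^sup>+t. (\<integral>\<^sup>+\<tau>. (if t \<le> \<tau> \<and> \<tau> \<le> t + h then 1 else 0) * ennreal (N \<tau>) \<partial>lborel) \<partial>lborel)"
  proof -
    have i: "(indicator {t..t+h} \<tau> :: ennreal) = (if t \<le> \<tau> \<and> \<tau> \<le> t + h then 1 else 0)" for t \<tau>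
      by (auto simp: indicator_def)
    show ?thesis unfolding i by (rule nn_integral_cmult) measurable
  qed
  also have "\<dots> = ennreal h * (\<integral>\<^sup>+\<tau>. (\<integral>\<^sup>+t. (if t \<le> \<tau> \<and> \<tau> \<le> t + h then 1 else 0) * ennreal (N \<tau>) \<partial>lborel) \<partial>lborel)"
    by (subst lborel_pair.Fubini') measurable
  also have "\<dots> = ennreal h * (\<integral>\<^sup>+\<tau>. ennreal h * ennreal (N \<tau>) \<partial>lborel)"
  proof (intro arg_cong2[where f = "(*)"] nn_integral_cong refl)
    fix \<tau> :: real
    have "(\<integral>\<^sup>+t. (if t \<le> \<tau> \<and> \<tau> \<le> t + h then 1 else 0) * ennreal (N \<tau>) \<partial>lborel) = (\<integral>\<^sup>+t. ennreal (N \<tau>) * indicator {\<tau>-h..\<tau>} t \<partial>lborel)"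
      by (intro nn_integral_cong) (auto simp: indicator_def)
    also have "\<dots> = ennreal h * ennreal (N \<tau>)"
      using h by (subst nn_integral_cmult_indicator) (auto simp: mult.commute)
    finally show "(\<integral>\<^sup>+t. (if t \<le> \<tau> \<and> \<tau> \<le> t + h then 1 else 0) * ennreal (N \<tau>) \<partial>lborel) = ennreal h * ennreal (N \<tau>)" .
  qed
  also have "\<dots> = ennreal h * (ennreal h * ennreal (\<integral>t. N t \<partial>lborel))"
    using N_nonneg by (simp add: nn_integral_cmult nn_integral_eq_integral[OF N_int])
  also have "\<dots> = ennreal (h\<^sup>2 * (\<integral>t. N t \<partial>lborel))"
    using h N_nonneg by (simp add: ennreal_mult[symmetric] power2_eq_square mult.assoc)
  finally have le: "(\<integral>\<^sup>+t. ennreal (F h t) \<partial>lborel) \<le> ennreal (h\<^sup>2 * (\<integral>t. N t \<partial>lborel))" .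
  then show i: "integrable lborel (F h)"
    using F_nonneg[OF h] by (intro integrableI_nonneg) (auto intro: le_less_trans)
  have "0 \<le> h\<^sup>2 * (\<integral>t. N t \<partial>lborel)" using N_nonneg by simp
  then show "(\<integral>t. F h t \<partial>lborel) \<le> h\<^sup>2 * (\<integral>t. N t \<partial>lborel)"
    using le F_nonneg[OF h] by (simp add: nn_integral_eq_integral[OF i])
qed

text \<open>The scalar identity is summed over the coordinates. All partial sums are dominated by
  the integrable function F h t + 2 N (t + h) + 2 N t, so summation and time integration
  interchange. The series in the statement is half of the time derivative of F.\<close>

lemma F_increment:
  assumes h: "h > 0" and t: "t1 \<le> t2"
  shows "summable (\<lambda>k. C h k t * (c k (t + h) - c k t))"
    and "set_integrable lborel {t1..t2} (\<lambda>t. \<Sum>k. C h k t * (c k (t + h) - c k t))"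
    and "F h t2 - F h t1 = 2 * (LBINT t:{t1..t2}. \<Sum>k. C h k t * (c k (t + h) - c k t))"
proof -
  let ?s = "\<lambda>k t. C h k t * (c k (t + h) - c k t)"
  note [measurable] = c_borel
  have [measurable]: "N \<in> borel_measurable borel" using N_int by auto
  let ?D = "\<lambda>t. F h t + 2 * N (t + h) + 2 * N t"
  have abs: "\<bar>?s k t\<bar> \<le> (C h k t)\<^sup>2 + 2 * (c k (t + h))\<^sup>2 + 2 * (c k t)\<^sup>2" for k t
    using abs_mult_le_squares[of "C h k t" "c k (t + h) - c k t"] square_diff_le[of "c k (t + h)" "c k t"] by linarith
  have Ds: "(\<lambda>k. (C h k t)\<^sup>2 + 2 * (c k (t + h))\<^sup>2 + 2 * (c k t)\<^sup>2) sums ?D t" for t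
    by (intro sums_add sums_mult C_sums c_sums h)
  show sm: "summable (\<lambda>k. ?s k t)" for t
    by (rule summable_comparison_test[OF _ sums_summable[OF Ds[of t]]]) (use abs in auto)
  have Ni: "integrable lborel (\<lambda>t. N (t + h))"
    using lborel_integrable_real_affine[OF N_int, of 1 h] by (simp add: add.commute)
  have Di: "integrable lborel (\<lambda>t. indicator {t1..t2} t *\<^sub>R ?D t)"
    using F_integral(1)[OF h] Ni N_int by (intro integrable_mult_indicator) auto
  let ?f = "\<lambda>n t. indicator {t1..t2} t *\<^sub>R (\<Sum>k<n. ?s k t)" and ?g = "\<lambda>t. indicator {t1..t2} t *\<^sub>R (\<Sum>k. ?s k t)"
  have lim: "(\<lambda>n. ?f n t) \<longlonglongrightarrow> ?g t" for t
    by (intro tendsto_intros summable_LIMSEQ sm)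
  have dom: "norm (?f n t) \<le> indicator {t1..t2} t *\<^sub>R ?D t" for n t
  proof -
    have "\<bar>\<Sum>k<n. ?s k t\<bar> \<le> (\<Sum>k<n. (C h k t)\<^sup>2 + 2 * (c k (t + h))\<^sup>2 + 2 * (c k t)\<^sup>2)"
      by (rule order_trans[OF sum_abs]) (intro sum_mono abs)
    also have "\<dots> \<le> ?D t"
      using sum_le_suminf[OF sums_summable[OF Ds[of t]], of "{..<n}"] Ds[of t] by (simp add: sums_iff)
    finally show ?thesis by (simp add: indicator_def)
  qed
  have fm: "?f n \<in> borel_measurable lborel" and gm: "?g \<in> borel_measurable lborel" for n by measurable
  have "integrable lborel ?g"
    by (rule integrable_dominated_convergence[where s = ?f, OF gm fm Di]) (use lim dom in auto)
  then show "set_integrable lborel {t1..t2} (\<lambda>t. \<Sum>k. ?s k t)" by (simp add: set_integrable_def)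
  have L: "(\<lambda>n. \<integral>t. ?f n t \<partial>lborel) \<longlonglongrightarrow> (\<integral>t. ?g t \<partial>lborel)"
    by (rule integral_dominated_convergence[where s = ?f, OF gm fm Di]) (use lim dom in auto)
  have "2 * (\<integral>t. ?f n t \<partial>lborel) = (\<Sum>k<n. (C h k t2)\<^sup>2) - (\<Sum>k<n. (C h k t1)\<^sup>2)" for n
  proof -
    have i: "integrable lborel (\<lambda>t. indicator {t1..t2} t *\<^sub>R ?s k t)" for k
      using window_square_increment(1)[OF c_set_integrable[where k=k] h t] by (simp add: set_integrable_def C_def)
    have "2 * (\<integral>t. ?f n t \<partial>lborel) = (\<Sum>k<n. 2 * (\<integral>t. indicator {t1..t2} t *\<^sub>R ?s k t \<partial>lborel))"
      unfolding scaleR_sum_right using i by (subst Bochner_Integration.integral_sum) (auto simp: sum_distrib_left)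
    also have "\<dots> = (\<Sum>k<n. (C h k t2)\<^sup>2 - (C h k t1)\<^sup>2)"
      using window_square_increment(2)[OF c_set_integrable h t]
      by (intro sum.cong) (auto simp: C_def set_lebesgue_integral_def)
    finally show ?thesis by (simp add: sum_subtractf)
  qed
  then have "(\<lambda>n. 2 * (\<integral>t. ?f n t \<partial>lborel)) \<longlonglongrightarrow> F h t2 - F h t1"
    using C_sums[OF h, of t1] C_sums[OF h, of t2] unfolding sums_def by (simp add: tendsto_diff)
  moreover have "(\<lambda>n. 2 * (\<integral>t. ?f n t \<partial>lborel)) \<longlonglongrightarrow> 2 * (\<integral>t. ?g t \<partial>lborel)"
    using L by (intro tendsto_intros)
  ultimately show "F h t2 - F h t1 = 2 * (LBINT t:{t1..t2}. \<Sum>k. ?s k t)"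
    unfolding set_lebesgue_integral_def by (rule LIMSEQ_unique)
qed

end

section \<open>Square-integrable curves in a semi-inner product space\<close>

lemma borel_measurable_AE_limit:
  fixes f :: "nat \<Rightarrow> real \<Rightarrow> real"
  assumes f: "\<And>n. f n \<in> borel_measurable lebesgue" and lim: "AE t in lebesgue. (\<lambda>n. f n t) \<longlonglongrightarrow> g t"
  shows "g \<in> borel_measurable lebesgue"
proof (rule borel_measurable_AE)
  show "(\<lambda>t. lim (\<lambda>n. f n t)) \<in> borel_measurable lebesgue" using f by measurable
  show "AE t in lebesgue. lim (\<lambda>n. f n t) = g t"
    using lim by eventually_elim (rule limI)
qed

lemma AE_lebesgue_shift:
  assumes "AE t in lebesgue. P (t::real)" shows "AE t in lebesgue. P (t + h)"
proof -
  have "negligible {t. \<not> P t}"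
    using assms by (simp add: completion.AE_iff_null_sets negligible_iff_null_sets)
  then have "negligible ((+) (- h) ` {t. \<not> P t})" by (rule negligible_translation)
  moreover have "{t. \<not> P (t + h)} \<subseteq> (+) (- h) ` {t. \<not> P t}"
    by (auto simp: image_iff intro!: exI[of _ "_ + h"])
  ultimately have "negligible {t. \<not> P (t + h)}" using negligible_subset by blast
  then show ?thesis
    by (intro AE_I'[of "{t. \<not> P (t + h)}"]) (auto simp: negligible_iff_null_sets)
qed

text \<open>With a Borel exceptional set, bad times can be cut out without losing Borel
  measurability.\<close>

lemma AE_lebesgue_borel_null_set:
  assumes "AE x in lebesgue. P (x::'a::euclidean_space)"
  shows "\<exists>Z. Z \<in> null_sets lborel \<and> (\<forall>x. x \<notin> Z \<longrightarrow> P x)"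
proof -
  have "AE x in lborel. P x" using assms by (simp add: AE_completion_iff)
  then show ?thesis unfolding eventually_ae_filter by auto
qed

text \<open>All properties hold at every time, which is achieved by modifying a given curve on a
  null set. The countable set D approximates the values of W and is there to provide Lebesgue
  points.\<close>

locale spanned_curve = semi_inner_space X B + sq_curve c N 
  for X :: "('b \<Rightarrow> real) set" and B c N +
  fixes e :: "nat \<Rightarrow> 'b \<Rightarrow> real" and W :: "real \<Rightarrow> 'b \<Rightarrow> real" and D :: "('b \<Rightarrow> real) set"
  assumes e: "orthosys e" and W: "\<And>t. spanned e (W t)" and coeff: "\<And>t k. B (W t) (e k) = c k t"
    and D: "countable D" "D \<subseteq> X" and dense: "\<And>t \<epsilon>. \<epsilon> > 0 \<Longrightarrow> \<exists>y\<in>D. nrm (\<lambda>x. W t x - y x) < \<epsilon>"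
begin

lemma W_mem: "W t \<in> X" using W[of t] by (simp add: spanned_def)

lemma N_eq: "N t = B (W t) (W t)"
  using W[of t] c_sums[of t] unfolding spanned_def coeff by (meson sums_unique2)

lemma nrm_W: "(nrm (W t))\<^sup>2 = N t" by (simp add: N_eq nrm_sq W_mem)

lemma B_W_sums: "v \<in> X \<Longrightarrow> (\<lambda>k. c k t * B v (e k)) sums B (W t) v"
  using spanned_parseval[OF e W, of v t] by (simp add: coeff)

lemma B_W_borel: 
  assumes "v \<in> X" shows "(\<lambda>t. B (W t) v) \<in> borel_measurable borel"
proof -
  note [measurable] = c_borel
  have "(\<lambda>t. B (W t) v) = (\<lambda>t. \<Sum>k. c k t * B v (e k))"
    using B_W_sums[OF assms] by (auto simp: sums_iff)
  then show ?thesis by simp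
qed

lemma nrm_W_le: "nrm (W t) \<le> 1 + N t"
proof -
  have "0 \<le> (nrm (W t) - 1)\<^sup>2" by simp
  then have "2 * nrm (W t) \<le> N t + 1" by (simp add: power2_diff nrm_W)
  then show ?thesis using nrm_nonneg[OF W_mem[of t]] by linarith
qed

lemma B_W_bound: "v \<in> X \<Longrightarrow> \<bar>B (W t) v\<bar> \<le> (1 + N t) * nrm v"
  using cauchy_schwarz[OF W_mem[of t], of v] mult_right_mono[OF nrm_W_le[of t] nrm_nonneg[of v]] by linarith

lemma one_plus_N_integrable: "integrable lborel (\<lambda>t. indicator {a..b} t * (1 + N t))"
proof -
  have "integrable lborel (\<lambda>t. indicator {a..b} t + indicator {a..b} t * N t)"
    using N_window_integrable[of a b] by (intro Bochner_Integration.integrable_add integrable_real_indicator) (auto simp: emeasure_lborel_Icc_eq)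
  then show ?thesis by (simp add: distrib_left)
qed

lemma B_W_set_integrable:
  assumes "v \<in> X" shows "set_integrable lborel {a..b} (\<lambda>t. B (W t) v)"
  unfolding set_integrable_def
proof (rule Bochner_Integration.integrable_bound)
  show "integrable lborel (\<lambda>t. indicator {a..b} t * (1 + N t) * nrm v)"
    using one_plus_N_integrable by (rule integrable_mult_left)
  show "(\<lambda>t. indicator {a..b} t *\<^sub>R B (W t) v) \<in> borel_measurable lborel"
    using B_W_borel[OF assms] by simp
  show "AE t in lborel. norm (indicator {a..b} t *\<^sub>R B (W t) v) \<le> norm (indicator {a..b} t * (1 + N t) * nrm v)"
    using B_W_bound[OF assms] N_nonneg nrm_nonneg[OF assms] by (auto simp: indicator_def)
qed

text \<open>In effect \<open>C h k t\<close> are the coordinates of the integral of W over the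
  window. Sum and integral interchange by dominated convergence: the partial sums are pairings of v
  with projections of W \<tau>, whose norms are at most that of W \<tau>.\<close>

lemma window_sums:
  assumes v: "v \<in> X"
  shows "(\<lambda>k. C h k t * B v (e k)) sums (LBINT \<tau>:{t..t+h}. B (W \<tau>) v)"
  unfolding sums_def
proof -
  note [measurable] = c_borel B_W_borel[OF v]
  let ?i = "indicator {t..t+h} :: real \<Rightarrow> real"
  let ?f = "\<lambda>n \<tau>. ?i \<tau> * (\<Sum>k<n. c k \<tau> * B v (e k))"
  have ic: "integrable lborel (\<lambda>\<tau>. ?i \<tau> * c k \<tau>)" for k
    using c_set_integrable[of t "t+h" k] by (simp add: set_integrable_def)
  have "(\<integral>\<tau>. ?f n \<tau> \<partial>lborel) = (\<Sum>k<n. C h k t * B v (e k))" for n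
  proof -
    have "?f n = (\<lambda>\<tau>. \<Sum>k<n. (?i \<tau> * c k \<tau>) * B v (e k))" by (simp add: sum_distrib_left mult.assoc)
    then show ?thesis using ic by (simp add: C_lborel)
  qed
  moreover have "(\<lambda>n. \<integral>\<tau>. ?f n \<tau> \<partial>lborel) \<longlonglongrightarrow> (\<integral>\<tau>. ?i \<tau> * B (W \<tau>) v \<partial>lborel)"
  proof (rule integral_dominated_convergence[where s = ?f and w = "\<lambda>\<tau>. ?i \<tau> * (1 + N \<tau>) * nrm v"])
    show "(\<lambda>\<tau>. ?i \<tau> * B (W \<tau>) v) \<in> borel_measurable lborel" by measurable
    show "?f n \<in> borel_measurable lborel" for n by measurable
    show "integrable lborel (\<lambda>\<tau>. ?i \<tau> * (1 + N \<tau>) * nrm v)"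
      using one_plus_N_integrable by (rule integrable_mult_left)
    show "AE \<tau> in lborel. (\<lambda>n. ?f n \<tau>) \<longlonglongrightarrow> ?i \<tau> * B (W \<tau>) v"
      using B_W_sums[OF v] unfolding sums_def by (intro AE_I2 tendsto_intros) auto
    show "AE \<tau> in lborel. norm (?f n \<tau>) \<le> ?i \<tau> * (1 + N \<tau>) * nrm v" for n
    proof (rule AE_I2)
      fix \<tau>
      have p: "proj e n (W \<tau>) \<in> X" by (rule proj_mem[OF e])
      have "(\<Sum>k<n. c k \<tau> * B v (e k)) = B (proj e n (W \<tau>)) v"
        by (simp add: B_proj_left[OF e W_mem v] coeff)
      also have "\<bar>\<dots>\<bar> \<le> nrm (proj e n (W \<tau>)) * nrm v" by (rule cauchy_schwarz[OF p v])
      also have "\<dots> \<le> (1 + N \<tau>) * nrm v"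
      proof (rule mult_right_mono[OF order_trans[OF _ nrm_W_le] nrm_nonneg[OF v]])
        show "nrm (proj e n (W \<tau>)) \<le> nrm (W \<tau>)"
          unfolding nrm_def B_proj_self[OF e W_mem] by (rule real_sqrt_le_mono[OF bessel[OF e W_mem]])
      qed
      finally show "norm (?f n \<tau>) \<le> ?i \<tau> * (1 + N \<tau>) * nrm v" by (simp add: indicator_def)
    qed
  qed
  ultimately show "(\<lambda>n. \<Sum>k<n. C h k t * B v (e k)) \<longlonglongrightarrow> (LBINT \<tau>:{t..t+h}. B (W \<tau>) v)"
    by (simp add: set_lebesgue_integral_def)
qed

text \<open>Cauchy-Schwarz in coordinates, with Bessel's inequality for v. Thus sqrt (F h t) bounds
  the dual norm of the window functional.\<close>

lemma window_bound:
  assumes v: "v \<in> X" and h: "h > 0"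
  shows "\<bar>LBINT \<tau>:{t..t+h}. B (W \<tau>) v\<bar> \<le> sqrt (F h t) * nrm v"
proof -
  have "\<bar>\<Sum>k<n. C h k t * B v (e k)\<bar> \<le> sqrt (F h t) * nrm v" for n
  proof -
    have "\<bar>\<Sum>k<n. C h k t * B v (e k)\<bar> \<le> L2_set (\<lambda>k. C h k t) {..<n} * L2_set (\<lambda>k. B v (e k)) {..<n}"
      by (rule order_trans[OF sum_abs]) (use L2_set_mult_ineq in \<open>auto simp: abs_mult\<close>)
    also have "\<dots> \<le> sqrt (F h t) * nrm v"
      using F_partial[OF h] bessel[OF e v] F_nonneg[OF h]
      by (intro mult_mono) (auto simp: L2_set_def nrm_def sum_nonneg)
    finally show ?thesis .
  qed
  then show ?thesis
    using window_sums[OF v, of h t] unfolding sums_def by (intro LIMSEQ_le_const2[OF tendsto_rabs]) auto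
qed

lemma nrm_diff_borel:
  assumes "v \<in> X" shows "(\<lambda>t. nrm (\<lambda>x. W t x - v x)) \<in> borel_measurable borel"
proof -
  note [measurable] = B_W_borel[OF assms]
  have [measurable]: "N \<in> borel_measurable borel" using N_int by auto
  have "(\<lambda>t. nrm (\<lambda>x. W t x - v x)) = (\<lambda>t. sqrt (N t - 2 * B (W t) v + B v v))"
    by (simp add: nrm_def B_diff_self W_mem assms N_eq)
  then show ?thesis by simp
qed

lemma nrm_diff_set_integrable:
  assumes v: "v \<in> X" shows "set_integrable lborel {a..b} (\<lambda>t. nrm (\<lambda>x. W t x - v x))"
  unfolding set_integrable_def
proof (rule Bochner_Integration.integrable_bound)
  show "integrable lborel (\<lambda>t. indicator {a..b} t * (1 + N t) * (1 + nrm v))"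
    using one_plus_N_integrable by (rule integrable_mult_left)
  show "(\<lambda>t. indicator {a..b} t *\<^sub>R nrm (\<lambda>x. W t x - v x)) \<in> borel_measurable lborel"
    using nrm_diff_borel[OF v] by simp
  show "AE t in lborel. norm (indicator {a..b} t *\<^sub>R nrm (\<lambda>x. W t x - v x)) \<le> norm (indicator {a..b} t * (1 + N t) * (1 + nrm v))"
  proof (rule AE_I2)
    fix t
    have n: "0 \<le> nrm v" "0 \<le> N t" using nrm_nonneg[OF v] N_nonneg by auto
    have "nrm (\<lambda>x. W t x - v x) \<le> nrm (W t) + nrm v"
      using nrm_triangle[OF W_mem scale_mem[OF v, of "-1"], of t] nrm_scale[OF v, of "-1"] by simp
    also have "\<dots> \<le> (1 + N t) + (1 + N t) * nrm v"
      using nrm_W_le[of t] mult_right_mono[of 1 "1 + N t" "nrm v"] n by simp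
    finally have "nrm (\<lambda>x. W t x - v x) \<le> (1 + N t) * (1 + nrm v)" by (simp add: distrib_left)
    then show "norm (indicator {a..b} t *\<^sub>R nrm (\<lambda>x. W t x - v x)) \<le> norm (indicator {a..b} t * (1 + N t) * (1 + nrm v))"
      using nrm_nonneg[OF diff_mem[OF W_mem v], of t] n by (simp add: indicator_def)
  qed
qed

text \<open>The scalar differentiation theorem is applied to the distance from W to each y in D, and
  the countably many exceptional sets are united. At any remaining t the value W t lies within
  \<epsilon> / 3 of some y in D, and the triangle inequality transfers the property from y to W
  t.\<close>

lemma lebesgue_points:
  "AE t in lebesgue. \<forall>\<epsilon>>0. \<exists>d>0. \<forall>h. 0 < h \<and> h < d \<longrightarrow> (LBINT \<tau>:{t..t+h}. nrm (\<lambda>x. W \<tau> x - W t x)) \<le> \<epsilon> * h"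
proof -
  let ?f = "\<lambda>y t. nrm (\<lambda>x. W t x - y x)"
  have int: "?f y integrable_on {a..b}" if "y \<in> X" for y a b
    by (rule set_borel_integral_eq_integral(1)[OF nrm_diff_set_integrable[OF that]])
  define LP where "LP = (\<lambda>y x. \<forall>\<epsilon>>0. \<exists>d>0. \<forall>h. 0 < h \<and> h < d \<longrightarrow>
      norm (integral {x..x+h} (?f y) /\<^sub>R h - ?f y x) < \<epsilon>)"
  have "\<forall>y\<in>D. \<exists>Z. negligible Z \<and> (\<forall>x. x \<notin> Z \<longrightarrow> LP y x)"
  proof
    fix y assume "y \<in> D"
    then have "y \<in> X" using D by blast
    then have "?f y integrable_on cbox a b" for a b using int by simp
    then show "\<exists>Z. negligible Z \<and> (\<forall>x. x \<notin> Z \<longrightarrow> LP y x)"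
    proof (rule integrable_ccontinuous_explicit)
      fix Z assume "negligible Z" and
        *: "\<And>x \<epsilon>. x \<notin> Z \<Longrightarrow> 0 < \<epsilon> \<Longrightarrow> \<exists>d>0. \<forall>h. 0 < h \<and> h < d \<longrightarrow>
         norm (integral (cbox x (x + h *\<^sub>R One)) (?f y) /\<^sub>R h ^ DIM(real) - ?f y x) < \<epsilon>"
      have "LP y x" if "x \<notin> Z" for x using *[OF that] by (simp add: LP_def)
      then show ?thesis using \<open>negligible Z\<close> by blast
    qed
  qed
  from bchoice[OF this] obtain Z where Z: "\<And>y. y \<in> D \<Longrightarrow> negligible (Z y)"
    and ZLP: "\<And>y x. y \<in> D \<Longrightarrow> x \<notin> Z y \<Longrightarrow> LP y x" by blast
  have Zd: "\<exists>d>0. \<forall>h. 0 < h \<and> h < d \<longrightarrow> norm (integral {x..x+h} (?f y) /\<^sub>R h - ?f y x) < \<epsilon>"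
    if "y \<in> D" "x \<notin> Z y" "0 < \<epsilon>" for y x \<epsilon>
    using ZLP[OF that(1,2)] that(3) by (simp add: LP_def)
  have neg: "negligible (\<Union>(Z ` D))"
    using D(1) Z by (intro negligible_countable_Union) auto
  show ?thesis
  proof (rule AE_I'[OF neg[unfolded negligible_iff_null_sets]], rule subsetI, rule ccontr)
    fix t assume t: "t \<in> {t \<in> space lebesgue. \<not> (\<forall>\<epsilon>>0. \<exists>d>0. \<forall>h. 0 < h \<and> h < d \<longrightarrow> (LBINT \<tau>:{t..t+h}. nrm (\<lambda>x. W \<tau> x - W t x)) \<le> \<epsilon> * h)}"
      and nZ: "t \<notin> \<Union>(Z ` D)"
    have "\<exists>d>0. \<forall>h. 0 < h \<and> h < d \<longrightarrow> (LBINT \<tau>:{t..t+h}. nrm (\<lambda>x. W \<tau> x - W t x)) \<le> \<epsilon> * h" if \<epsilon>: "\<epsilon> > 0" for \<epsilon>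
    proof -
      have "\<epsilon> / 3 > 0" using \<epsilon> by simp
      from dense[OF this] obtain y where y: "y \<in> D" "?f y t < \<epsilon> / 3" by blast
      have yX: "y \<in> X" using y D by blast
      have "t \<notin> Z y" using nZ y by blast
      from Zd[OF y(1) this \<open>\<epsilon> / 3 > 0\<close>] obtain d where d: "d > 0"
        "\<And>h. 0 < h \<Longrightarrow> h < d \<Longrightarrow> norm (integral {t..t+h} (?f y) /\<^sub>R h - ?f y t) < \<epsilon> / 3" by blast
      have "(LBINT \<tau>:{t..t+h}. nrm (\<lambda>x. W \<tau> x - W t x)) \<le> \<epsilon> * h" if h: "0 < h" "h < d" for h
      proof -
        have tri: "nrm (\<lambda>x. W \<tau> x - W t x) \<le> ?f y \<tau> + ?f y t" for \<tau>
          using nrm_diff_triangle[OF W_mem yX W_mem, of \<tau> t] nrm_minus_commute[OF yX W_mem, of t] by simp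
        have "(LBINT \<tau>:{t..t+h}. nrm (\<lambda>x. W \<tau> x - W t x)) = integral {t..t+h} (?f (W t))"
          by (rule set_borel_integral_eq_integral(2)[OF nrm_diff_set_integrable[OF W_mem]])
        also have "\<dots> \<le> integral {t..t+h} (\<lambda>\<tau>. ?f y \<tau> + ?f y t)"
          using int[OF W_mem] int[OF yX] tri by (intro integral_le) (auto intro!: integrable_add)
        also have "\<dots> = integral {t..t+h} (?f y) + h * ?f y t"
          using int[OF yX] h by (subst Henstock_Kurzweil_Integration.integral_add) auto
        also have "integral {t..t+h} (?f y) = h * (integral {t..t+h} (?f y) /\<^sub>R h)" using h by simp
        also have "h * (integral {t..t+h} (?f y) /\<^sub>R h) \<le> h * (?f y t + \<epsilon> / 3)"
        proof (rule mult_left_mono)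
          show "integral {t..t+h} (?f y) /\<^sub>R h \<le> ?f y t + \<epsilon> / 3"
            using d(2)[OF h] unfolding real_norm_def by linarith
        qed (use h in simp)
        also have "h * (?f y t + \<epsilon> / 3) + h * ?f y t \<le> h * (\<epsilon>/3 + \<epsilon>/3) + h * (\<epsilon>/3)"
          using y(2) h by (intro add_mono mult_left_mono) auto
        also have "\<dots> = \<epsilon> * h" by (simp add: algebra_simps)
        finally show ?thesis by simp
      qed
      with d(1) show ?thesis by blast
    qed
    then show False using t by blast
  qed
qed

end

context semi_inner_space
begin

text \<open>The approximating simple functions have countably many values, whose closed span
  contains w t for almost every t in I; Gram-Schmidt applied to them yields the system. The
  coordinates of w are measurable as limits of those of simple functions. Cutting out a Borel null
  set \<open>Z\<close> and extending by zero outside I makes them Borel and valid at every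
  time.\<close>

lemma curve_coordinates:
  assumes w: "w \<in> bochner_Lp 2 I X nrm" and I: "I \<in> sets borel"
  obtains e c N W D where "spanned_curve X B c N e W D" 
    "AE t in lebesgue. t \<in> I \<longrightarrow> W t = w t"
proof -
  have I'[measurable]: "I \<in> sets lebesgue" using I by simp
  obtain q :: "nat \<Rightarrow> real \<Rightarrow> 'b \<Rightarrow> real" where fin: "\<And>n. finite (q n ` I)" and qX: "\<And>n. q n ` I \<subseteq> X"
    and qm: "\<And>n y. {t \<in> I. q n t = y} \<in> sets lebesgue"
    and ql: "AE t in lebesgue. t \<in> I \<longrightarrow> w t \<in> X \<and> (\<lambda>n. nrm (\<lambda>x. w t x - q n t x)) \<longlonglongrightarrow> 0"
    using w unfolding bochner_Lp_def strongly_measurable_on_def by blast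
  have wint: "integrable lebesgue (\<lambda>t. indicator I t *\<^sub>R nrm (w t) ^ 2)"
    using w by (simp add: bochner_Lp_def set_integrable_def)
  \<comment> \<open>The zero function is included because W vanishes outside \<open>G\<close>; it
    also makes D nonempty for the enumeration.\<close>
  define D where "D = insert (\<lambda>x. 0) (\<Union>n. q n ` I)"
  have Dc: "countable D" unfolding D_def using fin by (simp add: countable_finite)
  have DX: "D \<subseteq> X" unfolding D_def using qX zero_mem by auto
  define d where "d = from_nat_into D"
  have dD: "range d = D" unfolding d_def using Dc by (intro range_from_nat_into) (auto simp: D_def)
  then have dX: "d n \<in> X" for n using DX by auto
  have "\<exists>e. orthosys e \<and> (\<forall>n. spanned e (d n))"
  proof (rule gram_schmidt[of d, OF dX])
    fix e assume "orthosys e" "\<And>n. spanned e (d n)"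
    then show ?thesis by blast
  qed
  then obtain e where e: "orthosys e" and ed: "\<And>n. spanned e (d n)" by blast
  have eD: "spanned e y" if "y \<in> D" for y using that ed unfolding dD[symmetric] by blast
  have good1: "AE t in lebesgue. t \<in> I \<longrightarrow> spanned e (w t) \<and> (\<forall>\<epsilon>>0. \<exists>y\<in>D. nrm (\<lambda>x. w t x - y x) < \<epsilon>)"
    using ql
  proof eventually_elim
    case (elim t)
    show ?case
    proof
      assume t: "t \<in> I"
      then have wX: "w t \<in> X" and l: "(\<lambda>n. nrm (\<lambda>x. w t x - q n t x)) \<longlonglongrightarrow> 0" using elim by auto
      have ap: "\<exists>y\<in>D. nrm (\<lambda>x. w t x - y x) < \<epsilon>" if "\<epsilon> > 0" for \<epsilon>
      proof -
        from LIMSEQ_D[OF l that] obtain n where "norm (nrm (\<lambda>x. w t x - q n t x) - 0) < \<epsilon>" by blast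
        then have "nrm (\<lambda>x. w t x - q n t x) < \<epsilon>" by auto
        moreover have "q n t \<in> D" using t by (auto simp: D_def)
        ultimately show ?thesis by blast
      qed
      then have "spanned e (w t)" using eD by (intro spanned_closed[OF e wX]) blast
      with ap show "spanned e (w t) \<and> (\<forall>\<epsilon>>0. \<exists>y\<in>D. nrm (\<lambda>x. w t x - y x) < \<epsilon>)" by blast
    qed
  qed
  define c0 where "c0 = (\<lambda>k t. indicator I t * B (w t) (e k))"
  have c0m: "c0 k \<in> borel_measurable lebesgue" for k
  proof (rule borel_measurable_AE_limit)
    let ?f = "\<lambda>n t. \<Sum>y\<in>q n ` I. B y (e k) * indicator {t \<in> I. q n t = y} t"
    show "?f n \<in> borel_measurable lebesgue" for n
      by (intro borel_measurable_sum borel_measurable_times borel_measurable_const borel_measurable_indicator qm)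
    have fe: "?f n t = indicator I t * B (q n t) (e k)" for n t
    proof (cases "t \<in> I")
      case True
      have "?f n t = (\<Sum>y\<in>q n ` I. if y = q n t then B (q n t) (e k) else 0)"
        using True by (intro sum.cong) (auto simp: indicator_def)
      also have "\<dots> = B (q n t) (e k)" using fin[of n] True by simp
      finally show ?thesis using True by simp
    qed simp
    show "AE t in lebesgue. (\<lambda>n. ?f n t) \<longlonglongrightarrow> c0 k t"
      unfolding fe c0_def using ql
    proof eventually_elim
      case (elim t)
      show ?case
      proof (cases "t \<in> I")
        case True
        then have wX: "w t \<in> X" and l: "(\<lambda>n. nrm (\<lambda>x. w t x - q n t x)) \<longlonglongrightarrow> 0" using elim by auto
        have qtX: "q n t \<in> X" for n using qX[of n] True by blast
        have ek: "e k \<in> X" by (rule orthosys_mem[OF e])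
        have "(\<lambda>n. B (w t) (e k) - B (q n t) (e k)) \<longlonglongrightarrow> 0"
        proof (rule Lim_null_comparison)
          show "(\<lambda>n. nrm (\<lambda>x. w t x - q n t x) * nrm (e k)) \<longlonglongrightarrow> 0"
            using tendsto_mult_left_zero[OF l] by simp
          show "\<forall>\<^sub>F n in sequentially. norm (B (w t) (e k) - B (q n t) (e k)) \<le> nrm (\<lambda>x. w t x - q n t x) * nrm (e k)"
            using cauchy_schwarz[OF diff_mem[OF wX qtX] ek] by (simp add: B_diff_left[OF wX qtX ek])
        qed
        then have "(\<lambda>n. B (w t) (e k) - (B (w t) (e k) - B (q n t) (e k))) \<longlonglongrightarrow> B (w t) (e k) - 0"
          by (intro tendsto_intros)
        then show ?thesis using True by simp
      qed simp
    qed
  qed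
  have "\<forall>k. \<exists>f. f \<in> borel_measurable borel \<and> (AE t in lebesgue. c0 k t = f t)"
    using lebesgue_borel_representative[OF c0m] by metis
  from choice[OF this] obtain c1 where c1: "\<And>k. c1 k \<in> borel_measurable borel" "\<And>k. AE t in lebesgue. c0 k t = c1 k t" by blast
  have "AE t in lebesgue. \<forall>k. c0 k t = c1 k t" using c1(2) unfolding AE_all_countable by blast
  with good1 have "AE t in lebesgue. (t \<in> I \<longrightarrow> spanned e (w t) \<and> (\<forall>\<epsilon>>0. \<exists>y\<in>D. nrm (\<lambda>x. w t x - y x) < \<epsilon>)) \<and> (\<forall>k. c0 k t = c1 k t)"
    by eventually_elim blast
  from AE_lebesgue_borel_null_set[OF this] obtain Z where Z: "Z \<in> null_sets lborel" 
    "\<And>t. t \<notin> Z \<Longrightarrow> (t \<in> I \<longrightarrow> spanned e (w t) \<and> (\<forall>\<epsilon>>0. \<exists>y\<in>D. nrm (\<lambda>x. w t x - y x) < \<epsilon>)) \<and> (\<forall>k. c0 k t = c1 k t)"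
    by blast
  define G where "G = I - Z"
  have G: "G \<in> sets borel" unfolding G_def using I Z(1) by auto
  define W where "W = (\<lambda>t. if t \<in> G then w t else (\<lambda>x. 0))"
  define c where "c = (\<lambda>k t. indicator G t * c1 k t)"
  define N where "N = (\<lambda>t. B (W t) (W t))"
  have Wsp: "spanned e (W t)" for t
  proof (cases "t \<in> G")
    case True
    then have tIZ: "t \<in> I" "t \<notin> Z" by (auto simp: G_def)
    have Wt: "W t = w t" using True by (simp add: W_def)
    show ?thesis unfolding Wt using conjunct1[OF Z(2)[OF tIZ(2)]] tIZ(1) by blast
  next
    case False
    have "spanned e (\<lambda>x. \<Sum>k<0. 0 * e k x)" by (rule spanned_combination[OF e])
    then show ?thesis using False by (simp add: W_def)
  qed
  have co: "B (W t) (e k) = c k t" for t k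
  proof (cases "t \<in> G")
    case True
    then have "c0 k t = c1 k t" "t \<in> I" using Z(2)[of t] by (auto simp: G_def)
    then show ?thesis using True by (simp add: W_def c_def c0_def)
  next
    case False
    then show ?thesis by (simp add: W_def c_def B_zero_left orthosys_mem[OF e])
  qed
  have csums: "(\<lambda>k. (c k t)\<^sup>2) sums N t" for t
    using Wsp[of t] unfolding spanned_def co N_def by blast
  have cm: "c k \<in> borel_measurable borel" for k unfolding c_def using c1(1) G by measurable
  have Nm: "N \<in> borel_measurable borel"
  proof -
    note [measurable] = cm
    have "N = (\<lambda>t. \<Sum>k. (c k t)\<^sup>2)" using csums by (auto simp: sums_iff)
    then show ?thesis by simp
  qed
  have aeZ: "AE t in lebesgue. t \<notin> Z"
    using Z(1) by (intro AE_completion AE_not_in)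
  then have WI: "AE t in lebesgue. t \<in> I \<longrightarrow> W t = w t"
    by eventually_elim (auto simp: W_def G_def)
  have aeN: "AE t in lebesgue. indicator I t *\<^sub>R nrm (w t) ^ 2 = N t"
    using aeZ
  proof eventually_elim
    case (elim t)
    show ?case
    proof (cases "t \<in> I")
      case True
      then have "W t = w t" "w t \<in> X" using elim Wsp[of t] by (auto simp: W_def G_def spanned_def)
      then show ?thesis using True by (simp add: N_def nrm_sq)
    next
      case False
      then show ?thesis by (simp add: N_def W_def G_def B_zero_left zero_mem)
    qed
  qed
  have "N \<in> borel_measurable lebesgue" using Nm by (simp add: measurable_completion)
  from integrable_cong_AE[THEN iffD1, OF borel_measurable_integrable[OF wint] this aeN wint]
  have "integrable lebesgue N" .
  then have Ni: "integrable lborel N" using Nm by (simp add: integrable_completion)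
  have "spanned_curve X B c N e W D"
  proof (unfold_locales)
    fix t and \<epsilon> :: real assume \<epsilon>: "\<epsilon> > 0"
    show "\<exists>y\<in>D. nrm (\<lambda>x. W t x - y x) < \<epsilon>"
    proof (cases "t \<in> G")
      case True
      then have tIZ: "t \<in> I" "t \<notin> Z" by (auto simp: G_def)
      have Wt: "W t = w t" using True by (simp add: W_def)
      show ?thesis unfolding Wt using conjunct1[OF Z(2)[OF tIZ(2)]] tIZ(1) \<epsilon> by blast
    next
      case False
      then have "nrm (\<lambda>x. W t x - 0) = 0" by (simp add: W_def nrm_def B_zero_left zero_mem)
      then show ?thesis using \<epsilon> by (intro bexI[of _ "\<lambda>x. 0"]) (auto simp: D_def)
    qed
  qed (use cm csums Ni e Wsp co Dc DX in auto)
  then show ?thesis using that WI by blast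
qed

end

context spanned_curve
begin

lemma window_near_lebesgue_point:
  assumes v: "v \<in> X" and h: "h > 0" and near: "(LBINT \<tau>:{t..t+h}. nrm (\<lambda>x. W \<tau> x - W t x)) \<le> \<epsilon> * h"
  shows "\<bar>(LBINT \<tau>:{t..t+h}. B (W \<tau>) v) - h * B (W t) v\<bar> \<le> \<epsilon> * h * nrm v"
proof -
  have i1: "(\<lambda>\<tau>. B (W \<tau>) v) integrable_on {t..t+h}"
    by (rule set_borel_integral_eq_integral(1)[OF B_W_set_integrable[OF v]])
  have i2: "(\<lambda>\<tau>. nrm (\<lambda>x. W \<tau> x - W t x)) integrable_on {t..t+h}"
    by (rule set_borel_integral_eq_integral(1)[OF nrm_diff_set_integrable[OF W_mem]])
  have "(LBINT \<tau>:{t..t+h}. B (W \<tau>) v) - h * B (W t) v = integral {t..t+h} (\<lambda>\<tau>. B (W \<tau>) v) - integral {t..t+h} (\<lambda>\<tau>. B (W t) v)"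
    using h by (simp add: set_borel_integral_eq_integral(2)[OF B_W_set_integrable[OF v]])
  also have "\<dots> = integral {t..t+h} (\<lambda>\<tau>. B (W \<tau>) v - B (W t) v)"
    by (rule Henstock_Kurzweil_Integration.integral_diff[symmetric, OF i1 integrable_const_ivl])
  also have "norm \<dots> \<le> integral {t..t+h} (\<lambda>\<tau>. nrm (\<lambda>x. W \<tau> x - W t x) * nrm v)"
  proof (rule integral_norm_bound_integral)
    show "(\<lambda>\<tau>. B (W \<tau>) v - B (W t) v) integrable_on {t..t+h}" by (intro integrable_diff i1 integrable_const_ivl)
    show "(\<lambda>\<tau>. nrm (\<lambda>x. W \<tau> x - W t x) * nrm v) integrable_on {t..t+h}"
      using integrable_on_mult_left[OF i2, of "nrm v"] by (simp add: mult.commute)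
    show "norm (B (W \<tau>) v - B (W t) v) \<le> nrm (\<lambda>x. W \<tau> x - W t x) * nrm v" for \<tau>
      using cauchy_schwarz[OF diff_mem[OF W_mem W_mem] v, of \<tau> t] by (simp add: B_diff_left[OF W_mem W_mem v])
  qed
  also have "\<dots> = (LBINT \<tau>:{t..t+h}. nrm (\<lambda>x. W \<tau> x - W t x)) * nrm v"
    by (simp add: set_borel_integral_eq_integral(2)[OF nrm_diff_set_integrable[OF W_mem]])
  also have "\<dots> \<le> \<epsilon> * h * nrm v" by (rule mult_right_mono[OF near nrm_nonneg[OF v]])
  finally show ?thesis by simp
qed

end

section \<open>The energy estimate\<close>

text \<open>\<open>W\<close> is the chemical potential, modified on a null set of times. For time increments
  \<open>\<delta>u = u (t + h) - u t\<close> one has \<open>\<delta>u = - \<AA> (integral of W over [t, t + h])\<close>, so that \<open>F h t\<close> is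
  the squared dual norm of \<open>\<delta>u\<close>, and testing the increment of the second equation with \<open>\<delta>u\<close> gives
  \<open>1/2 F' + \<parallel>\<delta>u\<parallel>\<^sup>2 \<le> lam \<parallel>\<delta>u\<parallel>\<^sup>2\<close> with the norms of \<open>X_space \<Omega> \<sigma>\<close> and \<open>L\<^sup>2\<close> respectively.\<close>

locale ch_energy =
  fixes \<Omega> :: "'a::euclidean_space set" and s \<sigma> lam :: real and g :: "real \<Rightarrow> real" 
    and u :: "real \<Rightarrow> 'a \<Rightarrow> real" and c N e W D
  assumes \<Omega>: "bounded \<Omega>" "open \<Omega>" and s: "0 < s" "s < 1" and \<sigma>: "0 < \<sigma>" "\<sigma> < 1" and lam: "0 \<le> lam"
    and g_mono: "\<And>x y. - lam * (x - y)\<^sup>2 \<le> (g x - g y) * (x - y)"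
    and uX: "\<And>t. t \<ge> 0 \<Longrightarrow> u t \<in> X_space \<Omega> \<sigma>"
    and u_weak: "\<And>l. l \<in> X_dual \<Omega> \<sigma> \<Longrightarrow> continuous_on {0..} (\<lambda>t. l (u t))"
    and curve: "spanned_curve (X_space \<Omega> s) (frac_op s) c N e W D"
    and evolution: "\<And>v t1 t2. v \<in> X_space \<Omega> s \<Longrightarrow> 0 < t1 \<Longrightarrow> t1 \<le> t2 \<Longrightarrow>
      (LINT x|lebesgue. u t2 x * v x) - (LINT x|lebesgue. u t1 x * v x) = - (LBINT \<tau>:{t1..t2}. frac_op s (W \<tau>) v)"
    and potential: "AE t in lebesgue. 0 < t \<longrightarrow> (\<lambda>x. g (u t x)) \<in> L2_space \<Omega> \<and>
      (\<forall>v\<in>X_space \<Omega> \<sigma>. (LINT x|lebesgue. W t x * v x) = frac_op \<sigma> (u t) v + (LINT x|lebesgue. g (u t x) * v x))"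
begin

sublocale T: semi_inner_space "X_space \<Omega> \<sigma>" "frac_op \<sigma>" by (rule semi_inner_space_X[OF \<sigma>])
sublocale spanned_curve "X_space \<Omega> s" "frac_op s" c N e W D by (rule curve)

lemma nrm_s: "nrm = X_norm s" by (rule nrm_X[OF s])
lemma nrm_\<sigma>: "T.nrm = X_norm \<sigma>" by (rule nrm_X[OF \<sigma>])

lemma X_sq_int: "v \<in> X_space \<Omega> a \<Longrightarrow> sq_int lebesgue v"
  by (simp add: X_space_iff)

lemma B_u_continuous: "v \<in> X_space \<Omega> \<sigma> \<Longrightarrow> continuous_on {0..} (\<lambda>t. frac_op \<sigma> (u t) v)"
  using u_weak[of "\<lambda>w. frac_op \<sigma> w v"] T.B_in_dual[of v] by (simp add: nrm_\<sigma>)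

text \<open>Weak continuity suffices: a functional that kills the system kills u at nonnegative
  rational times, hence at all times in {0..}, and \<open>spanned_if_annihilated\<close>
  applies.\<close>

lemma u_spanned: "\<exists>f. T.orthosys f \<and> (\<forall>t\<ge>0. T.spanned f (u t))"
proof -
  define Q where "Q = {q \<in> \<rat>. (0::real) \<le> q}"
  have Q: "countable Q" "Q \<noteq> {}" 
    unfolding Q_def by (rule countable_subset[OF _ countable_rat]) (auto intro: exI[of _ 0])
  define d where "d = (\<lambda>n. u (from_nat_into Q n))"
  have dX: "d n \<in> X_space \<Omega> \<sigma>" for n
    unfolding d_def using from_nat_into[OF Q(2), of n] by (intro uX) (auto simp: Q_def)
  have "\<exists>f. T.orthosys f \<and> (\<forall>n. T.spanned f (d n))"
  proof (rule T.gram_schmidt[of d, OF dX])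
    fix f assume "T.orthosys f" "\<And>n. T.spanned f (d n)"
    then show ?thesis by blast
  qed
  then obtain f where f: "T.orthosys f" "\<And>n. T.spanned f (d n)" by blast
  have "T.spanned f (u t)" if t: "t \<ge> 0" for t
  proof (rule T.spanned_if_annihilated[OF f(1) uX[OF t]])
    fix l assume l: "l \<in> dual_space (X_space \<Omega> \<sigma>) T.nrm" and z: "\<And>k. l (f k) = 0"
    have lQ: "l (u q) = 0" if qQ: "q \<in> Q" for q
    proof -
      obtain n where "from_nat_into Q n = q" using from_nat_into_surj[OF Q(1) qQ] by blast
      then have "T.spanned f (u q)" using f(2)[of n] by (simp add: d_def)
      from T.spanned_functional_sums[OF f(1) this l] show ?thesis using z by (simp add: sums_iff)
    qed
    \<comment> \<open>Rational times are taken to the right of t, so they remain in {0..} even for t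
      = 0.\<close>
    have "\<forall>n. \<exists>q. q \<in> Q \<and> t < q \<and> q < t + 1 / real (Suc n)"
    proof
      fix n
      obtain q where "q \<in> \<rat>" "t < q" "q < t + 1 / real (Suc n)"
        using Rats_dense_in_real[of t "t + 1 / real (Suc n)"] by auto
      then show "\<exists>q. q \<in> Q \<and> t < q \<and> q < t + 1 / real (Suc n)" using t by (auto simp: Q_def)
    qed
    from choice[OF this] obtain r where r: "\<And>n. r n \<in> Q" "\<And>n. t < r n" "\<And>n. r n < t + 1 / real (Suc n)" by blast
    have "(\<lambda>n. t + 1 / real (Suc n)) \<longlonglongrightarrow> t + 0" by (intro tendsto_intros LIMSEQ_Suc lim_1_over_n)
    then have lim: "(\<lambda>n. t + 1 / real (Suc n)) \<longlonglongrightarrow> t" unfolding add_0_right .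
    have "r \<longlonglongrightarrow> t"
      by (rule tendsto_sandwich[OF always_eventually[OF allI[OF less_imp_le[OF r(2)]]]
            always_eventually[OF allI[OF less_imp_le[OF r(3)]]] tendsto_const lim])
    then have "(\<lambda>n. l (u (r n))) \<longlonglongrightarrow> l (u t)"
      using u_weak[of l] l t r(1) unfolding nrm_\<sigma>
      by (intro continuous_on_tendsto_compose[of "{0..}" "\<lambda>t. l (u t)"]) (auto simp: Q_def)
    then show "l (u t) = 0" using lQ[OF r(1)] by (simp add: LIMSEQ_const_iff)
  qed
  with f(1) show ?thesis by blast
qed

definition f :: "nat \<Rightarrow> 'a \<Rightarrow> real" where
  "f = (SOME f. T.orthosys f \<and> (\<forall>t\<ge>0. T.spanned f (u t)))"

lemma f: "T.orthosys f" "t \<ge> 0 \<Longrightarrow> T.spanned f (u t)"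
  using someI_ex[OF u_spanned] unfolding f_def by blast+

definition inc :: "real \<Rightarrow> real \<Rightarrow> 'a \<Rightarrow> real" where "inc h t = (\<lambda>x. u (t + h) x - u t x)"

lemma inc_mem: "h > 0 \<Longrightarrow> t > 0 \<Longrightarrow> inc h t \<in> X_space \<Omega> \<sigma>"
  unfolding inc_def by (intro T.diff_mem uX) auto

lemma inc_spanned: "h > 0 \<Longrightarrow> t > 0 \<Longrightarrow> T.spanned f (inc h t)"
  unfolding inc_def by (intro T.spanned_diff f) auto

text \<open>The cut-off to zero for t \<le> 0 makes E and the coordinates \<open>\<beta>\<close>
  Borel functions on the whole line, although u is controlled only on {0..}.\<close>

definition E :: "real \<Rightarrow> real \<Rightarrow> real" where
  "E h t = (if t > 0 then frac_op \<sigma> (inc h t) (inc h t) else 0)"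

definition \<beta> :: "real \<Rightarrow> nat \<Rightarrow> real \<Rightarrow> real" where
  "\<beta> h k t = (if t > 0 then frac_op \<sigma> (inc h t) (f k) else 0)"

lemma \<beta>_borel: 
  assumes "h > 0" shows "\<beta> h k \<in> borel_measurable borel"
proof -
  have fk: "f k \<in> X_space \<Omega> \<sigma>" by (rule T.orthosys_mem[OF f(1)])
  have "continuous_on {0<..} (\<lambda>t. frac_op \<sigma> (u (t + h)) (f k) - frac_op \<sigma> (u t) (f k))"
    using assms by (intro continuous_intros continuous_on_compose2[OF B_u_continuous[OF fk]] continuous_on_subset[OF B_u_continuous[OF fk]]) auto
  then have "(\<lambda>t. indicator {0<..} t *\<^sub>R (frac_op \<sigma> (u (t + h)) (f k) - frac_op \<sigma> (u t) (f k))) \<in> borel_measurable borel"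
    by (intro borel_measurable_continuous_on_indicator) auto
  moreover have "\<beta> h k = (\<lambda>t. indicator {0<..} t *\<^sub>R (frac_op \<sigma> (u (t + h)) (f k) - frac_op \<sigma> (u t) (f k)))"
    using assms by (auto simp: \<beta>_def inc_def fun_eq_iff T.B_diff_left uX fk)
  ultimately show ?thesis by simp
qed

lemma E_sums: "h > 0 \<Longrightarrow> (\<lambda>k. (\<beta> h k t)\<^sup>2) sums E h t"
  using inc_spanned[of h t] by (auto simp: \<beta>_def E_def T.spanned_def)

lemma E_borel: 
  assumes "h > 0" shows "E h \<in> borel_measurable borel"
proof -
  note [measurable] = \<beta>_borel[OF assms]
  have "E h = (\<lambda>t. \<Sum>k. (\<beta> h k t)\<^sup>2)" using E_sums[OF assms] by (auto simp: sums_iff)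
  then show ?thesis by simp
qed

lemma E_nonneg: "h > 0 \<Longrightarrow> 0 \<le> E h t"
  by (simp add: E_def T.B_nonneg inc_mem)

lemma inc_pairing:
  assumes v: "v \<in> X_space \<Omega> s" and h: "h > 0" and t: "t > 0"
  shows "(LINT x|lebesgue. inc h t x * v x) = - (LBINT \<tau>:{t..t+h}. frac_op s (W \<tau>) v)"
proof -
  have "(LINT x|lebesgue. inc h t x * v x) = (LINT x|lebesgue. u (t+h) x * v x) - (LINT x|lebesgue. u t x * v x)"
    unfolding inc_def left_diff_distrib using h t
    by (intro Bochner_Integration.integral_diff sq_int_mult X_sq_int[OF uX] X_sq_int[OF v]) auto
  also have "\<dots> = - (LBINT \<tau>:{t..t+h}. frac_op s (W \<tau>) v)" using h by (intro evolution[OF v t]) simp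
  finally show ?thesis .
qed

lemma inc_pairing_bound:
  assumes v: "v \<in> X_space \<Omega> s" and h: "h > 0" and t: "t > 0"
  shows "\<bar>LINT x|lebesgue. inc h t x * v x\<bar> \<le> sqrt (F h t) * X_norm s v"
  using window_bound[OF v h, of t] by (simp add: inc_pairing[OF assms] nrm_s)

text \<open>The left side is the window functional evaluated at the increment of W, and
  \<open>inc_pairing\<close> turns it into minus the L^2 pairing of the two increments. There the
  second equation, taken at the times t and t + h, is tested with the increment of u;
  \<open>AE_lebesgue_shift\<close> makes it available at t + h.\<close>

lemma energy_pointwise:
  assumes h: "h > 0"
  shows "AE t in lebesgue. 0 < t \<longrightarrow>
    (\<Sum>k. C h k t * (c k (t + h) - c k t)) \<le> - E h t + lam * (LINT x|lebesgue. (inc h t x)\<^sup>2)"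
  using potential AE_lebesgue_shift[OF potential, of h]
proof eventually_elim
  case (elim t)
  show ?case
  proof
    assume t: "0 < t"
    let ?d = "inc h t" and ?w = "\<lambda>x. W (t + h) x - W t x" and ?g = "\<lambda>x. g (u (t + h) x) - g (u t x)"
    have dX: "?d \<in> X_space \<Omega> \<sigma>" by (rule inc_mem[OF h t])
    have wX: "?w \<in> X_space \<Omega> s" by (intro diff_mem W_mem)
    note d2 = X_sq_int[OF dX] 
    have g1: "sq_int lebesgue (\<lambda>x. g (u (t + h) x))" "sq_int lebesgue (\<lambda>x. g (u t x))"
      using elim h t by (auto intro!: L2_space_sq_int)
    have "(\<Sum>k. C h k t * (c k (t + h) - c k t)) = (LBINT \<tau>:{t..t+h}. frac_op s (W \<tau>) ?w)"
    proof -
      have "frac_op s ?w (e k) = c k (t + h) - c k t" for k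
        by (simp add: B_diff_left W_mem orthosys_mem[OF e] coeff)
      then show ?thesis using window_sums[OF wX, of h t] by (simp add: sums_iff)
    qed
    also have "\<dots> = - (LINT x|lebesgue. ?d x * ?w x)" by (simp add: inc_pairing[OF wX h t])
    also have "(LINT x|lebesgue. ?d x * ?w x) = (LINT x|lebesgue. W (t + h) x * ?d x) - (LINT x|lebesgue. W t x * ?d x)"
    proof -
      have "(\<lambda>x. ?d x * ?w x) = (\<lambda>x. W (t + h) x * ?d x - W t x * ?d x)" by (simp add: algebra_simps)
      then show ?thesis using sq_int_mult[OF X_sq_int[OF W_mem] d2] by simp
    qed
    also have "\<dots> = frac_op \<sigma> (u (t + h)) ?d - frac_op \<sigma> (u t) ?d + ((LINT x|lebesgue. g (u (t + h) x) * ?d x) - (LINT x|lebesgue. g (u t x) * ?d x))"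
      using elim h t dX by simp
    also have "frac_op \<sigma> (u (t + h)) ?d - frac_op \<sigma> (u t) ?d = E h t"
    proof -
      have "u (t + h) \<in> X_space \<Omega> \<sigma>" "u t \<in> X_space \<Omega> \<sigma>" using h t by (auto intro: uX)
      then show ?thesis using T.B_diff_left[OF _ _ dX, of "u (t+h)" "u t"] t by (simp add: E_def inc_def)
    qed
    also have "(LINT x|lebesgue. g (u (t + h) x) * ?d x) - (LINT x|lebesgue. g (u t x) * ?d x) = (LINT x|lebesgue. ?g x * ?d x)"
      using sq_int_mult[OF g1(1) d2] sq_int_mult[OF g1(2) d2] by (simp add: left_diff_distrib)
    finally have 1: "(\<Sum>k. C h k t * (c k (t + h) - c k t)) = - E h t - (LINT x|lebesgue. ?g x * ?d x)" by simp
    have "(LINT x|lebesgue. - lam * (?d x)\<^sup>2) \<le> (LINT x|lebesgue. ?g x * ?d x)"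
    proof (rule integral_mono)
      show "integrable lebesgue (\<lambda>x. - lam * (?d x)\<^sup>2)" using d2 by (simp add: sq_int_def)
      show "integrable lebesgue (\<lambda>x. ?g x * ?d x)" by (rule sq_int_mult[OF sq_int_diff[OF g1] d2])
      show "- lam * (?d x)\<^sup>2 \<le> ?g x * ?d x" for x unfolding inc_def by (rule g_mono)
    qed
    then show "(\<Sum>k. C h k t * (c k (t + h) - c k t)) \<le> - E h t + lam * (LINT x|lebesgue. (?d x)\<^sup>2)"
      using 1 by simp
  qed
qed

text \<open>Ehrling's inequality is applied to the increment with A = sqrt (F h t), as
  \<open>inc_pairing_bound\<close> permits. Its parameter 1 / (2 (lam + 1)) becomes the coefficient
  lam / (2 (lam + 1)) \<le> 1/2, so half of E survives, and the constant is independent of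
  h.\<close>

lemma energy_pointwise_absorbed:
  "\<exists>C1\<ge>0. \<forall>h>0. AE t in lebesgue. 0 < t \<longrightarrow>
    (\<Sum>k. C h k t * (c k (t + h) - c k t)) \<le> - E h t / 2 + C1 * F h t"
proof -
  have "1 / (2 * (lam + 1)) > 0" using lam by simp
  then obtain C0 where C0: "C0 \<ge> 0"
    "\<And>v A. v \<in> X_space \<Omega> \<sigma> \<Longrightarrow> A \<ge> 0 \<Longrightarrow>
      (\<And>\<phi>. \<phi> \<in> X_space \<Omega> s \<Longrightarrow> \<bar>LINT x|lebesgue. v x * \<phi> x\<bar> \<le> A * X_norm s \<phi>) \<Longrightarrow>
      (LINT x|lebesgue. (v x)\<^sup>2) \<le> 1 / (2 * (lam + 1)) * frac_op \<sigma> v v + C0 * A\<^sup>2"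
    using ehrling[OF \<Omega> s \<sigma>] by blast
  show ?thesis
  proof (intro exI[of _ "lam * C0"] conjI allI impI)
    show "0 \<le> lam * C0" using lam C0 by simp
    fix h :: real assume h: "h > 0"
    show "AE t in lebesgue. 0 < t \<longrightarrow> (\<Sum>k. C h k t * (c k (t + h) - c k t)) \<le> - E h t / 2 + lam * C0 * F h t"
      using energy_pointwise[OF h]
    proof eventually_elim
      case (elim t)
      show ?case
      proof
        assume t: "0 < t"
        have "(LINT x|lebesgue. (inc h t x)\<^sup>2) \<le> 1 / (2 * (lam + 1)) * frac_op \<sigma> (inc h t) (inc h t) + C0 * (sqrt (F h t))\<^sup>2"
          using F_nonneg[OF h] inc_pairing_bound[OF _ h t] by (intro C0(2) inc_mem[OF h t]) auto
        then have "(LINT x|lebesgue. (inc h t x)\<^sup>2) \<le> 1 / (2 * (lam + 1)) * E h t + C0 * F h t"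
          using t F_nonneg[OF h] by (simp add: E_def)
        from mult_left_mono[OF this lam]
        have "lam * (LINT x|lebesgue. (inc h t x)\<^sup>2) \<le> lam / (2 * (lam + 1)) * E h t + lam * C0 * F h t"
          by (simp add: distrib_left mult.assoc)
        moreover have "lam / (2 * (lam + 1)) * E h t \<le> 1 / 2 * E h t"
          using lam by (intro mult_right_mono E_nonneg[OF h]) (simp add: field_simps)
        ultimately show "(\<Sum>k. C h k t * (c k (t + h) - c k t)) \<le> - E h t / 2 + lam * C0 * F h t"
          using elim t by linarith
      qed
    qed
  qed
qed

text \<open>The term with F is not handled by Gronwall: its integral over the whole line is at most
  h^2 M by \<open>F_integral\<close>, with M the integral of N, so the constant does not grow with
  t2.\<close>

lemma energy_inequality:
  "\<exists>K1\<ge>0. \<forall>h t1 t2. h > 0 \<longrightarrow> 0 < t1 \<longrightarrow> t1 \<le> t2 \<longrightarrow> set_integrable lborel {t1..t2} (E h) \<and>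
      F h t2 + (LBINT t:{t1..t2}. E h t) \<le> F h t1 + K1 * h\<^sup>2"
proof -
  obtain C1 where C1: "C1 \<ge> 0" and pw: "\<And>h. h > 0 \<Longrightarrow> AE t in lebesgue. 0 < t \<longrightarrow>
    (\<Sum>k. C h k t * (c k (t + h) - c k t)) \<le> - E h t / 2 + C1 * F h t"
    using energy_pointwise_absorbed by blast
  define M where "M = (\<integral>t. N t \<partial>lborel)"
  have M: "M \<ge> 0" using N_nonneg by (simp add: M_def)
  show ?thesis
  proof (intro exI[of _ "2 * C1 * M"] conjI allI impI)
    show "0 \<le> 2 * C1 * M" using C1 M by simp
    fix h t1 t2 :: real assume h: "h > 0" and t: "0 < t1" "t1 \<le> t2"
    let ?S = "\<lambda>t. \<Sum>k. C h k t * (c k (t + h) - c k t)"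
    let ?i = "indicator {t1..t2} :: real \<Rightarrow> real"
    note [measurable] = E_borel[OF h]
    have Si: "integrable lborel (\<lambda>t. ?i t * ?S t)" using F_increment(2)[OF h t(2)] by (simp add: set_integrable_def)
    have Fi: "integrable lborel (\<lambda>t. ?i t * F h t)"
      using integrable_mult_indicator[OF _ F_integral(1)[OF h], of "{t1..t2}"] by simp
    have ae: "AE t in lborel. ?i t * E h t \<le> 2 * C1 * (?i t * F h t) - 2 * (?i t * ?S t)"
    proof -
      have "AE t in lborel. 0 < t \<longrightarrow> ?S t \<le> - E h t / 2 + C1 * F h t"
        using pw[OF h] by (simp add: AE_completion_iff)
      then show ?thesis
      proof eventually_elim
        case (elim t)
        show ?case
        proof (cases "t \<in> {t1..t2}")
          case True
          then have "?S t \<le> - E h t / 2 + C1 * F h t" using elim t by simp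
          then show ?thesis using True by simp
        qed simp
      qed
    qed
    have bi: "integrable lborel (\<lambda>t. 2 * C1 * (?i t * F h t) - 2 * (?i t * ?S t))"
      using Si Fi by simp
    \<comment> \<open>Integrability of E comes from the inequality itself: E is nonnegative, Borel
      and dominated by an integrable function.\<close>
    have Ei: "integrable lborel (\<lambda>t. ?i t * E h t)"
    proof (rule Bochner_Integration.integrable_bound[OF bi])
      show "AE t in lborel. norm (?i t * E h t) \<le> norm (2 * C1 * (?i t * F h t) - 2 * (?i t * ?S t))"
        using ae
      proof eventually_elim
        case (elim t)
        have "0 \<le> ?i t * E h t" using E_nonneg[OF h] by simp
        then show ?case using elim by simp
      qed
    qed measurable
    then show "set_integrable lborel {t1..t2} (E h)" by (simp add: set_integrable_def)
    have "(\<integral>t. ?i t * E h t \<partial>lborel) \<le> (\<integral>t. 2 * C1 * (?i t * F h t) - 2 * (?i t * ?S t) \<partial>lborel)"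
      by (rule integral_mono_AE[OF Ei bi ae])
    also have "\<dots> = 2 * C1 * (\<integral>t. ?i t * F h t \<partial>lborel) - 2 * (\<integral>t. ?i t * ?S t \<partial>lborel)"
      using Si Fi by simp
    also have "2 * (\<integral>t. ?i t * ?S t \<partial>lborel) = F h t2 - F h t1"
      using F_increment(3)[OF h t(2)] by (simp add: set_lebesgue_integral_def)
    also have "(\<integral>t. ?i t * F h t \<partial>lborel) \<le> h\<^sup>2 * M"
    proof -
      have "(\<integral>t. ?i t * F h t \<partial>lborel) \<le> (\<integral>t. F h t \<partial>lborel)"
        using F_nonneg[OF h] by (intro integral_mono Fi F_integral(1)[OF h]) (auto simp: indicator_def)
      then show ?thesis using F_integral(2)[OF h] by (simp add: M_def)
    qed
    finally have "(\<integral>t. ?i t * E h t \<partial>lborel) \<le> 2 * C1 * (h\<^sup>2 * M) - (F h t2 - F h t1)"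
      using C1 by (simp add: mult_left_mono)
    moreover have "2 * C1 * (h\<^sup>2 * M) = 2 * C1 * M * h\<^sup>2" by simp
    ultimately show "F h t2 + (LBINT t:{t1..t2}. E h t) \<le> F h t1 + 2 * C1 * M * h\<^sup>2"
      unfolding set_lebesgue_integral_def real_scaleR_def by linarith
  qed
qed

lemma uniform_bounds:
  assumes t0: "t0 > 0"
  shows "\<exists>K\<ge>0. \<forall>h t. h > 0 \<longrightarrow> t0 \<le> t \<longrightarrow> F h t \<le> K * h\<^sup>2 \<and> set_integrable lborel {t0..t} (E h) \<and> (LBINT \<tau>:{t0..t}. E h \<tau>) \<le> K * h\<^sup>2"
proof -
  obtain K1 where K1: "K1 \<ge> 0" and en: "\<And>h t1 t2. h > 0 \<Longrightarrow> 0 < t1 \<Longrightarrow> t1 \<le> t2 \<Longrightarrow> set_integrable lborel {t1..t2} (E h) \<and>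
      F h t2 + (LBINT t:{t1..t2}. E h t) \<le> F h t1 + K1 * h\<^sup>2"
    using energy_inequality by blast
  define M where "M = (\<integral>t. N t \<partial>lborel)"
  have M: "M \<ge> 0" using N_nonneg by (simp add: M_def)
  define K where "K = (M + 1) / t0 + K1"
  show ?thesis
  proof (intro exI[of _ K] conjI allI impI)
    show "0 \<le> K" using M t0 K1 by (simp add: K_def)
    fix h t :: real assume h: "h > 0" and t: "t0 \<le> t"
    \<comment> \<open>Averaging over the starting time: if F exceeded h^2 (M + 1) / t0 throughout
      (0, t0), its integral would be larger than h^2 M. The summand 1 makes the contradiction
      strict.\<close>
    have "\<exists>t1. 0 < t1 \<and> t1 < t0 \<and> F h t1 \<le> h\<^sup>2 * (M + 1) / t0"
    proof (rule ccontr)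
      assume "\<not> (\<exists>t1. 0 < t1 \<and> t1 < t0 \<and> F h t1 \<le> h\<^sup>2 * (M + 1) / t0)"
      then have gt: "h\<^sup>2 * (M + 1) / t0 \<le> F h t1" if "0 < t1" "t1 < t0" for t1 using that by force
      have "h\<^sup>2 * (M + 1) = (\<integral>t. indicator {0<..<t0} t * (h\<^sup>2 * (M + 1) / t0) \<partial>lborel)" using t0 by simp
      also have "\<dots> \<le> (\<integral>t. F h t \<partial>lborel)"
      proof (rule integral_mono)
        show "integrable lborel (\<lambda>t. indicator {0<..<t0} t * (h\<^sup>2 * (M + 1) / t0))"
          by (intro integrable_mult_left integrable_real_indicator) (use t0 in auto)
        show "indicator {0<..<t0} \<tau> * (h\<^sup>2 * (M + 1) / t0) \<le> F h \<tau>" for \<tau>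
          using gt[of \<tau>] F_nonneg[OF h, of \<tau>] by (simp add: indicator_def)
      qed (rule F_integral(1)[OF h])
      also have "\<dots> \<le> h\<^sup>2 * M" unfolding M_def by (rule F_integral(2)[OF h])
      finally show False using h by (simp add: distrib_left)
    qed
    then obtain t1 where t1: "0 < t1" "t1 < t0" "F h t1 \<le> h\<^sup>2 * (M + 1) / t0" by blast
    have i: "set_integrable lborel {t1..t} (E h)" and ie: "F h t + (LBINT \<tau>:{t1..t}. E h \<tau>) \<le> F h t1 + K1 * h\<^sup>2"
      using en[OF h t1(1), of t] t1 t by auto
    show i0: "set_integrable lborel {t0..t} (E h)"
      by (rule set_integrable_subset[OF i]) (use t1 in auto)
    have mono: "(LBINT \<tau>:{t0..t}. E h \<tau>) \<le> (LBINT \<tau>:{t1..t}. E h \<tau>)"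
      unfolding set_lebesgue_integral_def
      using i i0 E_nonneg[OF h] t1 by (intro integral_mono) (auto simp: set_integrable_def indicator_def)
    have pos: "0 \<le> (LBINT \<tau>:{t0..t}. E h \<tau>)"
      unfolding set_lebesgue_integral_def using E_nonneg[OF h] by (intro integral_nonneg_AE) auto
    have "K * h\<^sup>2 = h\<^sup>2 * (M + 1) / t0 + K1 * h\<^sup>2" using t0 by (simp add: K_def field_simps)
    then have "F h t1 + K1 * h\<^sup>2 \<le> K * h\<^sup>2" using t1(3) by linarith
    then show "F h t \<le> K * h\<^sup>2" "(LBINT \<tau>:{t0..t}. E h \<tau>) \<le> K * h\<^sup>2"
      using ie mono pos F_nonneg[OF h, of t] by linarith+
  qed
qed

text \<open>At a Lebesgue point the window functional is close to h times the pairing with W t.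
  Testing with W t itself and bounding the window by sqrt (F h t) \<le> sqrt K * h gives the claim
  after division by h and by the norm of W t.\<close>

lemma W_bounded:
  assumes t0: "t0 > 0"
  shows "\<exists>K. AE t in lebesgue. t0 < t \<longrightarrow> X_norm s (W t) \<le> K"
proof -
  obtain K where K: "K \<ge> 0" "\<And>h t. h > 0 \<Longrightarrow> t0 \<le> t \<Longrightarrow> F h t \<le> K * h\<^sup>2"
    using uniform_bounds[OF t0] by blast
  have "AE t in lebesgue. t0 < t \<longrightarrow> X_norm s (W t) \<le> sqrt K"
    using lebesgue_points
  proof eventually_elim
    case (elim t)
    show ?case
    proof
      assume t: "t0 < t"
      let ?n = "nrm (W t)"
      have n0: "?n \<ge> 0" by (rule nrm_nonneg[OF W_mem])
      have "?n \<le> sqrt K + \<epsilon>" if \<epsilon>: "\<epsilon> > 0" for \<epsilon>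
      proof (cases "?n = 0")
        case True
        then show ?thesis using K(1) \<epsilon> by (simp add: add_nonneg_nonneg)
      next
        case False
        obtain d where d: "d > 0" "\<And>h. 0 < h \<Longrightarrow> h < d \<Longrightarrow> (LBINT \<tau>:{t..t+h}. nrm (\<lambda>x. W \<tau> x - W t x)) \<le> \<epsilon> * h"
          using elim \<epsilon> by blast
        define h where "h = d / 2"
        have h: "0 < h" "h < d" using d(1) by (auto simp: h_def)
        have "\<bar>(LBINT \<tau>:{t..t+h}. frac_op s (W \<tau>) (W t)) - h * frac_op s (W t) (W t)\<bar> \<le> \<epsilon> * h * ?n"
          by (rule window_near_lebesgue_point[OF W_mem h(1) d(2)[OF h]])
        moreover have "\<bar>LBINT \<tau>:{t..t+h}. frac_op s (W \<tau>) (W t)\<bar> \<le> sqrt (F h t) * ?n"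
          by (rule window_bound[OF W_mem h(1)])
        moreover have "sqrt (F h t) * ?n \<le> sqrt K * h * ?n"
        proof (rule mult_right_mono[OF _ n0])
          have "sqrt (F h t) \<le> sqrt (K * h\<^sup>2)" using K(2)[OF h(1), of t] t by (intro real_sqrt_le_mono) simp
          then show "sqrt (F h t) \<le> sqrt K * h" using h by (simp add: real_sqrt_mult)
        qed
        ultimately have "h * frac_op s (W t) (W t) \<le> sqrt K * h * ?n + \<epsilon> * h * ?n" by linarith
        also have "\<dots> = h * ((sqrt K + \<epsilon>) * ?n)" by (simp add: algebra_simps)
        finally have "frac_op s (W t) (W t) \<le> (sqrt K + \<epsilon>) * ?n" using h(1) by simp
        then have "?n * ?n \<le> (sqrt K + \<epsilon>) * ?n" using nrm_sq[OF W_mem, of t] by (simp add: power2_eq_square)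
        then show ?thesis using False n0 by simp
      qed
      then have "?n \<le> sqrt K" by (rule field_le_epsilon)
      then show "X_norm s (W t) \<le> sqrt K" by (simp add: nrm_s)
    qed
  qed
  then show ?thesis by blast
qed

end

section \<open>Passage to the limit in the difference quotients\<close>

context ch_energy
begin

text \<open>L stands for the lower limit of the energies of the quotients and \<open>\<eta>\<close>
  bounds the excess of the chosen ones. Since this bound vanishes, the energy of the limit is at
  most L itself, so that Fatou's lemma can later control its integral over time.\<close>

lemma increments_limit:
  assumes t: "t > 0" and h: "\<And>j. h j > 0" "h \<longlonglongrightarrow> 0" and L: "L \<ge> 0" 
    and bd: "\<And>j. E (h j) t / (h j)\<^sup>2 \<le> L + \<eta> j" and \<eta>: "\<eta> \<longlonglongrightarrow> 0" "\<And>j. \<eta> j \<le> 1"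
    and LP: "\<forall>\<epsilon>>0. \<exists>d>0. \<forall>h. 0 < h \<and> h < d \<longrightarrow> (LBINT \<tau>:{t..t+h}. nrm (\<lambda>x. W \<tau> x - W t x)) \<le> \<epsilon> * h"
  shows "\<exists>z. T.spanned f z \<and> frac_op \<sigma> z z \<le> L \<and>
    (\<forall>k. (\<lambda>j. \<beta> (h j) k t / h j) \<longlonglongrightarrow> frac_op \<sigma> z (f k)) \<and>
    (\<forall>\<phi>\<in>X_space \<Omega> s. (LINT x|lebesgue. z x * \<phi> x) = - frac_op s (W t) \<phi>)"
proof -
  define v where "v = (\<lambda>j x. (1 / h j) * inc (h j) t x)"
  have vX: "v j \<in> X_space \<Omega> \<sigma>" for j unfolding v_def by (intro T.scale_mem inc_mem h t)
  have vsp: "T.spanned f (v j)" for j unfolding v_def by (intro T.spanned_scale f inc_spanned h t)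
  have vy: "frac_op \<sigma> (v j) y = frac_op \<sigma> (inc (h j) t) y / h j" if "y \<in> X_space \<Omega> \<sigma>" for j y
    unfolding v_def T.B_scale_left[OF inc_mem[OF h(1) t] that] by simp
  have vv: "frac_op \<sigma> (v j) (v j) = E (h j) t / (h j)\<^sup>2" for j
    unfolding v_def T.B_scale_left[OF inc_mem[OF h(1) t] T.scale_mem[OF inc_mem[OF h(1) t]]] 
      T.B_scale_right[OF inc_mem[OF h(1) t] inc_mem[OF h(1) t]]
    using t by (simp add: E_def power2_eq_square)
  have vbd: "frac_op \<sigma> (v j) (v j) \<le> L + 1" for j using bd[of j] \<eta>(2)[of j] vv[of j] by linarith
  \<comment> \<open>Uniformity over \<phi> makes this convergence in the dual norm, the form in
    which Ehrling's inequality uses it.\<close>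
  have close: "\<exists>J. \<forall>j\<ge>J. \<forall>\<phi>\<in>X_space \<Omega> s. \<bar>(LINT x|lebesgue. v j x * \<phi> x) + frac_op s (W t) \<phi>\<bar> \<le> \<epsilon> * X_norm s \<phi>"
    if \<epsilon>: "\<epsilon> > 0" for \<epsilon>
  proof -
    obtain d where d: "d > 0" "\<And>h. 0 < h \<Longrightarrow> h < d \<Longrightarrow> (LBINT \<tau>:{t..t+h}. nrm (\<lambda>x. W \<tau> x - W t x)) \<le> \<epsilon> * h"
      using LP \<epsilon> by blast
    obtain J where J: "\<And>j. j \<ge> J \<Longrightarrow> norm (h j - 0) < d" using LIMSEQ_D[OF h(2) d(1)] by blast
    have "\<bar>(LINT x|lebesgue. v j x * \<phi> x) + frac_op s (W t) \<phi>\<bar> \<le> \<epsilon> * X_norm s \<phi>" if j: "j \<ge> J" and \<phi>: "\<phi> \<in> X_space \<Omega> s" for j \<phi>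
    proof -
      let ?I = "LBINT \<tau>:{t..t+h j}. frac_op s (W \<tau>) \<phi>"
      have hj: "0 < h j" "h j < d" using h(1)[of j] J[OF j] by auto
      have "\<bar>?I - h j * frac_op s (W t) \<phi>\<bar> \<le> \<epsilon> * h j * nrm \<phi>"
        by (rule window_near_lebesgue_point[OF \<phi> hj(1) d(2)[OF hj]])
      then have "\<bar>?I - h j * frac_op s (W t) \<phi>\<bar> / h j \<le> \<epsilon> * nrm \<phi>"
        using hj(1) by (simp add: pos_divide_le_eq mult_ac)
      moreover have "(LINT x|lebesgue. v j x * \<phi> x) = - ?I / h j"
        unfolding v_def using inc_pairing[OF \<phi> hj(1) t] by (simp add: mult.assoc)
      then have "(LINT x|lebesgue. v j x * \<phi> x) + frac_op s (W t) \<phi> = - ((?I - h j * frac_op s (W t) \<phi>) / h j)"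
        using hj(1) by (simp add: field_simps)
      ultimately show ?thesis using hj(1) by (simp add: abs_divide nrm_s)
    qed
    then show ?thesis by blast
  qed
  have cauchy: "\<exists>J. \<forall>i\<ge>J. \<forall>j\<ge>J. (LINT x|lebesgue. (v i x - v j x)\<^sup>2) < \<epsilon>" if \<epsilon>: "\<epsilon> > 0" for \<epsilon>
  proof -
    \<comment> \<open>The difference of two quotients has energy at most 4 (L + 1), so with this
      parameter the energy term contributes at most \<epsilon> / 2. The \<delta> below keeps the
      dual term, where A = 2 \<delta>, under \<epsilon> / 2.\<close>
    have "\<epsilon> / (8 * (L + 1)) > 0" using \<epsilon> L by simp
    then obtain C0 where C0: "C0 \<ge> 0"
      "\<And>v A. v \<in> X_space \<Omega> \<sigma> \<Longrightarrow> A \<ge> 0 \<Longrightarrow>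
        (\<And>\<phi>. \<phi> \<in> X_space \<Omega> s \<Longrightarrow> \<bar>LINT x|lebesgue. v x * \<phi> x\<bar> \<le> A * X_norm s \<phi>) \<Longrightarrow>
        (LINT x|lebesgue. (v x)\<^sup>2) \<le> \<epsilon> / (8 * (L + 1)) * frac_op \<sigma> v v + C0 * A\<^sup>2"
      using ehrling[OF \<Omega> s \<sigma>] by blast
    define \<delta> where "\<delta> = sqrt (\<epsilon> / (8 * (C0 + 1)))"
    have \<delta>: "\<delta> > 0" "\<delta>\<^sup>2 = \<epsilon> / (8 * (C0 + 1))" using \<epsilon> C0(1) by (auto simp: \<delta>_def)
    obtain J where J: "\<And>j \<phi>. j \<ge> J \<Longrightarrow> \<phi> \<in> X_space \<Omega> s \<Longrightarrow> \<bar>(LINT x|lebesgue. v j x * \<phi> x) + frac_op s (W t) \<phi>\<bar> \<le> \<delta> * X_norm s \<phi>"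
      using close[OF \<delta>(1)] by blast
    have "(LINT x|lebesgue. (v i x - v j x)\<^sup>2) < \<epsilon>" if i: "i \<ge> J" and j: "j \<ge> J" for i j
    proof -
      have a1: "(LINT x|lebesgue. (v i x - v j x)\<^sup>2) 
          \<le> \<epsilon> / (8 * (L + 1)) * frac_op \<sigma> (\<lambda>x. v i x - v j x) (\<lambda>x. v i x - v j x) + C0 * (2 * \<delta>)\<^sup>2"
      proof (rule C0(2)[OF T.diff_mem[OF vX vX]])
        fix \<phi> assume \<phi>: "\<phi> \<in> X_space \<Omega> s"
        have "(LINT x|lebesgue. (v i x - v j x) * \<phi> x) = (LINT x|lebesgue. v i x * \<phi> x) - (LINT x|lebesgue. v j x * \<phi> x)"
          unfolding left_diff_distrib
          by (intro Bochner_Integration.integral_diff sq_int_mult X_sq_int[OF vX] X_sq_int[OF \<phi>])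
        then show "\<bar>LINT x|lebesgue. (v i x - v j x) * \<phi> x\<bar> \<le> 2 * \<delta> * X_norm s \<phi>"
          using J[OF i \<phi>] J[OF j \<phi>] by linarith
      qed (use \<delta> in simp)
      have a2: "frac_op \<sigma> (\<lambda>x. v i x - v j x) (\<lambda>x. v i x - v j x) \<le> 4 * (L + 1)"
      proof -
        \<comment> \<open>Nonnegativity of the energy of v i + v j bounds the mixed term from below,
          as in the parallelogram law.\<close>
        have pos: "0 \<le> frac_op \<sigma> (v i) (v i) + 2 * frac_op \<sigma> (v i) (v j) + frac_op \<sigma> (v j) (v j)"
          unfolding T.B_add_self[OF vX vX, symmetric] by (rule T.B_nonneg[OF T.add_mem[OF vX vX]])
        have gen: "a - 2 * b + d \<le> 4 * M" if "0 \<le> a + 2 * b + d" "a \<le> M" "d \<le> M" for a b d M :: real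
          using that by linarith
        show ?thesis unfolding T.B_diff_self[OF vX vX] by (rule gen[OF pos vbd vbd])
      qed
      have "\<epsilon> / (8 * (L + 1)) * frac_op \<sigma> (\<lambda>x. v i x - v j x) (\<lambda>x. v i x - v j x) \<le> \<epsilon> / (8 * (L + 1)) * (4 * (L + 1))"
        by (rule mult_left_mono[OF a2]) (use \<epsilon> L in simp)
      also have "\<dots> = \<epsilon> / 2"
      proof -
        have "\<epsilon> / (8 * M) * (4 * M) = \<epsilon> / 2" if "M \<noteq> 0" for M :: real using that by simp
        then show ?thesis using L by (metis add_nonneg_pos less_irrefl zero_less_one)
      qed
      finally have "(LINT x|lebesgue. (v i x - v j x)\<^sup>2) \<le> \<epsilon> / 2 + C0 * (2 * \<delta>)\<^sup>2"
        by (intro order_trans[OF a1] add_right_mono)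
      also have "C0 * (2 * \<delta>)\<^sup>2 < \<epsilon> / 2"
      proof -
        have "C0 * (2 * \<delta>)\<^sup>2 = C0 / (C0 + 1) * (\<epsilon> / 2)" using C0(1) by (simp add: power_mult_distrib \<delta>(2) field_simps)
        also have "\<dots> < 1 * (\<epsilon> / 2)" using C0(1) \<epsilon> by (intro mult_strict_right_mono) auto
        finally show ?thesis by simp
      qed
      finally show ?thesis by simp
    qed
    then show ?thesis by blast
  qed
  obtain z where z: "z \<in> X_space \<Omega> \<sigma>" "(\<lambda>n. LINT x|lebesgue. (v n x - z x)\<^sup>2) \<longlonglongrightarrow> 0"
    "\<And>y. y \<in> X_space \<Omega> \<sigma> \<Longrightarrow> (\<lambda>n. frac_op \<sigma> (v n) y) \<longlonglongrightarrow> frac_op \<sigma> z y"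
    using X_space_L2_limit[OF \<sigma> vX vbd cauchy] by blast
  have "T.spanned f z"
    by (rule T.spanned_weak_limit[OF f(1) z(1) vsp _ z(3), of "sqrt (L + 1)"]) 
       (use vbd in \<open>auto simp: T.nrm_def intro: real_sqrt_le_mono\<close>)
  \<comment> \<open>Weak lower semicontinuity of the norm, obtained by pairing the quotients with z
    itself.\<close>
  moreover have "frac_op \<sigma> z z \<le> L"
  proof -
    let ?n = "T.nrm z"
    have "(\<lambda>j. sqrt (L + \<eta> j) * ?n) \<longlonglongrightarrow> sqrt (L + 0) * ?n" by (intro tendsto_intros \<eta>)
    moreover have "frac_op \<sigma> (v j) z \<le> sqrt (L + \<eta> j) * ?n" for j
    proof -
      have "T.nrm (v j) \<le> sqrt (L + \<eta> j)" using bd[of j] by (simp add: T.nrm_def vv)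
      from mult_right_mono[OF this T.nrm_nonneg[OF z(1)]] show ?thesis
        using T.cauchy_schwarz[OF vX z(1), of j] by linarith
    qed
    ultimately have "frac_op \<sigma> z z \<le> sqrt (L + 0) * ?n"
      using LIMSEQ_le[OF z(3)[OF z(1)]] by blast
    then have le: "?n * ?n \<le> sqrt L * ?n" using T.nrm_sq[OF z(1)] by (simp add: power2_eq_square)
    have n0: "?n \<ge> 0" by (rule T.nrm_nonneg[OF z(1)])
    have "?n \<le> sqrt L" using le n0 L by (cases "?n = 0") auto
    then have "?n\<^sup>2 \<le> (sqrt L)\<^sup>2" using n0 by (rule power_mono)
    then show ?thesis using L T.nrm_sq[OF z(1)] by simp
  qed
  moreover have "(\<lambda>j. \<beta> (h j) k t / h j) \<longlonglongrightarrow> frac_op \<sigma> z (f k)" for k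
    using z(3)[OF T.orthosys_mem[OF f(1)], of k] t by (simp add: vy[OF T.orthosys_mem[OF f(1)]] \<beta>_def)
  moreover have "(LINT x|lebesgue. z x * \<phi> x) = - frac_op s (W t) \<phi>" if \<phi>: "\<phi> \<in> X_space \<Omega> s" for \<phi>
  proof (rule LIMSEQ_unique)
    note zs = X_sq_int[OF z(1)] and \<phi>s = X_sq_int[OF \<phi>]
    have "(\<lambda>j. (LINT x|lebesgue. v j x * \<phi> x) - (LINT x|lebesgue. z x * \<phi> x)) \<longlonglongrightarrow> 0"
    proof (rule Lim_null_comparison)
      show "(\<lambda>j. sqrt (LINT x|lebesgue. (v j x - z x)\<^sup>2) * sqrt (LINT x|lebesgue. (\<phi> x)\<^sup>2)) \<longlonglongrightarrow> 0"
        using tendsto_mult_left_zero[OF tendsto_real_sqrt[OF z(2), simplified]] by simp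
      have "(LINT x|lebesgue. v j x * \<phi> x) - (LINT x|lebesgue. z x * \<phi> x) = (LINT x|lebesgue. (v j x - z x) * \<phi> x)" for j
        unfolding left_diff_distrib
        by (intro Bochner_Integration.integral_diff[symmetric] sq_int_mult X_sq_int[OF vX] zs \<phi>s)
      then show "\<forall>\<^sub>F j in sequentially. norm ((LINT x|lebesgue. v j x * \<phi> x) - (LINT x|lebesgue. z x * \<phi> x))
          \<le> sqrt (LINT x|lebesgue. (v j x - z x)\<^sup>2) * sqrt (LINT x|lebesgue. (\<phi> x)\<^sup>2)"
        using sq_int_cauchy_schwarz[OF sq_int_diff[OF X_sq_int[OF vX] zs] \<phi>s] by simp
    qed
    then show "(\<lambda>j. LINT x|lebesgue. v j x * \<phi> x) \<longlonglongrightarrow> (LINT x|lebesgue. z x * \<phi> x)" by (simp add: LIM_zero_iff)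
    show "(\<lambda>j. LINT x|lebesgue. v j x * \<phi> x) \<longlonglongrightarrow> - frac_op s (W t) \<phi>"
      unfolding LIMSEQ_iff
    proof (intro allI impI)
      fix \<epsilon> :: real assume \<epsilon>: "\<epsilon> > 0"
      have n0: "X_norm s \<phi> \<ge> 0" using nrm_nonneg[OF \<phi>] by (simp add: nrm_s)
      have "\<epsilon> / (X_norm s \<phi> + 1) > 0" using \<epsilon> n0 by simp
      from close[OF this] obtain J where J: "\<And>j. j \<ge> J \<Longrightarrow> \<bar>(LINT x|lebesgue. v j x * \<phi> x) + frac_op s (W t) \<phi>\<bar> \<le> \<epsilon> / (X_norm s \<phi> + 1) * X_norm s \<phi>"
        using \<phi> by blast
      have "\<epsilon> / (X_norm s \<phi> + 1) * X_norm s \<phi> < \<epsilon>" using \<epsilon> n0 by (simp add: field_simps)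
      then show "\<exists>J. \<forall>j\<ge>J. norm ((LINT x|lebesgue. v j x * \<phi> x) - - frac_op s (W t) \<phi>) < \<epsilon>"
        using J by (intro exI[of _ J]) force
    qed
  qed
  ultimately show ?thesis by blast
qed

text \<open>A good sequence of quotients depends on t, so its indices \<open>kk j t\<close> are
  least witnesses of Borel conditions, which makes the limiting coordinates \<open>cc\<close>
  measurable. The limit z t is picked by \<open>SOME\<close>, but its coordinates are prescribed, so
  \<open>strongly_measurable_if_coefficients\<close> applies. Fatou bounds the integral of the lower
  limit \<open>l\<close>, and with it that of the squared norm of z.\<close>

lemma velocity_in_X:
  assumes t0: "t0 > 0"
  shows "\<exists>z\<in>bochner_Lp 2 {t0<..} (X_space \<Omega> \<sigma>) (X_norm \<sigma>).
    AE t in lebesgue. t0 < t \<longrightarrow> (\<forall>\<phi>\<in>X_space \<Omega> s. - frac_op s (W t) \<phi> = L2_pairing \<Omega> (z t) \<phi>)"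
proof -
  obtain K where K: "K \<ge> 0" "\<And>h t. h > 0 \<Longrightarrow> t0 \<le> t \<Longrightarrow> set_integrable lborel {t0..t} (E h)"
    "\<And>h t. h > 0 \<Longrightarrow> t0 \<le> t \<Longrightarrow> (LBINT \<tau>:{t0..t}. E h \<tau>) \<le> K * h\<^sup>2"
    using uniform_bounds[OF t0] by blast
  define hs where "hs = (\<lambda>n. 1 / real (Suc n))"
  have hs: "hs n > 0" for n by (simp add: hs_def)
  \<comment> \<open>The energy bounds concern bounded intervals. The cut-off at t0 + n moves to
    infinity, so each t beyond t0 is eventually seen by the lower limit, while the integral of G n
    stays at most K.\<close>
  define G where "G = (\<lambda>n t. indicator {t0..t0 + real n} t * (E (hs n) t / (hs n)\<^sup>2))"
  have Gm[measurable]: "G n \<in> borel_measurable borel" for n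
    unfolding G_def using E_borel[OF hs, of n] by measurable
  have G0: "G n t \<ge> 0" for n t using E_nonneg[OF hs, of n t] by (simp add: G_def)
  define l where "l = (\<lambda>t. liminf (\<lambda>n. ennreal (G n t)))"
  have lm[measurable]: "l \<in> borel_measurable borel" unfolding l_def by measurable
  have Gint: "(\<integral>\<^sup>+t. ennreal (G n t) \<partial>lborel) \<le> ennreal K" for n
  proof -
    have e: "G n t = (indicator {t0..t0 + real n} t * E (hs n) t) / (hs n)\<^sup>2" for t by (simp add: G_def)
    have i: "integrable lborel (\<lambda>t. indicator {t0..t0 + real n} t * E (hs n) t)"
      using K(2)[OF hs, of "t0 + real n" n] by (simp add: set_integrable_def)
    then have iG: "integrable lborel (G n)" unfolding e[abs_def] by simp
    have "(\<integral>t. G n t \<partial>lborel) = (LBINT \<tau>:{t0..t0 + real n}. E (hs n) \<tau>) / (hs n)\<^sup>2"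
      unfolding e by (simp add: set_lebesgue_integral_def)
    also have "\<dots> \<le> K" using K(3)[OF hs, of "t0 + real n" n] hs[of n] by (simp add: pos_divide_le_eq)
    finally show ?thesis using G0 by (simp add: nn_integral_eq_integral[OF iG] ennreal_leI)
  qed
  have lint: "(\<integral>\<^sup>+t. l t \<partial>lborel) \<le> ennreal K"
  proof -
    have "(\<integral>\<^sup>+t. l t \<partial>lborel) \<le> liminf (\<lambda>n. \<integral>\<^sup>+t. ennreal (G n t) \<partial>lborel)"
      unfolding l_def by (rule nn_integral_liminf) measurable
    also have "\<dots> \<le> ennreal K" by (rule Liminf_le) (use Gint in auto)
    finally show ?thesis .
  qed
  have lfin: "AE t in lebesgue. l t \<noteq> \<infinity>"
  proof (rule AE_completion)
    have "(\<integral>\<^sup>+t. l t \<partial>lborel) \<noteq> \<infinity>" using lint by (auto simp: top_unique)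
    then show "AE t in lborel. l t \<noteq> \<infinity>" by (intro nn_integral_PInf_AE) auto
  qed
  \<comment> \<open>The first condition sends the step sizes to 0, the second excludes indices at
    which the cut-off makes G vanish, and the third picks energies close to their lower
    limit.\<close>
  define P where "P = (\<lambda>j t k. j \<le> k \<and> t \<le> t0 + real k \<and> ennreal (G k t) \<le> l t + ennreal (1 / real (Suc j)))"
  define kk where "kk = (\<lambda>j t. LEAST k. P j t k)"
  have kkm[measurable]: "kk j \<in> measurable borel (count_space UNIV)" for j
    unfolding kk_def P_def by measurable
  define cc where "cc = (\<lambda>k t. lim (\<lambda>j. \<beta> (hs (kk j t)) k t / hs (kk j t)))"
  have ccm[measurable]: "cc k \<in> borel_measurable borel" for k
  proof -
    have "(\<lambda>t. \<beta> (hs (kk j t)) k t / hs (kk j t)) \<in> borel_measurable borel" for j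
      by (rule measurable_compose_countable[of "\<lambda>n t. \<beta> (hs n) k t / hs n" borel borel "kk j"])
         (use \<beta>_borel[OF hs] in measurable)
    then show ?thesis unfolding cc_def by measurable
  qed
  define good where "good = (\<lambda>t z. T.spanned f z \<and> (\<forall>k. frac_op \<sigma> z (f k) = cc k t) \<and> ennreal (frac_op \<sigma> z z) \<le> l t \<and>
     (\<forall>\<phi>\<in>X_space \<Omega> s. (LINT x|lebesgue. z x * \<phi> x) = - frac_op s (W t) \<phi>))"
  have ae: "AE t in lebesgue. t0 < t \<longrightarrow> (\<exists>z. good t z)"
    using lfin lebesgue_points
  proof eventually_elim
    case (elim t)
    show ?case
    proof
      assume t: "t0 < t"
      define L where "L = enn2real (l t)"
      have L: "L \<ge> 0" "l t = ennreal L" using elim(1) by (simp_all add: L_def less_top)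
      \<comment> \<open>If no index qualified, G would eventually stay at least 1/(j+1) above its
        finite lower limit.\<close>
      have "\<exists>k. P j t k" for j
      proof (rule ccontr)
        assume n: "\<nexists>k. P j t k"
        obtain k0 :: nat where k0: "t - t0 \<le> real k0" using real_arch_simple by blast
        have "\<forall>\<^sub>F k in sequentially. l t + ennreal (1 / real (Suc j)) \<le> ennreal (G k t)"
          using eventually_ge_at_top[of "max j k0"]
        proof eventually_elim
          case (elim k)
          then have "real k0 \<le> real k" by simp
          then have "t \<le> t0 + real k" using k0 by linarith
          moreover have "j \<le> k" using elim by simp
          ultimately show ?case using n unfolding P_def by (meson linear)
        qed
        then have "l t + ennreal (1 / real (Suc j)) \<le> l t" unfolding l_def by (rule Liminf_bounded)
        then have "ennreal (L + 1 / real (Suc j)) \<le> ennreal L" unfolding L(2) using L(1) by (simp add: ennreal_plus)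
        then show False using L(1) by (simp add: ennreal_le_iff)
      qed
      then have "P j t (kk j t)" for j unfolding kk_def by (rule LeastI_ex)
      then have kP: "j \<le> kk j t" "t \<le> t0 + real (kk j t)" "ennreal (G (kk j t) t) \<le> ennreal L + ennreal (1 / real (Suc j))" for j
        unfolding P_def L(2) by auto
      let ?h = "\<lambda>j. hs (kk j t)" and ?\<eta> = "\<lambda>j. 1 / real (Suc j)"
      have \<eta>0: "?\<eta> \<longlonglongrightarrow> 0" by (rule LIMSEQ_Suc[OF lim_1_over_n])
      have h0: "?h \<longlonglongrightarrow> 0"
      proof (rule tendsto_sandwich[OF _ _ tendsto_const \<eta>0])
        show "\<forall>\<^sub>F j in sequentially. 0 \<le> ?h j" using hs by (simp add: less_imp_le)
        show "\<forall>\<^sub>F j in sequentially. ?h j \<le> ?\<eta> j"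
          unfolding hs_def using kP(1) by (intro always_eventually allI frac_le) auto
      qed
      have bd: "E (?h j) t / (?h j)\<^sup>2 \<le> L + ?\<eta> j" for j
      proof -
        have "G (kk j t) t = E (?h j) t / (?h j)\<^sup>2" using t kP(2)[of j] by (simp add: G_def)
        moreover have "ennreal (G (kk j t) t) \<le> ennreal (L + ?\<eta> j)"
          using kP(3)[of j] L(1) by (subst ennreal_plus) auto
        then have "G (kk j t) t \<le> L + ?\<eta> j" using L(1) by (subst (asm) ennreal_le_iff) auto
        ultimately show ?thesis by simp
      qed
      have "t > 0" using t t0 by simp
      from increments_limit[OF this hs h0 L(1) bd \<eta>0 _ elim(2)]
      obtain z where z: "T.spanned f z" "frac_op \<sigma> z z \<le> L" "\<And>k. (\<lambda>j. \<beta> (?h j) k t / ?h j) \<longlonglongrightarrow> frac_op \<sigma> z (f k)"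
        "\<And>\<phi>. \<phi>\<in>X_space \<Omega> s \<Longrightarrow> (LINT x|lebesgue. z x * \<phi> x) = - frac_op s (W t) \<phi>"
        by auto
      have "good t z"
        unfolding good_def L(2) cc_def using z limI[OF z(3)] by (auto intro: ennreal_leI)
      then show "\<exists>z. good t z" by blast
    qed
  qed
  define z where "z = (\<lambda>t. SOME z. good t z)"
  have gz: "AE t in lebesgue. t0 < t \<longrightarrow> good t (z t)"
    using ae
  proof eventually_elim
    case (elim t)
    then show ?case unfolding z_def using someI_ex[of "good t"] by blast
  qed
  have sm: "strongly_measurable_on {t0<..} (X_space \<Omega> \<sigma>) (X_norm \<sigma>) z"
    unfolding nrm_\<sigma>[symmetric]
  proof (rule T.strongly_measurable_if_coefficients[OF f(1)])
    show "cc k \<in> borel_measurable lebesgue" for k by (simp add: measurable_completion)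
    show "AE t in lebesgue. t \<in> {t0<..} \<longrightarrow> T.spanned f (z t) \<and> (\<forall>k. frac_op \<sigma> (z t) (f k) = cc k t)"
      using gz by eventually_elim (auto simp: good_def)
  qed simp
  let ?N = "\<lambda>t. indicator {t0<..} t *\<^sub>R (X_norm \<sigma> (z t))\<^sup>2"
  \<comment> \<open>The squared norm agrees almost everywhere with a Borel series of squared
    coordinates, which settles its measurability.\<close>
  have Neq: "AE t in lebesgue. indicator {t0<..} t * (\<Sum>k. (cc k t)\<^sup>2) = ?N t \<and> ennreal (?N t) \<le> l t"
    using gz
  proof eventually_elim
    case (elim t)
    show ?case
    proof (cases "t0 < t")
      case True
      then have g: "good t (z t)" using elim by blast
      then have zX: "z t \<in> X_space \<Omega> \<sigma>" by (simp add: good_def T.spanned_def)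
      have "(\<Sum>k. (cc k t)\<^sup>2) = frac_op \<sigma> (z t) (z t)"
      proof -
        have c: "frac_op \<sigma> (z t) (f k) = cc k t" for k using g by (simp add: good_def)
        have "(\<lambda>k. (frac_op \<sigma> (z t) (f k))\<^sup>2) sums frac_op \<sigma> (z t) (z t)"
          using g unfolding good_def T.spanned_def by blast
        then show ?thesis unfolding c by (rule sums_unique[symmetric])
      qed
      moreover have "(X_norm \<sigma> (z t))\<^sup>2 = frac_op \<sigma> (z t) (z t)" using T.nrm_sq[OF zX] by (simp add: nrm_\<sigma>)
      ultimately show ?thesis using g True by (simp add: good_def)
    qed simp
  qed
  have "integrable lebesgue ?N"
  proof (rule integrableI_bounded)
    show "?N \<in> borel_measurable lebesgue"
    proof (rule borel_measurable_AE)
      show "(\<lambda>t. indicator {t0<..} t * (\<Sum>k. (cc k t)\<^sup>2)) \<in> borel_measurable lebesgue"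
        by (intro measurable_completion) measurable
      show "AE t in lebesgue. indicator {t0<..} t * (\<Sum>k. (cc k t)\<^sup>2) = ?N t"
        using Neq by eventually_elim blast
    qed
    have "(\<integral>\<^sup>+t. ennreal (norm (?N t)) \<partial>lebesgue) \<le> (\<integral>\<^sup>+t. l t \<partial>lebesgue)"
    proof (rule nn_integral_mono_AE)
      show "AE t in lebesgue. ennreal (norm (?N t)) \<le> l t"
        using Neq by eventually_elim (simp add: indicator_def)
    qed
    also have "\<dots> = (\<integral>\<^sup>+t. l t \<partial>lborel)" by (rule nn_integral_completion)
    also have "\<dots> < \<infinity>" using lint by (auto intro: le_less_trans)
    finally show "(\<integral>\<^sup>+t. ennreal (norm (?N t)) \<partial>lebesgue) < \<infinity>" .
  qed
  then have "z \<in> bochner_Lp 2 {t0<..} (X_space \<Omega> \<sigma>) (X_norm \<sigma>)"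
    using sm by (simp add: bochner_Lp_def set_integrable_def)
  moreover have "AE t in lebesgue. t0 < t \<longrightarrow> (\<forall>\<phi>\<in>X_space \<Omega> s. - frac_op s (W t) \<phi> = L2_pairing \<Omega> (z t) \<phi>)"
    using gz
  proof eventually_elim
    case (elim t)
    show ?case
    proof (intro impI ballI)
      fix \<phi> assume t: "t0 < t" and \<phi>: "\<phi> \<in> X_space \<Omega> s"
      then have g: "good t (z t)" using elim by blast
      then have "z t \<in> X_space \<Omega> \<sigma>" by (simp add: good_def T.spanned_def)
      then have "z t \<in> borel_measurable lebesgue" using X_sq_int by (auto simp: sq_int_def)
      then have "L2_pairing \<Omega> (z t) \<phi> = (LINT x|lebesgue. z t x * \<phi> x)"
        using \<Omega>(2) by (intro L2_pairing_eq X_space_L2[OF \<phi>]) auto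
      then show "- frac_op s (W t) \<phi> = L2_pairing \<Omega> (z t) \<phi>" using g \<phi> by (simp add: good_def)
    qed
  qed
  ultimately show ?thesis by blast
qed

end

section \<open>From the weak formulation to the energy framework\<close>

lemma strongly_measurable_on_subset:
  assumes "strongly_measurable_on I X nrm f" "J \<subseteq> I" "J \<in> sets lebesgue"
  shows "strongly_measurable_on J X nrm f"
proof -
  obtain q :: "nat \<Rightarrow> real \<Rightarrow> _" where q: "\<And>n. finite (q n ` I)" "\<And>n. q n ` I \<subseteq> X" "\<And>n y. {t \<in> I. q n t = y} \<in> sets lebesgue"
    and ae: "AE t in lebesgue. t \<in> I \<longrightarrow> f t \<in> X \<and> (\<lambda>n. nrm (\<lambda>x. f t x - q n t x)) \<longlonglongrightarrow> 0"
    using assms(1) unfolding strongly_measurable_on_def by blast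
  show ?thesis
    unfolding strongly_measurable_on_def
  proof (intro exI[of _ q] conjI allI)
    fix n y
    show "finite (q n ` J)" using q(1)[of n] assms(2) by (meson finite_subset image_mono)
    show "q n ` J \<subseteq> X" using q(2)[of n] assms(2) by blast
    have "{t \<in> J. q n t = y} = J \<inter> {t \<in> I. q n t = y}" using assms(2) by auto
    then show "{t \<in> J. q n t = y} \<in> sets lebesgue" using sets.Int[OF assms(3) q(3)[of n y]] by simp
    show "AE t in lebesgue. t \<in> J \<longrightarrow> f t \<in> X \<and> (\<lambda>n. nrm (\<lambda>x. f t x - q n t x)) \<longlonglongrightarrow> 0"
      using ae by eventually_elim (use assms(2) in blast)
  qed
qed

text \<open>By Cauchy-Schwarz and Poincare. Its purpose is to make the L^2 pairing of u t with a
  fixed v continuous in t, since weak continuity of u concerns the functionals in the dual.\<close>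

lemma L2_pairing_in_X_dual:
  fixes \<Omega> :: "'a::euclidean_space set"
  assumes \<Omega>: "bounded \<Omega>" "open \<Omega>" and a: "0 < a" "a < 1" and v: "v \<in> L2_space \<Omega>"
  shows "(\<lambda>w. L2_pairing \<Omega> w v) \<in> X_dual \<Omega> a"
proof -
  obtain P where P: "P \<ge> 0" "\<And>w. w \<in> X_space \<Omega> a \<Longrightarrow> (LINT x|lebesgue. (w x)\<^sup>2) \<le> P * frac_op a w w"
    using poincare[OF \<Omega>(1) a] by blast
  interpret S: semi_inner_space "X_space \<Omega> a" "frac_op a" by (rule semi_inner_space_X[OF a])
  have vs: "sq_int lebesgue v" by (rule L2_space_sq_int[OF v])
  have ws: "sq_int lebesgue w" if "w \<in> X_space \<Omega> a" for w using that by (simp add: X_space_iff)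
  have eq: "L2_pairing \<Omega> w v = (LINT x|lebesgue. w x * v x)" if "w \<in> X_space \<Omega> a" for w
    using ws[OF that] \<Omega>(2) by (intro L2_pairing_eq v) (auto simp: sq_int_def)
  show ?thesis
    unfolding dual_space_def
  proof (intro CollectI conjI ballI allI exI[of _ "sqrt P * sqrt (LINT x|lebesgue. (v x)\<^sup>2)"])
    fix w1 w2 assume w: "w1 \<in> X_space \<Omega> a" "w2 \<in> X_space \<Omega> a"
    show "L2_pairing \<Omega> (\<lambda>x. w1 x + w2 x) v = L2_pairing \<Omega> w1 v + L2_pairing \<Omega> w2 v"
      using sq_int_mult[OF ws[OF w(1)] vs] sq_int_mult[OF ws[OF w(2)] vs]
      by (simp add: eq w S.add_mem distrib_right)
  next
    fix k w assume w: "w \<in> X_space \<Omega> a"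
    show "L2_pairing \<Omega> (\<lambda>x. k * w x) v = k * L2_pairing \<Omega> w v"
      by (simp add: eq w S.scale_mem mult.assoc)
  next
    fix w assume w: "w \<in> X_space \<Omega> a"
    have "\<bar>L2_pairing \<Omega> w v\<bar> \<le> sqrt (LINT x|lebesgue. (w x)\<^sup>2) * sqrt (LINT x|lebesgue. (v x)\<^sup>2)"
      unfolding eq[OF w] by (rule sq_int_cauchy_schwarz[OF ws[OF w] vs])
    also have "\<dots> \<le> (sqrt P * X_norm a w) * sqrt (LINT x|lebesgue. (v x)\<^sup>2)"
      unfolding X_norm_def real_sqrt_mult[symmetric] using P(2)[OF w] by (intro mult_right_mono real_sqrt_le_mono) auto
    finally show "\<bar>L2_pairing \<Omega> w v\<bar> \<le> sqrt P * sqrt (LINT x|lebesgue. (v x)\<^sup>2) * X_norm a w"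
      by (simp add: mult_ac)
  qed
qed

theorem theorem2:
  fixes \<Omega> :: "'a::euclidean_space set"
    and s \<sigma> lam \<kappa> :: real
    and g g' \<beta>hat :: "real \<Rightarrow> real"
    and u\<^sub>0 :: "'a \<Rightarrow> real"
    and u w :: "real \<Rightarrow> 'a \<Rightarrow> real"
  assumes "smooth_bounded_domain \<Omega>"
    and "0 < s" "s < 1" "0 < \<sigma>" "\<sigma> < 1"
    and "\<And>r. (g has_real_derivative g' r) (at r)"
    and "continuous_on UNIV g'"
    and "g 0 = 0"
    and "lam \<ge> 0"
    and "\<And>r. g' r \<ge> - lam"
    and "\<kappa> > 0"
    and "Liminf at_infinity
           (\<lambda>r. ereal (g r * r + (first_eigenvalue \<Omega> \<sigma> - \<kappa>) * r\<^sup>2)) > 0"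
    and "\<And>r. (\<beta>hat has_real_derivative (g r + lam * r)) (at r)"
    and "u\<^sub>0 \<in> X_space \<Omega> \<sigma>"
    and "set_integrable lebesgue \<Omega> (\<lambda>x. \<beta>hat (u\<^sub>0 x))"
    and "weak_solution \<Omega> s \<sigma> g 0 \<infinity> u w"
    and "AE x in lebesgue. u 0 x = u\<^sub>0 x"
  shows "\<exists>u'. has_weak_time_derivative \<Omega> s (time_interval 0 \<infinity>) u u' \<and>
           (\<forall>t\<^sub>0>0.
              dual_valued_in_Lp_X 2 (time_interval t\<^sub>0 \<infinity>) \<Omega> s \<sigma> u' \<and>
              u' \<in> bochner_Linfty (time_interval t\<^sub>0 \<infinity>) (X_dual \<Omega> s) (X_dual_norm \<Omega> s) \<and>
              w \<in> bochner_Linfty (time_interval t\<^sub>0 \<infinity>) (X_space \<Omega> s) (X_norm s))"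
proof -
  note s = assms(2,3) and \<sigma> = assms(4,5)
  have \<Omega>: "bounded \<Omega>" "open \<Omega>" using assms(1) by (auto simp: smooth_bounded_domain_def)
  then have \<Omega>s: "\<Omega> \<in> sets lebesgue" by simp
  have I: "time_interval t \<infinity> = {t<..}" for t by (auto simp: time_interval_def)
  have wc: "weakly_continuous 0 \<infinity> (X_space \<Omega> \<sigma>) (X_norm \<sigma>) u"
    and wL: "w \<in> bochner_Lp 2 {0<..} (X_space \<Omega> s) (X_norm s)"
    and gL: "(\<lambda>t x. g (u t x)) \<in> bochner_Lp_loc 2 0 \<infinity> (L2_space \<Omega>) (L2_norm \<Omega>)"
    using assms(16) by (auto simp: weak_solution_def I)
  obtain u' where u': "has_weak_time_derivative \<Omega> s {0<..} u u'"
    "u' \<in> bochner_Lp 2 {0<..} (X_dual \<Omega> s) (X_dual_norm \<Omega> s)"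
    and eqs: "AE t in lebesgue. t \<in> {0<..} \<longrightarrow>
           (\<forall>v\<in>X_space \<Omega> s. u' t v + frac_op s (w t) v = 0) \<and>
           (\<forall>v\<in>X_space \<Omega> \<sigma>. L2_pairing \<Omega> (w t) v =
              frac_op \<sigma> (u t) v + L2_pairing \<Omega> (\<lambda>x. g (u t x)) v)"
    using assms(16) unfolding weak_solution_def I by blast
  have uX: "u t \<in> X_space \<Omega> \<sigma>" if "t \<ge> 0" for t using wc that by (simp add: weakly_continuous_def)
  have u_weak: "continuous_on {0..} (\<lambda>t. l (u t))" if "l \<in> X_dual \<Omega> \<sigma>" for l
    using wc that by (simp add: weakly_continuous_def atLeast_def)
  interpret S: semi_inner_space "X_space \<Omega> s" "frac_op s" by (rule semi_inner_space_X[OF s])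
  have nrm_s: "S.nrm = X_norm s" by (rule nrm_X[OF s])
  have wL': "w \<in> bochner_Lp 2 {0<..} (X_space \<Omega> s) S.nrm" using wL unfolding nrm_s .
  \<comment> \<open>From here on w is replaced by W, equal to it at almost every positive time,
    whose coordinates are Borel at every time.\<close>
  obtain e c N W D where curve: "spanned_curve (X_space \<Omega> s) (frac_op s) c N e W D"
    and Ww: "AE t in lebesgue. t \<in> {0<..} \<longrightarrow> W t = w t"
  proof (rule S.curve_coordinates[OF wL'])
    show "{0::real<..} \<in> sets borel" by simp
  qed (rule that)
  interpret V: spanned_curve "X_space \<Omega> s" "frac_op s" c N e W D by (rule curve)
  have u'W: "AE t in lebesgue. 0 < t \<longrightarrow> (\<forall>v\<in>X_space \<Omega> s. u' t v = - frac_op s (W t) v)"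
    using eqs Ww by eventually_elim (auto simp: add_eq_0_iff)
  have g_mono: "- lam * (x - y)\<^sup>2 \<le> (g x - g y) * (x - y)" for x y
  proof -
    have *: "- lam * (x - y)\<^sup>2 \<le> (g x - g y) * (x - y)" if yx: "y < x" for x y
    proof -
      obtain r where "g x - g y = (x - y) * g' r" using MVT2[OF yx, of g g'] assms(6) by blast
      moreover have "- lam * (x - y)\<^sup>2 \<le> g' r * (x - y)\<^sup>2" using assms(10)[of r] by (intro mult_right_mono) auto
      ultimately show ?thesis by (simp add: power2_eq_square mult_ac)
    qed
    show ?thesis
    proof (cases x y rule: linorder_cases)
      case less
      then show ?thesis using *[OF less] by (simp add: power2_commute[of y x] algebra_simps)
    qed (use * in auto)
  qed
  have evolution: "(LINT x|lebesgue. u t2 x * v x) - (LINT x|lebesgue. u t1 x * v x) = - (LBINT \<tau>:{t1..t2}. frac_op s (W \<tau>) v)"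
    if v: "v \<in> X_space \<Omega> s" and t: "0 < t1" "t1 \<le> t2" for v t1 t2
  proof -
    note v2 = X_space_L2[OF v]
    let ?p = "\<lambda>t. - frac_op s (W t) v"
    have pm: "?p \<in> borel_measurable borel" using V.B_W_borel[OF v] by simp
    then have pmL: "?p \<in> borel_measurable lebesgue" by (simp add: measurable_completion)
    have pi: "set_integrable lborel {a..b} ?p" for a b
      using V.B_W_set_integrable[OF v, of a b] by (simp add: set_integrable_def)
    \<comment> \<open>The pairing is continuous in time, so the distributional derivative integrates
      to an identity at all positive times rather than almost all.\<close>
    have "L2_pairing \<Omega> (u t2) v - L2_pairing \<Omega> (u t1) v = (LINT t:{t1<..t2}|lebesgue. ?p t)"
    proof (rule du_bois_reymond[OF _ _ _ t])
      show "continuous_on {0<..} (\<lambda>t. L2_pairing \<Omega> (u t) v)"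
        using u_weak[OF L2_pairing_in_X_dual[OF \<Omega> \<sigma> v2]] by (rule continuous_on_subset) auto
      show "set_integrable lebesgue {a..b} ?p" for a b
        using pi[of a b] pm unfolding set_integrable_def by (subst integrable_completion) auto
      fix \<phi> assume \<phi>: "test_function {0<..} \<phi>"
      have \<phi>c: "\<phi> \<in> borel_measurable lebesgue"
      proof -
        have "Ck_on 0 \<phi> UNIV" using \<phi> by (simp only: test_function_def smooth_on_def)
        then show ?thesis by (simp add: measurable_completion borel_measurable_continuous_onI)
      qed
      have "(LINT t:{0<..}|lebesgue. deriv \<phi> t * L2_pairing \<Omega> (u t) v) = - (LINT t:{0<..}|lebesgue. \<phi> t * u' t v)"
        using u'(1) \<phi> v by (simp add: has_weak_time_derivative_def)
      also have "(LINT t:{0<..}|lebesgue. \<phi> t * u' t v) = (LINT t:{0<..}|lebesgue. \<phi> t * ?p t)"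
        unfolding set_lebesgue_integral_def
      proof (rule integral_cong_AE)
        show m: "(\<lambda>t. indicator {0<..} t *\<^sub>R (\<phi> t * ?p t)) \<in> borel_measurable lebesgue"
          by (intro borel_measurable_scaleR borel_measurable_times \<phi>c pmL borel_measurable_indicator) simp
        show ae: "AE t in lebesgue. indicator {0<..} t *\<^sub>R (\<phi> t * u' t v) = indicator {0<..} t *\<^sub>R (\<phi> t * ?p t)"
          using u'W by eventually_elim (use v in \<open>auto simp: indicator_def\<close>)
        show "(\<lambda>t. indicator {0<..} t *\<^sub>R (\<phi> t * u' t v)) \<in> borel_measurable lebesgue"
          by (rule borel_measurable_AE[OF m]) (use ae in eventually_elim, simp)
      qed
      finally show "(LINT t:{0<..}|lebesgue. deriv \<phi> t * L2_pairing \<Omega> (u t) v) = - (LINT t:{0<..}|lebesgue. \<phi> t * ?p t)" .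
    qed
    also have "(LINT t:{t1<..t2}|lebesgue. ?p t) = (LBINT t:{t1..t2}. ?p t)"
    proof -
      have "(LINT t:{t1<..t2}|lebesgue. ?p t) = (LBINT t:{t1<..t2}. ?p t)"
        unfolding set_lebesgue_integral_def using V.B_W_borel[OF v] by (intro integral_completion) measurable
      also have "\<dots> = (LBINT t:{t1..t2}. ?p t)"
        unfolding set_lebesgue_integral_def
      proof (rule integral_cong_AE)
        show "AE t in lborel. indicator {t1<..t2} t *\<^sub>R ?p t = indicator {t1..t2} t *\<^sub>R ?p t"
          using AE_lborel_singleton[of t1] by eventually_elim (auto simp: indicator_def)
      qed (use V.B_W_borel[OF v] in measurable)
      finally show ?thesis .
    qed
    also have "\<dots> = - (LBINT \<tau>:{t1..t2}. frac_op s (W \<tau>) v)" by (simp add: set_lebesgue_integral_def)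
    moreover have "L2_pairing \<Omega> (u t) v = (LINT x|lebesgue. u t x * v x)" if "t > 0" for t
      using uX[of t] that by (intro L2_pairing_eq[OF \<Omega>s _ v2]) (auto simp: X_space_iff sq_int_def)
    ultimately show ?thesis using t by simp
  qed
  have gL2: "AE t in lebesgue. 0 < t \<longrightarrow> (\<lambda>x. g (u t x)) \<in> L2_space \<Omega>"
  proof -
    \<comment> \<open>On (0, \<infinity>) integrability of g(u) is only local, so membership in L^2
      is collected from the intervals (0, n + 1).\<close>
    have "AE t in lebesgue. t \<in> time_interval 0 (ereal (real (Suc n))) \<longrightarrow> (\<lambda>x. g (u t x)) \<in> L2_space \<Omega>" for n
    proof -
      have "(\<lambda>t x. g (u t x)) \<in> bochner_Lp 2 (time_interval 0 (ereal (real (Suc n)))) (L2_space \<Omega>) (L2_norm \<Omega>)"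
        using gL unfolding bochner_Lp_loc_def by (simp del: of_nat_Suc)
      then obtain q :: "nat \<Rightarrow> real \<Rightarrow> 'a \<Rightarrow> real" where "AE t in lebesgue. t \<in> time_interval 0 (ereal (real (Suc n))) \<longrightarrow>
          (\<lambda>x. g (u t x)) \<in> L2_space \<Omega> \<and> (\<lambda>n. L2_norm \<Omega> (\<lambda>x. g (u t x) - q n t x)) \<longlonglongrightarrow> 0"
        unfolding bochner_Lp_def strongly_measurable_on_def by blast
      then show ?thesis by eventually_elim blast
    qed
    then have "AE t in lebesgue. \<forall>n. t \<in> time_interval 0 (ereal (real (Suc n))) \<longrightarrow> (\<lambda>x. g (u t x)) \<in> L2_space \<Omega>"
      unfolding AE_all_countable by blast
    then show ?thesis
    proof eventually_elim
      case (elim t)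
      show ?case
      proof
        assume t: "0 < t"
        obtain n where "t < real n" using reals_Archimedean2 by blast
        then have "t < real (Suc n)" by simp
        then have "t \<in> time_interval 0 (ereal (real (Suc n)))" using t by (simp add: time_interval_def)
        with elim show "(\<lambda>x. g (u t x)) \<in> L2_space \<Omega>" by blast
      qed
    qed
  qed
  have potential: "AE t in lebesgue. 0 < t \<longrightarrow> (\<lambda>x. g (u t x)) \<in> L2_space \<Omega> \<and>
      (\<forall>v\<in>X_space \<Omega> \<sigma>. (LINT x|lebesgue. W t x * v x) = frac_op \<sigma> (u t) v + (LINT x|lebesgue. g (u t x) * v x))"
    using eqs Ww gL2
  proof eventually_elim
    case (elim t)
    show ?case
    proof (intro impI conjI ballI)
      assume t: "0 < t"
      then show gt: "(\<lambda>x. g (u t x)) \<in> L2_space \<Omega>" using elim by blast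
      fix v assume v: "v \<in> X_space \<Omega> \<sigma>"
      have "L2_pairing \<Omega> (W t) v = (LINT x|lebesgue. W t x * v x)"
        using V.W_mem[of t] by (intro L2_pairing_eq[OF \<Omega>s _ X_space_L2[OF v]]) (auto simp: X_space_iff sq_int_def)
      moreover have "L2_pairing \<Omega> (\<lambda>x. g (u t x)) v = (LINT x|lebesgue. g (u t x) * v x)"
        using L2_space_sq_int[OF gt] by (intro L2_pairing_eq[OF \<Omega>s _ X_space_L2[OF v]]) (auto simp: sq_int_def)
      ultimately show "(LINT x|lebesgue. W t x * v x) = frac_op \<sigma> (u t) v + (LINT x|lebesgue. g (u t x) * v x)"
        using elim t v by simp
    qed
  qed
  interpret ch_energy \<Omega> s \<sigma> lam g u c N e W D
    by unfold_locales (fact \<Omega> s \<sigma> assms(9) g_mono uX u_weak curve evolution potential)+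
  show ?thesis
    unfolding I
  proof (intro exI[of _ u'] conjI allI impI)
    show "has_weak_time_derivative \<Omega> s {0<..} u u'" by (rule u'(1))
    fix t\<^sub>0 :: real assume t0: "0 < t\<^sub>0"
    obtain z where z: "z \<in> bochner_Lp 2 {t\<^sub>0<..} (X_space \<Omega> \<sigma>) (X_norm \<sigma>)"
      and zW: "AE t in lebesgue. t\<^sub>0 < t \<longrightarrow> (\<forall>\<phi>\<in>X_space \<Omega> s. - frac_op s (W t) \<phi> = L2_pairing \<Omega> (z t) \<phi>)"
      using velocity_in_X[OF t0] by blast
    have "AE t in lebesgue. t \<in> {t\<^sub>0<..} \<longrightarrow> (\<forall>v\<in>X_space \<Omega> s. u' t v = L2_pairing \<Omega> (z t) v)"
      using zW u'W by eventually_elim (use t0 in auto)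
    with z show "dual_valued_in_Lp_X 2 {t\<^sub>0<..} \<Omega> s \<sigma> u'"
      unfolding dual_valued_in_Lp_X_def by blast
    obtain K where K: "AE t in lebesgue. t\<^sub>0 < t \<longrightarrow> X_norm s (W t) \<le> K" using W_bounded[OF t0] by blast
    have sub: "{t\<^sub>0<..} \<subseteq> {0<..}" "{t\<^sub>0<..} \<in> sets lebesgue" using t0 by auto
    have "AE t in lebesgue. t \<in> {t\<^sub>0<..} \<longrightarrow> X_norm s (w t) \<le> K"
      using K Ww by eventually_elim (use t0 in auto)
    then show "w \<in> bochner_Linfty {t\<^sub>0<..} (X_space \<Omega> s) (X_norm s)"
      using strongly_measurable_on_subset[OF _ sub] wL unfolding bochner_Linfty_def bochner_Lp_def by blast
    \<comment> \<open>Almost everywhere u' t is minus the pairing with W t, so by Cauchy-Schwarz its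
      dual norm is at most the norm of W t.\<close>
    have "AE t in lebesgue. t \<in> {t\<^sub>0<..} \<longrightarrow> X_dual_norm \<Omega> s (u' t) \<le> K"
      using K u'W
    proof eventually_elim
      case (elim t)
      show ?case
      proof
        assume "t \<in> {t\<^sub>0<..}"
        then have t: "t\<^sub>0 < t" "0 < t" using t0 by auto
        show "X_dual_norm \<Omega> s (u' t) \<le> K"
          unfolding dual_norm_def
        proof (rule cSUP_least)
          have "X_norm s (\<lambda>x::'a. 0) = 0"
            using S.B_zero_left[OF S.zero_mem] by (simp add: X_norm_def)
          then show "{v \<in> X_space \<Omega> s. X_norm s v \<le> 1} \<noteq> {}" using S.zero_mem by force
          fix v assume "v \<in> {v \<in> X_space \<Omega> s. X_norm s v \<le> 1}"
          then have v: "v \<in> X_space \<Omega> s" "S.nrm v \<le> 1" by (auto simp: nrm_s)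
          have "\<bar>u' t v\<bar> = \<bar>frac_op s (W t) v\<bar>" using elim(2) t v by simp
          also have "\<dots> \<le> S.nrm (W t) * S.nrm v" by (rule S.cauchy_schwarz[OF V.W_mem v(1)])
          also have "\<dots> \<le> S.nrm (W t) * 1" by (rule mult_left_mono[OF v(2) S.nrm_nonneg[OF V.W_mem]])
          finally show "\<bar>u' t v\<bar> \<le> K" using elim(1) t by (simp add: nrm_s)
        qed
      qed
    qed
    then show "u' \<in> bochner_Linfty {t\<^sub>0<..} (X_dual \<Omega> s) (X_dual_norm \<Omega> s)"
      using strongly_measurable_on_subset[OF _ sub] u'(2) unfolding bochner_Linfty_def bochner_Lp_def by blast
  qed
qed

end
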